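(* Let $F=F(N,\mathcal D)$ be a connected generalized Sierpiński carpet. Then $F$ has a cut point if and only if $\chi(\Gamma_k)\ge |\mathcal D|^{k-1}-1$ for all integers $k\ge 2$.
   Context: Let $N\ge 2$ and let $\mathcal D\subset\{0,1,\dots,N-1\}^2$ with $1<|\mathcal D|<N^2$. For $i\in\{0,\dots,N-1\}^2$ let $\varphi_i(x)=\frac1N(x+i)$ on $\mathbb R^2$. The generalized Sierpiński carpet (GSC) $F=F(N,\mathcal D)$ is the unique nonempty compact set with $F=\bigcup_{i\in\mathcal D}\varphi_i(F)$. For $k\ge1$, $\mathcal D^k$ is the set of words $i_1\cdots i_k$ with $i_j\in\mathcal D$, and $\varphi_{i_1\cdots i_k}=\varphi_{i_1}\circ\cdots\circ\varphi_{i_k}$. The $k$-th Hata graph $\Gamma_k$ has vertex set $\mathcal D^k$, with an edge between distinct $\mathbf i,\mathbf j$ iff $\varphi_{\mathbf i}(F)\cap\varphi_{\mathbf j}(F)\neq\varnothing$. For a connected graph $G$, a vertex $v$ is a cut vertex if $G-\{v\}$ (delete $v$ and its incident edges) is disconnected; if $G_1(v),\dots,G_m(v)$ are the components of $G-\{v\}$ ordered so that $|G_1(v)|\ge|G_2(v)|\ge\cdots$ (number of vertices), set $\chi(G)=\max\{|G_2(v)|: v \text{ a cut vertex}\}$, and $\chi(G)=0$ if $G$ has no cut vertex. A cut point of a connected space $X$ is a point $x$ with $X\setminus\{x\}$ disconnected. *)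

theory Defs
  imports "HOL-Analysis.Analysis" "HOL-Library.Multiset"
begin

type_synonym digit = "nat \<times> nat"

definition gsc_map :: "nat \<Rightarrow> digit \<Rightarrow> real \<times> real \<Rightarrow> real \<times> real" where
  "gsc_map N i x = (1 / real N) *\<^sub>R (x + (real (fst i), real (snd i)))"

definition gsc :: "nat \<Rightarrow> digit set \<Rightarrow> (real \<times> real) set" where
  "gsc N D = (THE F. compact F \<and> F \<noteq> {} \<and> F = (\<Union>i\<in>D. gsc_map N i ` F))"

definition words :: "digit set \<Rightarrow> nat \<Rightarrow> digit list set" where
  "words D k = {w. length w = k \<and> set w \<subseteq> D}"

definition word_map :: "nat \<Rightarrow> digit list \<Rightarrow> real \<times> real \<Rightarrow> real \<times> real" where
  "word_map N w = foldr (\<lambda>i f. gsc_map N i \<circ> f) w id"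

text \<open>Edge relation of the k-th Hata graph (vertex set: words D k).\<close>
definition hata_edge :: "nat \<Rightarrow> digit set \<Rightarrow> digit list \<Rightarrow> digit list \<Rightarrow> bool" where
  "hata_edge N D u v \<longleftrightarrow> u \<noteq> v \<and> word_map N u ` gsc N D \<inter> word_map N v ` gsc N D \<noteq> {}"

text \<open>Graphs are given by a finite vertex set V and an edge relation E.
  Components of the induced subgraph on S.\<close>
definition gcomp :: "('a \<Rightarrow> 'a \<Rightarrow> bool) \<Rightarrow> 'a set \<Rightarrow> 'a \<Rightarrow> 'a set" where
  "gcomp E S x = {y \<in> S. (\<lambda>a b. a \<in> S \<and> b \<in> S \<and> E a b)\<^sup>*\<^sup>* x y}"

definition gcomponents :: "('a \<Rightarrow> 'a \<Rightarrow> bool) \<Rightarrow> 'a set \<Rightarrow> 'a set set" where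
  "gcomponents E S = gcomp E S ` S"

definition cut_vertex :: "'a set \<Rightarrow> ('a \<Rightarrow> 'a \<Rightarrow> bool) \<Rightarrow> 'a \<Rightarrow> bool" where
  "cut_vertex V E v \<longleftrightarrow> v \<in> V \<and> card (gcomponents E (V - {v})) \<ge> 2"

definition second_comp_size :: "'a set \<Rightarrow> ('a \<Rightarrow> 'a \<Rightarrow> bool) \<Rightarrow> 'a \<Rightarrow> nat" where
  "second_comp_size V E v =
     rev (sorted_list_of_multiset (image_mset card (mset_set (gcomponents E (V - {v}))))) ! 1"

definition chi :: "'a set \<Rightarrow> ('a \<Rightarrow> 'a \<Rightarrow> bool) \<Rightarrow> nat" where
  "chi V E = (if \<exists>v. cut_vertex V E v
              then Max {second_comp_size V E v | v. cut_vertex V E v} else 0)"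

definition cut_point :: "'a::topological_space set \<Rightarrow> 'a \<Rightarrow> bool" where
  "cut_point X x \<longleftrightarrow> x \<in> X \<and> \<not> connected (X - {x})"

end

theory Submission
  imports Defs
begin

text \<open>
  Edges of \<open>\<Gamma>\<^sub>k\<close> lift to all deeper levels, and each first-level block \<open>i D^(k-1)\<close> is connected, so a large second
  component means that one word separates two first-level blocks (possibly with that word itself removed).

  If this happens for all \<open>k\<close>, the cells of the deleted words accumulate at a point \<open>x\<close>. Were \<open>F - {x}\<close> connected,
  two blocks would be joined by a finite chain of cells that avoid \<open>x\<close>, hence avoid the deleted cell for large \<open>k\<close>.

  Conversely, let \<open>F\<close> have a cut point. A planar argument at grid points shows that for arbitrarily large \<open>K\<close> deleting a
  single word of level \<open>K\<close> separates two fixed cells. If some block meets the union of the other blocks in one point only,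
  the cells around that point show where to delete a word. Otherwise suppose that at some level no word separates two
  other first-level blocks. Then for a word \<open>w = i\<^sub>0 i\<^sub>1 \<dots>\<close> the layers
  \<open>L\<^sub>s = {i\<^sub>0 \<dots> i\<^sub>s\<^sub>-\<^sub>1 a \<dots> | a \<noteq> i\<^sub>s}\<close> remain connected after deleting \<open>w\<close>. If consecutive layers were not linked,
  the contact set of \<open>i\<^sub>0\<close> with its neighbours would lie in the subcell \<open>i\<^sub>0 i\<^sub>1\<close>, and either it would lie in
  \<open>i\<^sub>0 i\<^sub>1 i\<^sub>2\<close>, or the contact set of \<open>i\<^sub>1\<close> would lie in \<open>i\<^sub>1 i\<^sub>2\<close>. The base-\<open>N\<close> expansions of the points common to
  two opposite sides of \<open>F\<close> exclude this, so all layers are linked and no word of a deep level separates the two cells.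
\<close>

subsection \<open>Components of finite graphs\<close>

text \<open>The bound \<open>card D ^ (k - 1) - 1\<close> is the size of a first-level block that
  has lost one word. Starting from a cut point, there are two ways to reach it. Usually two intact
  blocks get separated (\<open>separates\<close>). This property passes from a level to every
  smaller positive level, because a prefix deletes a larger cell, so arbitrarily deep separating
  words are enough. A leaf block, which touches the rest in one point, may instead have to lose one
  of its own words and become a component by itself; hence the \<open>- 1\<close>. Two digits are
  treated apart because the leaf argument wants a third block. The obstacle on the way to separating
  words is that a cut point may lie in up to four cells of a level while only one can be deleted.
  Deep levels are therefore chosen where either a single cell contains the point or no cell is cut
  by it. In the latter case planarity forbids two cells against two, so one deletion leaves a single
  side at the point.\<close>

definition conn :: "('a \<Rightarrow> 'a \<Rightarrow> bool) \<Rightarrow> 'a set \<Rightarrow> 'a \<Rightarrow> 'a \<Rightarrow> bool" where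
  "conn E S = (\<lambda>a b. a \<in> S \<and> b \<in> S \<and> E a b)\<^sup>*\<^sup>*"

lemma conn_refl [simp, intro]: "conn E S x x"
  by (simp add: conn_def)

lemma conn_trans [trans]: "conn E S x y \<Longrightarrow> conn E S y z \<Longrightarrow> conn E S x z"
  by (simp add: conn_def)

lemma conn_edge: "x \<in> S \<Longrightarrow> y \<in> S \<Longrightarrow> E x y \<Longrightarrow> conn E S x y"
  by (auto simp: conn_def)

lemma conn_sym:
  assumes "symp E" "conn E S x y"
  shows "conn E S y x"
proof -
  have "symp (\<lambda>a b. a \<in> S \<and> b \<in> S \<and> E a b)"
    using assms(1) by (auto simp: symp_def)
  from sympD[OF symp_rtranclp[OF this]] assms(2) show ?thesis
    by (simp add: conn_def)
qed

lemma conn_induct [consumes 1, case_names refl step]: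
  assumes "conn E S x y" "P x"
    and "\<And>y z. conn E S x y \<Longrightarrow> y \<in> S \<Longrightarrow> z \<in> S \<Longrightarrow> E y z \<Longrightarrow> P y \<Longrightarrow> P z"
  shows "P y"
  using assms(1) unfolding conn_def
  by (induction rule: rtranclp_induct) (use assms(2,3) in \<open>auto simp: conn_def\<close>)

lemma gcomp_conn: "gcomp E S x = {y \<in> S. conn E S x y}"
  by (simp add: gcomp_def conn_def)

lemma gcomp_eqI:
  assumes "symp E" "conn E S x y"
  shows "gcomp E S x = gcomp E S y"
  unfolding gcomp_conn using assms conn_sym[OF assms] conn_trans by (metis (no_types, lifting))

text \<open>A path enters and leaves \<open>v\<close> through neighbours that are equal or adjacent,
  so the visit can be cut out.\<close>

lemma conn_delete_vertex:
  assumes "symp E" "irreflp E"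
    and nbrs: "\<And>n n'. n \<in> S \<Longrightarrow> n' \<in> S \<Longrightarrow> E v n \<Longrightarrow> E v n' \<Longrightarrow> n \<noteq> n' \<Longrightarrow> E n n'"
    and ab: "conn E S a b" and "a \<in> S" "a \<noteq> v" "b \<noteq> v"
  shows "conn E (S - {v}) a b"
proof -
  \<comment> \<open>While the path stands at \<open>v\<close>, the induction remembers the neighbour
    from which it came.\<close>
  have "(b \<noteq> v \<longrightarrow> conn E (S - {v}) a b) \<and>
        (b = v \<longrightarrow> (\<exists>n\<in>S. E v n \<and> conn E (S - {v}) a n))"
    using ab
  proof (induction rule: conn_induct)
    case refl
    then show ?case using assms by simp
  next
    case (step y z)
    have nv: "\<not> E v v" using assms(2) by (auto simp: irreflp_def)
    have yz: "E z y" using step assms(1) by (auto dest: sympD)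
    show ?case
    proof (cases "y = v")
      case True
      then have zv: "z \<noteq> v" using nv step by auto
      obtain n where n: "n \<in> S" "E v n" "conn E (S - {v}) a n"
        using step True by auto
      show ?thesis
      proof (cases "n = z")
        case False
        then have "E n z" using nbrs[of n z] n step True by auto
        moreover have "n \<noteq> v" using n nv by auto
        ultimately have "conn E (S - {v}) n z"
          using n step zv by (intro conn_edge) auto
        then show ?thesis using n zv conn_trans by metis
      qed (use n zv in auto)
    next
      case False
      then have ay: "conn E (S - {v}) a y" using step by auto
      show ?thesis
      proof (cases "z = v")
        case True
        then show ?thesis using ay yz step by auto
      next
        case zv: False
        then have "conn E (S - {v}) y z" using False step by (intro conn_edge) auto
        then show ?thesis using ay zv conn_trans by metis
      qed
    qed
  qed
  then show ?thesis using assms by auto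
qed

text \<open>In the list of multiplicities below, position \<open>1\<close> of the decreasing list is the second largest value.\<close>

lemma second_largest_ge_iff:
  fixes M :: "nat multiset"
  assumes "size M \<ge> 2"
  shows "n \<le> rev (sorted_list_of_multiset M) ! 1 \<longleftrightarrow> (\<exists>a b. {#a, b#} \<subseteq># M \<and> n \<le> a \<and> n \<le> b)"
proof -
  define xs where "xs = rev (sorted_list_of_multiset M)"
  have xsM: "mset xs = M" by (simp add: xs_def)
  have srt: "sorted (rev xs)" by (simp add: xs_def)
  have len: "length xs \<ge> 2" using assms xsM by (metis size_mset)
  then obtain x y zs where xs: "xs = x # y # zs"
    by (metis One_nat_def Suc_1 Suc_le_length_iff)
  have yx: "y \<le> x" and zy: "\<forall>z\<in>set zs. z \<le> y"
    using srt unfolding xs by (auto simp: sorted_append)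
  have "n \<le> y \<longleftrightarrow> (\<exists>a b. {#a, b#} \<subseteq># M \<and> n \<le> a \<and> n \<le> b)"
  proof
    assume "n \<le> y"
    moreover have "{#x, y#} \<subseteq># M" unfolding xsM[symmetric] xs by (simp add: mset_subset_eq_insertD)
    ultimately show "\<exists>a b. {#a, b#} \<subseteq># M \<and> n \<le> a \<and> n \<le> b" using yx by force
  next
    assume "\<exists>a b. {#a, b#} \<subseteq># M \<and> n \<le> a \<and> n \<le> b"
    then obtain a b where ab: "{#a, b#} \<subseteq># M" "n \<le> a" "n \<le> b" by blast
    show "n \<le> y"
    proof (rule ccontr)
      assume "\<not> n \<le> y"
      then have "a > y" "b > y" using ab by auto
      \<comment> \<open>Only the head \<open>x\<close> of the list can exceed \<open>y\<close>, so
        two entries above \<open>y\<close> do not fit into \<open>M\<close>.\<close>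
      have sub: "filter_mset (\<lambda>u. u > y) {#a, b#} \<subseteq># filter_mset (\<lambda>u. u > y) M"
        using ab(1) by (rule multiset_filter_mono)
      have emp: "filter_mset (\<lambda>u. u > y) (mset zs) = {#}"
        using zy by (induction zs) auto
      have "filter_mset (\<lambda>u. u > y) M \<subseteq># {#x#}"
        unfolding xsM[symmetric] xs by (simp add: emp)
      with sub have "size (filter_mset (\<lambda>u. u > y) {#a, b#}) \<le> size {#x#}"
        using size_mset_mono subset_mset.order_trans by metis
      then show False using \<open>a > y\<close> \<open>b > y\<close> by simp
    qed
  qed
  then show ?thesis unfolding xs_def[symmetric] by (simp add: xs)
qed

text \<open>The sizes form a multiset in which components of equal size are counted separately, so a
  pair of entries corresponds to two distinct components.\<close>

lemma second_comp_size_ge_iff: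
  assumes "finite V" "cut_vertex V E v"
  shows "n \<le> second_comp_size V E v \<longleftrightarrow>
    (\<exists>C1\<in>gcomponents E (V - {v}). \<exists>C2\<in>gcomponents E (V - {v}). C1 \<noteq> C2 \<and> n \<le> card C1 \<and> n \<le> card C2)"
proof -
  let ?G = "gcomponents E (V - {v})"
  have fin: "finite ?G" using assms(1) by (simp add: gcomponents_def)
  have "size (image_mset card (mset_set ?G)) \<ge> 2"
    using assms(2) by (simp add: cut_vertex_def)
  note iff = second_largest_ge_iff[OF this, of n]
  show ?thesis
    unfolding second_comp_size_def iff
  proof
    assume "\<exists>a b. {#a, b#} \<subseteq># image_mset card (mset_set ?G) \<and> n \<le> a \<and> n \<le> b"
    then obtain a b where ab: "{#a, b#} \<subseteq># image_mset card (mset_set ?G)" "n \<le> a" "n \<le> b" by blast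
    then obtain X where X: "X \<subseteq># mset_set ?G" "image_mset card X = {#a, b#}"
      by (metis image_mset_eq_plusD subset_mset.less_eqE mset_subset_eq_add_left)
    from X(2) obtain C1 C2 where C: "X = {#C1, C2#}" "card C1 = a" "card C2 = b"
      by (auto dest!: msed_map_invR)
    have "C1 \<noteq> C2"
    proof
      assume "C1 = C2"
      then have "count X C1 = 2" using C by simp
      then show False
        using X(1) fin by (metis One_nat_def Suc_1 count_mset_set(1,2,3) mset_subset_eq_count not_less_eq_eq le0 order_refl)
    qed
    moreover have "C1 \<in> ?G" "C2 \<in> ?G"
      using X(1) C fin by (auto dest!: set_mset_mono)
    ultimately show "\<exists>C1\<in>?G. \<exists>C2\<in>?G. C1 \<noteq> C2 \<and> n \<le> card C1 \<and> n \<le> card C2"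
      using C ab by blast
  next
    assume "\<exists>C1\<in>?G. \<exists>C2\<in>?G. C1 \<noteq> C2 \<and> n \<le> card C1 \<and> n \<le> card C2"
    then obtain C1 C2 where C: "C1 \<in> ?G" "C2 \<in> ?G" "C1 \<noteq> C2" "n \<le> card C1" "n \<le> card C2" by blast
    have "mset_set {C1, C2} \<subseteq># mset_set ?G"
      by (rule subset_imp_msubset_mset_set) (use C fin in auto)
    then have "image_mset card (mset_set {C1, C2}) \<subseteq># image_mset card (mset_set ?G)"
      by (rule image_mset_subseteq_mono)
    then have "{#card C1, card C2#} \<subseteq># image_mset card (mset_set ?G)"
      using C(3) by simp
    then show "\<exists>a b. {#a, b#} \<subseteq># image_mset card (mset_set ?G) \<and> n \<le> a \<and> n \<le> b"
      using C by blast
  qed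
qed

text \<open>\<open>n \<ge> 1\<close> rules out the default value 0 that \<open>chi\<close> has when
  there is no cut vertex.\<close>

lemma chi_ge_iff:
  assumes "finite V" "n \<ge> 1"
  shows "n \<le> chi V E \<longleftrightarrow> (\<exists>v\<in>V. \<exists>C1\<in>gcomponents E (V - {v}). \<exists>C2\<in>gcomponents E (V - {v}).
           C1 \<noteq> C2 \<and> n \<le> card C1 \<and> n \<le> card C2)"
proof -
  have cut: "cut_vertex V E v"
    if "v \<in> V" "C1 \<in> gcomponents E (V - {v})" "C2 \<in> gcomponents E (V - {v})" "C1 \<noteq> C2" for v C1 C2
  proof -
    have "card {C1, C2} \<le> card (gcomponents E (V - {v}))"
      using that assms(1) by (intro card_mono) (auto simp: gcomponents_def)
    then show ?thesis using that by (auto simp: cut_vertex_def)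
  qed
  have fin: "finite {second_comp_size V E v | v. cut_vertex V E v}"
    by (rule finite_subset[of _ "second_comp_size V E ` V"]) (use assms in \<open>auto simp: cut_vertex_def\<close>)
  have "n \<le> chi V E \<longleftrightarrow> (\<exists>v. cut_vertex V E v \<and> n \<le> second_comp_size V E v)"
  proof (cases "\<exists>v. cut_vertex V E v")
    case True
    then have "{second_comp_size V E v | v. cut_vertex V E v} \<noteq> {}" by auto
    from Max_ge_iff[OF fin this] True show ?thesis unfolding chi_def by auto
  next
    case False
    then show ?thesis using assms unfolding chi_def by auto
  qed
  also have "\<dots> \<longleftrightarrow> (\<exists>v\<in>V. \<exists>C1\<in>gcomponents E (V - {v}). \<exists>C2\<in>gcomponents E (V - {v}).
           C1 \<noteq> C2 \<and> n \<le> card C1 \<and> n \<le> card C2)"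
    using second_comp_size_ge_iff[OF assms(1)] cut by (metis cut_vertex_def)
  finally show ?thesis .
qed

subsection \<open>Coordinates and base-\<open>N\<close> positions\<close>

text \<open>Directions are indexed by a Boolean, so that one argument with \<open>c\<close> and
  \<open>\<not> c\<close> covers the horizontal and the vertical case.\<close>

definition crd :: "bool \<Rightarrow> 'a \<times> 'a \<Rightarrow> 'a" where
  "crd c z = (if c then fst z else snd z)"

definition pt :: "bool \<Rightarrow> 'a \<Rightarrow> 'a \<Rightarrow> 'a \<times> 'a" where
  "pt c a b = (if c then (a, b) else (b, a))"

lemma crd_pt [simp]: "crd c (pt c a b) = a" "crd (\<not> c) (pt c a b) = b"
  by (auto simp: crd_def pt_def)

lemma pt_crd [simp]: "pt c (crd c z) (crd (\<not> c) z) = z"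
  by (auto simp: crd_def pt_def)

lemma crd_eqI: "(\<And>c. crd c z = crd c z') \<Longrightarrow> z = z'"
  unfolding crd_def by (metis prod_eq_iff)

lemma crd_eqI2: "crd c z = crd c z' \<Longrightarrow> crd (\<not> c) z = crd (\<not> c) z' \<Longrightarrow> z = z'"
  by (metis pt_crd)

lemma crd_eqI3: "crd c z = a \<Longrightarrow> crd (\<not> c) z = b \<Longrightarrow> z = pt c a b"
  by (metis pt_crd)

lemma pt_inject: "pt c a b = pt c a' b' \<longleftrightarrow> a = a' \<and> b = b'"
  by (auto simp: pt_def)

lemma pt_not: "pt (\<not> c) a b = pt c b a"
  by (simp add: pt_def)

lemma pt_fun: "pt True (g True) (g False) = pt c (g c) (g (\<not> c))"
  by (cases c) (auto simp: pt_def)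

lemma all_crd_iff: "(\<forall>c'. P c') \<longleftrightarrow> P c \<and> P (\<not> c)" for P :: "bool \<Rightarrow> bool"
  by (cases c) (auto simp: all_bool_eq)

lemma crd_gsc_map: "crd c (gsc_map N i x) = (crd c x + real (crd c i)) / real N"
  by (cases x) (auto simp: gsc_map_def crd_def)

lemma word_map_simps [simp]:
  "word_map N [] = id" "word_map N (i # w) = gsc_map N i \<circ> word_map N w"
  by (auto simp: word_map_def)

lemma word_map_append: "word_map N (u @ v) = word_map N u \<circ> word_map N v"
  by (induction u) (auto simp: comp_assoc)

text \<open>The base-\<open>N\<close> number spelled by the \<open>c\<close>-coordinates of the
  letters. It is the grid position of the cell, whose square starts at
  \<open>idx N c w / N ^ length w\<close>.\<close>

fun idx :: "nat \<Rightarrow> bool \<Rightarrow> digit list \<Rightarrow> int" where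
  "idx N c [] = 0"
| "idx N c (i # w) = int (crd c i) * int N ^ length w + idx N c w"

lemma crd_word_map:
  assumes "N > 0"
  shows "crd c (word_map N w x) = (crd c x + real_of_int (idx N c w)) / real N ^ length w"
  by (induction w) (use assms in \<open>auto simp: crd_gsc_map field_simps\<close>)

lemma inj_gsc_map: "N > 0 \<Longrightarrow> inj (gsc_map N i)"
  by (rule injI) (auto simp: gsc_map_def)

lemma inj_word_map: "N > 0 \<Longrightarrow> inj (word_map N w)"
  by (induction w) (auto intro: inj_compose inj_gsc_map)

lemma continuous_on_gsc_map [continuous_intros]:
  "continuous_on S f \<Longrightarrow> continuous_on S (\<lambda>x. gsc_map N i (f x))"
  unfolding gsc_map_def by (intro continuous_intros)

lemma continuous_on_word_map: "continuous_on S (word_map N w)"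
proof (induction w)
  case (Cons i w)
  then show ?case unfolding word_map_simps comp_def by (intro continuous_on_gsc_map)
qed (auto simp: continuous_on_id)

lemma dist_gsc_map: "dist (gsc_map N i x) (gsc_map N i y) = dist x y / real N"
proof -
  have "gsc_map N i x - gsc_map N i y = (1 / real N) *\<^sub>R (x - y)"
    by (simp add: gsc_map_def algebra_simps)
  then show ?thesis by (simp add: dist_norm)
qed

lemma dist_word_map: "dist (word_map N w x) (word_map N w y) = dist x y / real N ^ length w"
  by (induction w) (auto simp: dist_gsc_map)

subsection \<open>The attractor\<close>

text \<open>The largest distance from a point of \<open>G\<close> to \<open>G'\<close> is at most
  itself divided by \<open>N\<close>, since a farthest point is the image of a point that is no
  farther away.\<close>

lemma attractor_subset:
  assumes "N \<ge> 2" "compact G" "G \<noteq> {}" "G = (\<Union>i\<in>D. gsc_map N i ` G)"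
    and "compact G'" "G' \<noteq> {}" "G' = (\<Union>i\<in>D. gsc_map N i ` G')"
  shows "G \<subseteq> G'"
proof -
  have "continuous_on G (\<lambda>x. infdist x G')" by (intro continuous_intros)
  then obtain p where p: "p \<in> G" "\<And>x. x \<in> G \<Longrightarrow> infdist x G' \<le> infdist p G'"
    using continuous_attains_sup[OF assms(2,3)] by blast
  obtain i p' where i: "i \<in> D" "p' \<in> G" "p = gsc_map N i p'"
    using p(1) assms(4) by blast
  obtain g where g: "g \<in> G'" "infdist p' G' = dist p' g"
    using infdist_attains_inf[of G' p'] assms(5,6) compact_imp_closed by metis
  have "gsc_map N i g \<in> G'" using assms(7) i g by blast
  then have "infdist p G' \<le> dist (gsc_map N i p') (gsc_map N i g)"
    unfolding i(3) by (rule infdist_le)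
  also have "\<dots> = infdist p' G' / real N" by (simp add: dist_gsc_map g)
  also have "\<dots> \<le> infdist p G' / real N"
    using p(2)[OF i(2)] by (simp add: divide_right_mono)
  also have "\<dots> \<le> infdist p G' / 2"
    using assms(1) infdist_nonneg[of p G'] by (intro divide_left_mono) auto
  finally have z: "infdist p G' = 0" using infdist_nonneg[of p G'] by simp
  show ?thesis
  proof
    fix x assume "x \<in> G"
    then have "infdist x G' = 0" using p(2)[of x] z infdist_nonneg[of x G'] by simp
    then show "x \<in> G'"
      using in_closed_iff_infdist_zero[of G' x] assms(5,6) compact_imp_closed by auto
  qed
qed

text \<open>The attractor is the intersection of the iterated images of the unit square, which also
  yields the bounds on the coordinates.\<close>

lemma attractor_exists:
  assumes "N \<ge> 2" "D \<subseteq> {0..<N} \<times> {0..<N}" "D \<noteq> {}"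
  shows "\<exists>F. compact F \<and> F \<noteq> {} \<and> F = (\<Union>i\<in>D. gsc_map N i ` F) \<and>
             (\<forall>z\<in>F. \<forall>c. 0 \<le> crd c z \<and> crd c z \<le> 1)"
proof -
  define H where "H X = (\<Union>i\<in>D. gsc_map N i ` X)" for X
  define Q where "Q = cbox (0::real \<times> real) (1, 1)"
  have Q: "z \<in> Q \<longleftrightarrow> (\<forall>c. 0 \<le> crd c z \<and> crd c z \<le> 1)" for z
    by (cases z) (auto simp: Q_def crd_def mem_box Basis_prod_def zero_prod_def split: if_splits)
  have finD: "finite D" using assms(2) finite_subset by blast
  have HQ: "H Q \<subseteq> Q"
  proof
    fix z assume "z \<in> H Q"
    then obtain i x where i: "i \<in> D" "x \<in> Q" "z = gsc_map N i x" by (auto simp: H_def)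
    have "real (crd c i) + 1 \<le> real N" for c
    proof -
      have "crd c i + 1 \<le> N" using i assms(2) by (auto simp: crd_def)
      then show ?thesis by linarith
    qed
    then have "crd c x + real (crd c i) \<le> real N" for c
      using i(2) Q[of x] by (smt (verit))
    moreover have "0 \<le> crd c x" for c using i(2) Q by auto
    ultimately show "z \<in> Q" using assms(1) unfolding Q i(3) crd_gsc_map by auto
  qed
  define X where "X n = (H ^^ n) Q" for n
  have X0: "X 0 = Q" and XS: "X (Suc n) = H (X n)" for n by (auto simp: X_def)
  have mono: "H A \<subseteq> H B" if "A \<subseteq> B" for A B using that by (auto simp: H_def)
  have dec1: "X (Suc n) \<subseteq> X n" for n
    by (induction n) (use HQ mono in \<open>auto simp: X0 XS\<close>)
  have dec: "X n \<subseteq> X m" if "m \<le> n" for m n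
    using that by (induction rule: dec_induct) (use dec1 in auto)
  have comp: "compact (X n)" for n
    by (induction n) (use finD in \<open>auto simp: X0 XS H_def Q_def
        intro!: compact_UN compact_continuous_image continuous_intros\<close>)
  have ne: "X n \<noteq> {}" for n
  proof (induction n)
    case 0
    have "0 \<in> Q" using Q by (auto simp: crd_def)
    then show ?case using X0 by blast
  qed (use assms(3) in \<open>auto simp: XS H_def\<close>)
  define F where "F = (\<Inter>n. X n)"
  have F1: "F \<noteq> {}" unfolding F_def
    by (rule compact_nest[OF comp ne]) (use dec in auto)
  have F2: "compact F"
    unfolding F_def by (intro compact_Inter) (use comp in auto)
  have F3: "F = H F"
  proof
    show "H F \<subseteq> F"
    proof -
      have "H F \<subseteq> X n" for n
        using mono[of F "X n"] dec1[of n] XS[of n] by (auto simp: F_def)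
      then show ?thesis by (auto simp: F_def)
    qed
    show "F \<subseteq> H F"
    proof
      fix z assume "z \<in> F"
      then have "\<forall>n. \<exists>i\<in>D. z \<in> gsc_map N i ` X n" using XS by (fastforce simp: F_def H_def)
      then obtain f where f: "\<And>n. f n \<in> D" "\<And>n. z \<in> gsc_map N (f n) ` X n" by metis
      have "finite (range f)" using finD f(1) by (meson finite_subset image_subsetI)
      \<comment> \<open>The digit that produces \<open>z\<close> may vary with \<open>n\<close>. One
        digit recurs for arbitrarily large \<open>n\<close>, which is enough because the
        \<open>X n\<close> decrease.\<close>
      then obtain n0 where inf: "infinite {n. f n = f n0}"
        using pigeonhole_infinite[of UNIV f] by auto
      obtain x where x: "z = gsc_map N (f n0) x" using f(2) by blast
      have "x \<in> X m" for m
      proof -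
        obtain n where n: "n \<ge> m" "f n = f n0" using inf
          by (metis (mono_tags, lifting) infinite_nat_iff_unbounded_le mem_Collect_eq)
        then have "x \<in> X n" using f(2)[of n] x inj_gsc_map[of N "f n0"] assms(1)
          by (auto dest: injD)
        then show ?thesis using dec n by blast
      qed
      then show "z \<in> H F" using x f(1) by (auto simp: F_def H_def)
    qed
  qed
  have "F \<subseteq> Q" using X0 by (auto simp: F_def)
  with F1 F2 F3 Q show ?thesis unfolding H_def by blast
qed

lemma gsc_properties:
  assumes "N \<ge> 2" "D \<subseteq> {0..<N} \<times> {0..<N}" "D \<noteq> {}"
  shows "compact (gsc N D)" "gsc N D \<noteq> {}" "gsc N D = (\<Union>i\<in>D. gsc_map N i ` gsc N D)"
    and "z \<in> gsc N D \<Longrightarrow> 0 \<le> crd c z" "z \<in> gsc N D \<Longrightarrow> crd c z \<le> 1"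
proof -
  obtain F where F: "compact F" "F \<noteq> {}" "F = (\<Union>i\<in>D. gsc_map N i ` F)"
    "\<forall>z\<in>F. \<forall>c. 0 \<le> crd c z \<and> crd c z \<le> 1"
    using attractor_exists[OF assms] by blast
  have "gsc N D = F" unfolding gsc_def
  proof (rule the_equality)
    fix G :: "(real \<times> real) set"
    assume "compact G \<and> G \<noteq> {} \<and> G = (\<Union>i\<in>D. gsc_map N i ` G)"
    then show "G = F"
      using attractor_subset[OF assms(1), of G D F] attractor_subset[OF assms(1), of F D G] F by auto
  qed (use F in blast)
  with F show "compact (gsc N D)" "gsc N D \<noteq> {}" "gsc N D = (\<Union>i\<in>D. gsc_map N i ` gsc N D)"
    "z \<in> gsc N D \<Longrightarrow> 0 \<le> crd c z" "z \<in> gsc N D \<Longrightarrow> crd c z \<le> 1" by auto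
qed

lemma symp_hata_edge: "symp (hata_edge N D)"
  by (auto simp: symp_def hata_edge_def)

lemma irreflp_hata_edge: "irreflp (hata_edge N D)"
  by (auto simp: irreflp_def hata_edge_def)

section \<open>Words, cells and grid positions of a connected carpet\<close>

locale carpet =
  fixes N :: nat and D :: "digit set"
  assumes N2: "N \<ge> 2"
    and D_sub: "D \<subseteq> {0..<N} \<times> {0..<N}"
    and card_D: "1 < card D"
    and conn_F: "connected (gsc N D)"
begin

abbreviation F :: "(real \<times> real) set" where "F \<equiv> gsc N D"
abbreviation E :: "digit list \<Rightarrow> digit list \<Rightarrow> bool" where "E \<equiv> hata_edge N D"
abbreviation "W \<equiv> words D"

definition cell :: "digit list \<Rightarrow> (real \<times> real) set" where
  "cell w = word_map N w ` F"

lemma N_pos: "N > 0" using N2 by simp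

lemma finite_D: "finite D" using D_sub finite_subset by blast

lemma D_ne: "D \<noteq> {}" using card_D by auto

lemmas gsc_props = gsc_properties[OF N2 D_sub D_ne]
lemmas compact_F = gsc_props(1)
lemmas F_ne = gsc_props(2)
lemmas F_eq = gsc_props(3)
lemmas F_ge = gsc_props(4)
lemmas F_le = gsc_props(5)

lemma other_digit: obtains j where "j \<in> D" "j \<noteq> i"
  proof -
  have "\<not> D \<subseteq> {i}" using card_D card_mono[of "{i}" D] by auto
  then show thesis using that by blast
qed

lemma digit_less: "i \<in> D \<Longrightarrow> crd c i < N"
  using D_sub by (auto simp: crd_def)

lemma words_iff: "w \<in> W k \<longleftrightarrow> length w = k \<and> set w \<subseteq> D"
  by (auto simp: words_def)

lemma finite_words: "finite (W k)"
  unfolding words_def using finite_lists_length_eq[OF finite_D, of k] by (simp add: conj_commute)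

lemma card_words: "card (W k) = card D ^ k"
  unfolding words_def using card_lists_length_eq[OF finite_D, of k] by (simp add: conj_commute)

lemma words_ne: "\<exists>w. w \<in> W k"
proof -
  obtain d where "d \<in> D" using D_ne by blast
  then have "replicate k d \<in> W k" by (auto simp: words_iff)
  then show ?thesis ..
qed

lemma words_append: "u @ v \<in> W K \<longleftrightarrow> set u \<subseteq> D \<and> length u \<le> K \<and> v \<in> W (K - length u)"
  by (auto simp: words_iff)

lemma cell_Nil [simp]: "cell [] = F" by (simp add: cell_def)

lemma cell_append: "cell (u @ v) = word_map N u ` cell v"
  by (simp add: cell_def word_map_append image_comp)

lemma F_words: "F = (\<Union>w\<in>W k. cell w)"
proof (induction k)
  case 0
  have "W 0 = {[]}" by (auto simp: words_iff)
  then show ?case by simp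
next
  case (Suc k)
  have W: "W (Suc k) = (\<Union>i\<in>D. (#) i ` W k)"
    by (auto simp: words_iff length_Suc_conv image_iff)
  have "cell (i # w) = gsc_map N i ` cell w" for i w
    using cell_append[of "[i]" w] by simp
  then have "(\<Union>w\<in>W (Suc k). cell w) = (\<Union>i\<in>D. gsc_map N i ` (\<Union>w\<in>W k. cell w))"
    unfolding W by auto
  also have "\<dots> = F" using Suc F_eq by metis
  finally show ?case ..
qed

lemma cell_subset: "set u \<subseteq> D \<Longrightarrow> cell u \<subseteq> F"
  using F_words[of "length u"] by (auto simp: words_iff)

lemma cell_append_subset: "set v \<subseteq> D \<Longrightarrow> cell (u @ v) \<subseteq> cell u"
  unfolding cell_append using cell_subset[of v] by (auto simp: cell_def)

lemma cell_split: "cell u = (\<Union>v\<in>W n. cell (u @ v))"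
proof -
  have "(\<Union>v\<in>W n. cell (u @ v)) = word_map N u ` (\<Union>v\<in>W n. cell v)" by (auto simp: cell_append)
  also have "(\<Union>v\<in>W n. cell v) = F" by (rule F_words[symmetric])
  finally show ?thesis by (simp add: cell_def)
qed

lemma cell_refine:
  assumes "z \<in> cell u" obtains v where "v \<in> W n" "z \<in> cell (u @ v)"
  using assms cell_split[of u n] by blast

lemma compact_cell: "compact (cell w)"
  unfolding cell_def by (intro compact_continuous_image continuous_on_word_map compact_F)

lemma closed_cell: "closed (cell w)" using compact_cell compact_imp_closed by blast

lemma connected_cell: "connected (cell w)"
  unfolding cell_def by (intro connected_continuous_image continuous_on_word_map conn_F)

lemma cell_ne: "cell w \<noteq> {}" using F_ne by (simp add: cell_def)

lemma mem_cell_iff: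
  "z \<in> cell w \<longleftrightarrow> (\<exists>y\<in>F. \<forall>c. real N ^ length w * crd c z = crd c y + real_of_int (idx N c w))"
proof -
  have "z = word_map N w y \<longleftrightarrow> (\<forall>c. real N ^ length w * crd c z = crd c y + real_of_int (idx N c w))" for y
  proof -
    have "z = word_map N w y \<longleftrightarrow> (\<forall>c. crd c z = crd c (word_map N w y))"
      using crd_eqI by metis
    also have "\<dots> \<longleftrightarrow> (\<forall>c. real N ^ length w * crd c z = crd c y + real_of_int (idx N c w))"
      using N_pos by (simp add: crd_word_map field_simps)
    finally show ?thesis .
  qed
  then show ?thesis unfolding cell_def by blast
qed

lemma idx_nonneg: "0 \<le> idx N c w" by (induction w) auto

lemma idx_less: "set w \<subseteq> D \<Longrightarrow> idx N c w < int N ^ length w"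
proof (induction w)
  case (Cons i w)
  have "int (crd c i) + 1 \<le> int N" using Cons.prems digit_less[of i c] by auto
  then have "(int (crd c i) + 1) * int N ^ length w \<le> int N * int N ^ length w"
    by (intro mult_right_mono) auto
  then show ?case using Cons by (simp add: algebra_simps)
qed simp

lemma idx_eq_imp_map_eq:
  assumes "set u \<subseteq> D" "set v \<subseteq> D" "length u = length v" "idx N c u = idx N c v"
  shows "map (crd c) u = map (crd c) v"
  using assms(3,1,2,4)
proof (induction u v rule: list_induct2)
  case (Cons i u j v)
  let ?M = "int N ^ length u"
  have eq: "int (crd c i) * ?M + idx N c u = int (crd c j) * ?M + idx N c v"
    using Cons.prems(3) Cons.hyps by simp
  have b: "0 \<le> idx N c u" "idx N c u < ?M" "0 \<le> idx N c v" "idx N c v < ?M"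
    using idx_nonneg idx_less[of u c] idx_less[of v c] Cons by auto
  have "?M > 0" using N_pos by simp
  then have dv: "(a * ?M + r) div ?M = a" if "0 \<le> r" "r < ?M" for a r
    using that by (simp add: div_pos_pos_trivial)
  have "int (crd c i) = (int (crd c i) * ?M + idx N c u) div ?M"
    using dv b by simp
  also have "\<dots> = int (crd c j)" unfolding eq using dv b by simp
  finally show ?case using eq Cons by simp
qed simp

lemma idx_inj:
  assumes "set u \<subseteq> D" "set v \<subseteq> D" "length u = length v" "\<And>c. idx N c u = idx N c v"
  shows "u = v"
proof (rule nth_equalityI)
  fix k assume k: "k < length u"
  show "u ! k = v ! k"
  proof (rule crd_eqI)
    fix c
    show "crd c (u ! k) = crd c (v ! k)"
      using idx_eq_imp_map_eq[OF assms(1-4), of c] k assms(3) by (metis nth_map)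
  qed
qed (use assms in simp)

lemma idx_inj2:
  assumes "u \<in> W k" "v \<in> W k" "idx N c u = idx N c v" "idx N (\<not> c) u = idx N (\<not> c) v"
  shows "u = v"
proof (rule idx_inj)
  have "\<forall>c'. idx N c' u = idx N c' v" using assms(3,4) unfolding all_crd_iff[of _ c] ..
  then show "\<And>c'. idx N c' u = idx N c' v" by blast
qed (use assms in \<open>auto simp: words_iff\<close>)

lemma dist_cell:
  assumes "x \<in> cell w" "y \<in> cell w"
  shows "dist x y \<le> 2 / real N ^ length w"
proof -
  obtain a b where ab: "a \<in> F" "b \<in> F" "x = word_map N w a" "y = word_map N w b"
    using assms by (auto simp: cell_def)
  \<comment> \<open>The constant 2 bounds the unit square in the sum norm.\<close>
  have "dist a b \<le> \<bar>crd True a - crd True b\<bar> + \<bar>crd False a - crd False b\<bar>"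
    unfolding dist_norm crd_def norm_prod_def using sqrt_sum_squares_le_sum_abs by simp
  also have "\<dots> \<le> 2"
    using F_ge[OF ab(1), of True] F_le[OF ab(1), of True] F_ge[OF ab(2), of True] F_le[OF ab(2), of True]
      F_ge[OF ab(1), of False] F_le[OF ab(1), of False] F_ge[OF ab(2), of False] F_le[OF ab(2), of False]
    by linarith
  finally show ?thesis unfolding ab dist_word_map using N_pos by (simp add: divide_right_mono)
qed

lemma cells_small:
  assumes "e > 0" obtains n where "\<And>w k x y. k \<ge> n \<Longrightarrow> length w = k \<Longrightarrow> x \<in> cell w \<Longrightarrow> y \<in> cell w \<Longrightarrow> dist x y < e"
proof -
  have N1: "real N > 1" using N2 by simp
  obtain n where n: "2 / e < real N ^ n" using real_arch_pow[OF N1] by blast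
  show thesis
  proof (rule that[of n])
    fix w k x y assume k: "k \<ge> n" "length w = k" "x \<in> cell w" "y \<in> cell w"
    have "real N ^ n \<le> real N ^ k" using k(1) N1 by (intro power_increasing) auto
    with n have "2 / e < real N ^ k" by linarith
    then have "2 / real N ^ k < e" using assms N_pos by (simp add: field_simps)
    with dist_cell[OF k(3,4)] k(2) show "dist x y < e" by simp
  qed
qed

lemma cell_avoiding:
  assumes "z \<in> cell r" "z \<noteq> x"
  obtains u where "set u \<subseteq> D" "z \<in> cell (r @ u)" "x \<notin> cell (r @ u)"
proof -
  obtain n where n: "\<And>w k a b. k \<ge> n \<Longrightarrow> length w = k \<Longrightarrow> a \<in> cell w \<Longrightarrow> b \<in> cell w \<Longrightarrow> dist a b < dist z x"
    using cells_small[of "dist z x"] assms(2) by auto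
  obtain u where u: "u \<in> W n" "z \<in> cell (r @ u)" using cell_refine[OF assms(1)] by blast
  have "x \<notin> cell (r @ u)" using n[of "length (r @ u)" "r @ u" z x] u by (auto simp: words_iff)
  then show thesis using that u by (auto simp: words_iff)
qed

end

subsection \<open>Linked cells\<close>

context carpet
begin

text \<open>Deleting \<open>w\<close> leaves the block of words with prefix \<open>p\<close>
  intact.\<close>

definition off :: "digit list \<Rightarrow> digit list \<Rightarrow> bool" where
  "off p w \<longleftrightarrow> (\<forall>u. w \<noteq> p @ u)"

text \<open>Quantifying over extensions compares prefixes of different lengths within one graph of
  level \<open>K\<close>. The relation is vacuous for a prefix without extension in
  \<open>W K\<close>, so transitivity needs a proper middle prefix.\<close>

definition lk :: "nat \<Rightarrow> digit list \<Rightarrow> digit list \<Rightarrow> digit list \<Rightarrow> bool" where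
  "lk K w p q \<longleftrightarrow>
     (\<forall>u v. p @ u \<in> W K \<longrightarrow> q @ v \<in> W K \<longrightarrow> conn E (W K - {w}) (p @ u) (q @ v))"

lemmas conn_E_sym = conn_sym[OF symp_hata_edge]

lemma E_iff: "E u v \<longleftrightarrow> u \<noteq> v \<and> cell u \<inter> cell v \<noteq> {}"
  by (simp add: hata_edge_def cell_def)

lemma E_append: "E (p @ u) (p @ v) \<longleftrightarrow> E u v"
proof -
  have "cell (p @ u) \<inter> cell (p @ v) = word_map N p ` (cell u \<inter> cell v)"
    unfolding cell_append using inj_word_map[OF N_pos] by (simp add: image_Int)
  then show ?thesis by (auto simp: E_iff)
qed

text \<open>Finite unions of cells are closed, so a component and the remaining words would
  disconnect \<open>F\<close>.\<close>

lemma conn_words: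
  assumes "u \<in> W k" "v \<in> W k"
  shows "conn E (W k) u v"
proof (rule ccontr)
  assume nc: "\<not> conn E (W k) u v"
  define S where "S = {w \<in> W k. conn E (W k) u w}"
  define A where "A = (\<Union>w\<in>S. cell w)"
  define B where "B = (\<Union>w\<in>W k - S. cell w)"
  have "closed A" "closed B"
    unfolding A_def B_def using finite_words by (auto intro!: closed_UN closed_cell simp: S_def)
  moreover have "A \<union> B = F" unfolding A_def B_def F_words[of k] by (auto simp: S_def)
  moreover have "A \<inter> B = {}"
  proof (rule ccontr)
    assume "A \<inter> B \<noteq> {}"
    then obtain z a b where ab: "a \<in> S" "b \<in> W k - S" "z \<in> cell a" "z \<in> cell b"
      by (auto simp: A_def B_def)
    then have "E a b" by (auto simp: E_iff)
    then have "conn E (W k) a b" using ab by (intro conn_edge) (auto simp: S_def)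
    then have "conn E (W k) u b" using ab conn_trans by (fastforce simp: S_def)
    then show False using ab by (auto simp: S_def)
  qed
  moreover have "A \<noteq> {}" using assms cell_ne by (auto simp: A_def S_def)
  moreover have "B \<noteq> {}" using assms nc cell_ne by (auto simp: B_def S_def)
  ultimately show False using conn_F by (auto simp: connected_closed_set compact_F compact_imp_closed)
qed

lemma conn_prefix:
  assumes "conn E S u v" "\<And>x. x \<in> S \<Longrightarrow> p @ x \<in> S'"
  shows "conn E S' (p @ u) (p @ v)"
  using assms(1)
proof (induction rule: conn_induct)
  case (step y z)
  then have "conn E S' (p @ y) (p @ z)" by (intro conn_edge assms) (auto simp: E_append)
  with step show ?case using conn_trans by metis
qed simp

text \<open>The block below \<open>p\<close> is a copy of the connected graph of level
  \<open>K - length p\<close>.\<close>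

lemma lk_refl:
  assumes "set p \<subseteq> D" "off p w"
  shows "lk K w p p"
  unfolding lk_def
proof (intro allI impI)
  fix u v assume "p @ u \<in> W K" "p @ v \<in> W K"
  then have uv: "u \<in> W (K - length p)" "v \<in> W (K - length p)" and l: "length p \<le> K"
    by (auto simp: words_append)
  show "conn E (W K - {w}) (p @ u) (p @ v)"
    using conn_words[OF uv]
  proof (rule conn_prefix)
    fix x assume "x \<in> W (K - length p)"
    then show "p @ x \<in> W K - {w}" using assms l by (auto simp: words_append off_def)
  qed
qed

lemma lk_sym: "lk K w p q \<Longrightarrow> lk K w q p"
  unfolding lk_def using conn_E_sym by blast

lemma extension_ex:
  assumes "set q \<subseteq> D" "length q \<le> K" obtains s where "q @ s \<in> W K"
  using words_ne[of "K - length q"] assms by (auto simp: words_append)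

lemma lk_trans:
  assumes "lk K w p q" "lk K w q r" "set q \<subseteq> D" "length q \<le> K"
  shows "lk K w p r"
proof -
  obtain s where "q @ s \<in> W K" using extension_ex assms by blast
  then show ?thesis using assms(1,2) conn_trans unfolding lk_def by metis
qed

lemma lk_descend_left: "lk K w p q \<Longrightarrow> lk K w (p @ u) q"
  unfolding lk_def by auto

lemma conn_touch:
  assumes "a \<in> W K - {w}" "b \<in> W K - {w}" "z \<in> cell a" "z \<in> cell b"
  shows "conn E (W K - {w}) a b"
proof (cases "a = b")
  case False
  then show ?thesis using assms by (intro conn_edge) (auto simp: E_iff)
qed simp

text \<open>A common point lies in a level-\<open>K\<close> subcell of either cell. These two
  subcells are equal or adjacent, and each intact block is connected.\<close>

lemma lk_touch:
  assumes p: "set p \<subseteq> D" "length p \<le> K" "off p w"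
    and q: "set q \<subseteq> D" "length q \<le> K" "off q w"
    and z: "z \<in> cell p" "z \<in> cell q"
  shows "lk K w p q"
  unfolding lk_def
proof (intro allI impI)
  fix u v assume uv: "p @ u \<in> W K" "q @ v \<in> W K"
  obtain s where s: "s \<in> W (K - length p)" "z \<in> cell (p @ s)" using cell_refine z by blast
  obtain t where t: "t \<in> W (K - length q)" "z \<in> cell (q @ t)" using cell_refine z by blast
  have ps: "p @ s \<in> W K" using p s by (simp add: words_append)
  have qt: "q @ t \<in> W K" using q t by (simp add: words_append)
  have "conn E (W K - {w}) (p @ u) (p @ s)"
    using lk_refl[of p w K] p uv ps by (auto simp: lk_def)
  also have "conn E (W K - {w}) (p @ s) (q @ t)"
    using p q ps qt s t by (intro conn_touch[of _ _ _ _ z]) (auto simp: off_def)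
  also have "conn E (W K - {w}) (q @ t) (q @ v)"
    using lk_refl[of q w K] q uv qt by (auto simp: lk_def)
  finally show "conn E (W K - {w}) (p @ u) (q @ v)" .
qed

text \<open>The block \<open>r\<close> of the deeper graph is a copy of level \<open>K\<close>, in
  which the deleted word becomes \<open>r @ w\<close>.\<close>

lemma lk_prefix:
  assumes "lk K w p q" "set r \<subseteq> D"
  shows "lk (length r + K) (r @ w) (r @ p) (r @ q)"
  unfolding lk_def
proof (intro allI impI)
  fix u v assume "(r @ p) @ u \<in> W (length r + K)" "(r @ q) @ v \<in> W (length r + K)"
  then have "p @ u \<in> W K" "q @ v \<in> W K" by (auto simp: words_iff)
  then have "conn E (W K - {w}) (p @ u) (q @ v)" using assms by (auto simp: lk_def)
  then have "conn E (W (length r + K) - {r @ w}) (r @ (p @ u)) (r @ (q @ v))"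
    by (rule conn_prefix) (use assms in \<open>auto simp: words_iff\<close>)
  then show "conn E (W (length r + K) - {r @ w}) ((r @ p) @ u) ((r @ q) @ v)" by simp
qed

text \<open>Deleting \<open>w @ r\<close> removes less than deleting \<open>w\<close>, and each edge
  of a path that avoids \<open>w\<close> lifts to the deeper level by
  \<open>lk_touch\<close>.\<close>

lemma conn_refine:
  assumes "conn E (W K - {w}) x y" "x \<in> W K - {w}" "w \<in> W K"
  shows "lk (K + n) (w @ r) x y"
  using assms(1)
proof (induction rule: conn_induct)
  case refl
  then show ?case using assms by (intro lk_refl) (auto simp: words_iff off_def)
next
  case (step y z)
  have yz: "y \<in> W K" "y \<noteq> w" "z \<in> W K" "z \<noteq> w" using step by auto
  obtain s where s: "s \<in> cell y" "s \<in> cell z" using step(4) by (auto simp: E_iff)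
  have "lk (K + n) (w @ r) y z"
    by (rule lk_touch[OF _ _ _ _ _ _ s]) (use yz assms in \<open>auto simp: words_iff off_def\<close>)
  then show ?case using step.IH yz by (auto intro: lk_trans simp: words_iff)
qed

lemma lk_refine:
  assumes "lk K w p q" "w \<in> W K" "set p \<subseteq> D" "length p \<le> K" "off p w" "length q \<le> K"
  shows "lk (K + n) (w @ r) p q"
  unfolding lk_def
proof (intro allI impI)
  fix u v assume uv: "p @ u \<in> W (K + n)" "q @ v \<in> W (K + n)"
  show "conn E (W (K + n) - {w @ r}) (p @ u) (q @ v)"
  proof -
    define u1 u2 v1 v2 where d: "u1 = take (K - length p) u" "u2 = drop (K - length p) u"
      "v1 = take (K - length q) v" "v2 = drop (K - length q) v"
    have u: "u = u1 @ u2" "v = v1 @ v2" by (auto simp: d)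
    have p1: "p @ u1 \<in> W K" and q1: "q @ v1 \<in> W K"
      using uv assms(4,6) set_take_subset[of "K - length p" u] set_take_subset[of "K - length q" v]
      by (auto simp: words_iff d)
    have "conn E (W K - {w}) (p @ u1) (q @ v1)" using assms(1) p1 q1 by (auto simp: lk_def)
    then have "lk (K + n) (w @ r) (p @ u1) (q @ v1)"
      by (rule conn_refine) (use assms p1 in \<open>auto simp: off_def\<close>)
    then show ?thesis using uv unfolding lk_def u by simp
  qed
qed

end

subsection \<open>Large components of the Hata graphs\<close>

context carpet
begin

lemma finite_gcomp: "finite (gcomp E (W k - X) x)"
  using finite_words[of k] by (simp add: gcomp_def)

lemma off_single: "w \<in> W (Suc n) \<Longrightarrow> off [a] w \<longleftrightarrow> a \<noteq> hd w"
  by (cases w) (auto simp: off_def words_iff)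

lemma card_block: "card ((#) a ` W n - {w}) \<ge> card D ^ n - 1"
proof -
  have "card ((#) a ` W n) = card D ^ n" by (simp add: card_image card_words)
  then show ?thesis using diff_card_le_card_Diff[of "{w}" "(#) a ` W n"] by simp
qed

lemma block_ne:
  assumes "n \<ge> 1" obtains u where "u \<in> W n" "a # u \<noteq> w"
proof -
  have "card D ^ n \<ge> card D ^ 1" using assms card_D by (intro power_increasing) auto
  then have "card ((#) a ` W n - {w}) > 0" using card_block[of n a w] card_D by simp
  then have "(#) a ` W n - {w} \<noteq> {}" by (metis card.empty less_irrefl)
  then show thesis using that by auto
qed

text \<open>Each block keeps at least \<open>card D ^ n - 1\<close> words after the deletion, so two
  internally connected blocks in different components reach the threshold.\<close>

lemma chi_geI:
  assumes n: "n \<ge> 1" and w: "w \<in> W (Suc n)" and ab: "a \<in> D" "b \<in> D"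
    and ca: "\<And>u u'. a # u \<in> W (Suc n) - {w} \<Longrightarrow> a # u' \<in> W (Suc n) - {w} \<Longrightarrow> conn E (W (Suc n) - {w}) (a # u) (a # u')"
    and cb: "\<And>u u'. b # u \<in> W (Suc n) - {w} \<Longrightarrow> b # u' \<in> W (Suc n) - {w} \<Longrightarrow> conn E (W (Suc n) - {w}) (b # u) (b # u')"
    and nc: "\<And>u v. a # u \<in> W (Suc n) - {w} \<Longrightarrow> b # v \<in> W (Suc n) - {w} \<Longrightarrow> \<not> conn E (W (Suc n) - {w}) (a # u) (b # v)"
  shows "card D ^ n - 1 \<le> chi (W (Suc n)) E"
proof -
  let ?S = "W (Suc n) - {w}"
  have "card D ^ n \<ge> card D ^ 1" using n card_D by (intro power_increasing) auto
  then have pos: "card D ^ n - 1 \<ge> 1" using card_D by simp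
  obtain u where u: "u \<in> W n" "a # u \<noteq> w" using block_ne[OF n] .
  obtain v where v: "v \<in> W n" "b # v \<noteq> w" using block_ne[OF n] .
  have uS: "a # u \<in> ?S" and vS: "b # v \<in> ?S" using u v ab by (auto simp: words_iff)
  have "card ((#) a ` W n - {w}) \<le> card (gcomp E ?S (a # u))"
    by (rule card_mono[OF finite_gcomp]) (use ca uS ab in \<open>auto simp: gcomp_conn words_iff\<close>)
  then have A: "card D ^ n - 1 \<le> card (gcomp E ?S (a # u))" using card_block[of n a w] by simp
  have "card ((#) b ` W n - {w}) \<le> card (gcomp E ?S (b # v))"
    by (rule card_mono[OF finite_gcomp]) (use cb vS ab in \<open>auto simp: gcomp_conn words_iff\<close>)
  then have B: "card D ^ n - 1 \<le> card (gcomp E ?S (b # v))" using card_block[of n b w] by simp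
  have "b # v \<in> gcomp E ?S (b # v)" "b # v \<notin> gcomp E ?S (a # u)"
    using nc[OF uS vS] vS by (auto simp: gcomp_conn)
  then have "gcomp E ?S (a # u) \<noteq> gcomp E ?S (b # v)" by blast
  then show ?thesis
    unfolding chi_ge_iff[OF finite_words pos]
    using w A B uS vS by (auto simp: gcomponents_def)
qed

text \<open>A component of this size contains a whole block, up to the deleted word. If it meets a
  block other than that of \<open>w\<close>, it contains that connected block. Otherwise it lies in
  the truncated block of \<open>w\<close>, which has exactly the threshold size.\<close>

lemma chi_geD:
  assumes n: "n \<ge> 1" and chi: "card D ^ n - 1 \<le> chi (W (Suc n)) E"
  obtains w a b where "w \<in> W (Suc n)" "a \<in> D" "b \<in> D"
    "\<And>u v. a # u \<in> W (Suc n) - {w} \<Longrightarrow> b # v \<in> W (Suc n) - {w} \<Longrightarrow> \<not> conn E (W (Suc n) - {w}) (a # u) (b # v)"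
proof -
  have "card D ^ n \<ge> card D ^ 1" using n card_D by (intro power_increasing) auto
  then have pos: "card D ^ n - 1 \<ge> 1" using card_D by simp
  obtain w x y where w: "w \<in> W (Suc n)" and x: "x \<in> W (Suc n) - {w}" and y: "y \<in> W (Suc n) - {w}"
    and ne: "gcomp E (W (Suc n) - {w}) x \<noteq> gcomp E (W (Suc n) - {w}) y"
    and cx: "card D ^ n - 1 \<le> card (gcomp E (W (Suc n) - {w}) x)"
    and cy: "card D ^ n - 1 \<le> card (gcomp E (W (Suc n) - {w}) y)"
    using chi unfolding chi_ge_iff[OF finite_words pos] gcomponents_def by blast
  let ?S = "W (Suc n) - {w}"
  have block: "\<exists>a\<in>D. \<forall>u. a # u \<in> ?S \<longrightarrow> conn E ?S x (a # u)"
    if x: "x \<in> ?S" and cx: "card D ^ n - 1 \<le> card (gcomp E ?S x)" for x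
  proof (cases "\<exists>j v. j # v \<in> ?S \<and> j \<noteq> hd w \<and> conn E ?S x (j # v)")
    case True
    then obtain j v where jv: "j # v \<in> ?S" "j \<noteq> hd w" "conn E ?S x (j # v)" by blast
    have jD: "j \<in> D" using jv by (auto simp: words_iff)
    have "lk (Suc n) w [j] [j]" using lk_refl off_single[OF w] jv jD by simp
    then have "conn E ?S (j # v) (j # u)" if "j # u \<in> ?S" for u
      using that jv unfolding lk_def by auto
    then show ?thesis using jv jD conn_trans by metis
  next
    case False
    obtain i w' where iw: "w = i # w'" "i \<in> D" "w' \<in> W n" using w by (cases w) (auto simp: words_iff)
    have sub: "gcomp E ?S x \<subseteq> (#) i ` W n - {w}"
    proof
      fix y assume "y \<in> gcomp E ?S x"
      then have y: "y \<in> ?S" "conn E ?S x y" by (auto simp: gcomp_conn)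
      then obtain j v where jv: "y = j # v" by (cases y) (auto simp: words_iff)
      then have "j = i" using False y iw(1) by (metis list.sel(1))
      then show "y \<in> (#) i ` W n - {w}" using jv y by (auto simp: words_iff)
    qed
    have "card ((#) i ` W n) = card D ^ n" by (simp add: card_image card_words)
    then have "card ((#) i ` W n - {w}) = card D ^ n - 1"
      using iw finite_words by (subst card_Diff_singleton) auto
    then have "gcomp E ?S x = (#) i ` W n - {w}"
      using cx by (intro card_seteq[OF _ sub]) (use finite_words in auto)
    then have "conn E ?S x (i # u)" if "i # u \<in> ?S" for u
      using that by (auto simp: gcomp_conn words_iff image_iff set_eq_iff)
    then show ?thesis using iw by blast
  qed
  obtain a where a: "a \<in> D" "\<And>u. a # u \<in> ?S \<Longrightarrow> conn E ?S x (a # u)" using block[OF x cx] by blast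
  obtain b where b: "b \<in> D" "\<And>u. b # u \<in> ?S \<Longrightarrow> conn E ?S y (b # u)" using block[OF y cy] by blast
  show thesis
  proof (rule that[OF w a(1) b(1)])
    fix u v assume uv: "a # u \<in> ?S" "b # v \<in> ?S"
    show "\<not> conn E ?S (a # u) (b # v)"
    proof
      assume "conn E ?S (a # u) (b # v)"
      then have "conn E ?S x y"
        using a(2)[OF uv(1)] conn_E_sym[OF b(2)[OF uv(2)]] conn_trans by metis
      then show False using ne gcomp_eqI[OF symp_hata_edge] by blast
    qed
  qed
qed

subsection \<open>Chains of cells avoiding a point\<close>

definition avoiding :: "real \<times> real \<Rightarrow> digit list set" where
  "avoiding x = {p. set p \<subseteq> D \<and> x \<notin> cell p}"

abbreviation touching :: "real \<times> real \<Rightarrow> digit list \<Rightarrow> digit list \<Rightarrow> bool" where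
  "touching x \<equiv> conn (\<lambda>p q. cell p \<inter> cell q \<noteq> {}) (avoiding x)"

text \<open>At a small enough level every cell that contains \<open>z\<close> avoids
  \<open>x\<close> and touches the given \<open>p\<close>, hence belongs to \<open>P\<close>. The
  finitely many cells of that level that miss \<open>z\<close> form a closed set and stay away from
  \<open>z\<close>.\<close>

lemma openin_cells:
  assumes P: "P \<subseteq> avoiding x"
    and step: "\<And>p q. p \<in> P \<Longrightarrow> q \<in> avoiding x \<Longrightarrow> cell p \<inter> cell q \<noteq> {} \<Longrightarrow> q \<in> P"
  shows "openin (top_of_set (F - {x})) (\<Union>p\<in>P. cell p)"
proof (subst openin_subopen, intro ballI)
  fix z assume "z \<in> (\<Union>p\<in>P. cell p)"
  then obtain p where p: "p \<in> P" "z \<in> cell p" by blast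
  have zx: "z \<in> F - {x}" using p P cell_subset[of p] by (auto simp: avoiding_def)
  obtain n where n: "\<And>w k a b. k \<ge> n \<Longrightarrow> length w = k \<Longrightarrow> a \<in> cell w \<Longrightarrow> b \<in> cell w \<Longrightarrow> dist a b < dist z x"
    using cells_small[of "dist z x"] zx by auto
  define C where "C = (\<Union>w\<in>{w\<in>W n. z \<notin> cell w}. cell w)"
  have "closed C" unfolding C_def using finite_words closed_cell by (intro closed_UN) auto
  then have "openin (top_of_set (F - {x})) ((F - {x}) \<inter> - C)"
    by (intro openin_open_Int) auto
  moreover have "z \<in> (F - {x}) \<inter> - C" using zx by (auto simp: C_def)
  moreover have "(F - {x}) \<inter> - C \<subseteq> (\<Union>p\<in>P. cell p)"
  proof
    fix y assume y: "y \<in> (F - {x}) \<inter> - C"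
    then obtain w where w: "w \<in> W n" "y \<in> cell w" using F_words[of n] by blast
    then have zw: "z \<in> cell w" using y by (auto simp: C_def)
    have "x \<notin> cell w"
    proof
      assume "x \<in> cell w"
      then show False using n[of n w z x] zw w by (auto simp: words_iff)
    qed
    then have "w \<in> avoiding x" using w by (auto simp: avoiding_def words_iff)
    then have "w \<in> P" using step[OF p(1)] p zw by auto
    then show "y \<in> (\<Union>p\<in>P. cell p)" using w by auto
  qed
  ultimately show "\<exists>T. openin (top_of_set (F - {x})) T \<and> z \<in> T \<and> T \<subseteq> (\<Union>p\<in>P. cell p)" by blast
qed

text \<open>Cells reachable from \<open>p\<close> and unreachable ones never touch, so their unions
  would be two disjoint open pieces of \<open>F - {x}\<close>.\<close>

lemma touching_all:
  assumes con: "connected (F - {x})" and pq: "p \<in> avoiding x" "q \<in> avoiding x"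
  shows "touching x p q"
proof (rule ccontr)
  assume nc: "\<not> touching x p q"
  define P where "P = {r \<in> avoiding x. touching x p r}"
  define Q where "Q = {r \<in> avoiding x. \<not> touching x p r}"
  have sy: "symp (\<lambda>p q. cell p \<inter> cell q \<noteq> {})" by (auto simp: symp_def)
  have st: "touching x p r \<longleftrightarrow> touching x p s"
    if "r \<in> avoiding x" "s \<in> avoiding x" "cell r \<inter> cell s \<noteq> {}" for r s
  proof -
    have rs: "touching x r s" using that by (intro conn_edge)
    show ?thesis using conn_trans[OF _ rs] conn_trans[OF _ conn_sym[OF sy rs]] by blast
  qed
  have "openin (top_of_set (F - {x})) (\<Union>p\<in>P. cell p)"
    by (rule openin_cells) (use st in \<open>auto simp: P_def\<close>)
  moreover have "openin (top_of_set (F - {x})) (\<Union>p\<in>Q. cell p)"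
    by (rule openin_cells) (use st in \<open>auto simp: Q_def\<close>)
  moreover have "F - {x} \<subseteq> (\<Union>p\<in>P. cell p) \<union> (\<Union>p\<in>Q. cell p)"
  proof
    fix z assume "z \<in> F - {x}"
    then obtain u where "set u \<subseteq> D" "z \<in> cell u" "x \<notin> cell u"
      using cell_avoiding[of z "[]" x] by auto
    then show "z \<in> (\<Union>p\<in>P. cell p) \<union> (\<Union>p\<in>Q. cell p)"
      unfolding P_def Q_def avoiding_def by auto
  qed
  moreover have "(\<Union>p\<in>P. cell p) \<inter> (\<Union>p\<in>Q. cell p) = {}"
    using st by (auto simp: P_def Q_def)
  moreover have "(\<Union>p\<in>P. cell p) \<noteq> {}" using pq cell_ne[of p] by (auto simp: P_def)
  moreover have "(\<Union>p\<in>Q. cell p) \<noteq> {}" using pq nc cell_ne[of q] by (auto simp: Q_def)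
  ultimately show False using con unfolding connected_openin by blast
qed

lemma avoiding_off:
  assumes "p \<in> avoiding x"
  obtains e where "e > 0" "\<And>w. set w \<subseteq> D \<Longrightarrow> cell w \<subseteq> ball x e \<Longrightarrow> off p w"
proof -
  have "open (- cell p)" "x \<in> - cell p" using assms closed_cell by (auto simp: avoiding_def)
  then obtain e where e: "e > 0" "ball x e \<subseteq> - cell p" using open_contains_ball by blast
  show thesis
  proof (rule that[OF e(1)])
    fix w assume w: "set w \<subseteq> D" "cell w \<subseteq> ball x e"
    show "off p w" unfolding off_def
    proof (intro allI notI)
      fix u assume "w = p @ u"
      then have "cell w \<subseteq> cell p" using w cell_append_subset by auto
      then show False using w e cell_ne[of w] by blast
    qed
  qed
qed

text \<open>A chain is finite, so a single radius and a single level serve all of its cells.\<close>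

lemma touching_lk:
  assumes "touching x p q" "p \<in> avoiding x"
  shows "\<exists>e>0. \<exists>K0. \<forall>K\<ge>K0. \<forall>w\<in>W K. cell w \<subseteq> ball x e \<longrightarrow> lk K w p q"
  using assms(1)
proof (induction rule: conn_induct)
  case refl
  obtain e where e: "e > 0" "\<And>w. set w \<subseteq> D \<Longrightarrow> cell w \<subseteq> ball x e \<Longrightarrow> off p w"
    using avoiding_off[OF assms(2)] by metis
  then have "lk K w p p" if "w \<in> W K" "cell w \<subseteq> ball x e" for K w
    using that assms(2) by (intro lk_refl) (auto simp: avoiding_def words_iff)
  then show ?case using e by blast
next
  case (step q r)
  obtain e1 K1 where e1: "e1 > 0" "\<And>K w. K \<ge> K1 \<Longrightarrow> w \<in> W K \<Longrightarrow> cell w \<subseteq> ball x e1 \<Longrightarrow> lk K w p q"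
    using step.IH by blast
  obtain e2 where e2: "e2 > 0" "\<And>w. set w \<subseteq> D \<Longrightarrow> cell w \<subseteq> ball x e2 \<Longrightarrow> off q w"
    using avoiding_off[OF step(2)] by metis
  obtain e3 where e3: "e3 > 0" "\<And>w. set w \<subseteq> D \<Longrightarrow> cell w \<subseteq> ball x e3 \<Longrightarrow> off r w"
    using avoiding_off[OF step(3)] by metis
  obtain z where z: "z \<in> cell q" "z \<in> cell r" using step(4) by blast
  define e where "e = min e1 (min e2 e3)"
  define K0 where "K0 = max K1 (max (length q) (length r))"
  have "lk K w p r" if K: "K \<ge> K0" "w \<in> W K" "cell w \<subseteq> ball x e" for K w
  proof -
    have sub: "cell w \<subseteq> ball x e1" "cell w \<subseteq> ball x e2" "cell w \<subseteq> ball x e3"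
      using K(3) by (auto simp: e_def)
    have le: "K \<ge> K1" "length q \<le> K" "length r \<le> K" using K(1) by (auto simp: K0_def)
    have D: "set q \<subseteq> D" "set r \<subseteq> D" "set w \<subseteq> D" using step K by (auto simp: avoiding_def words_iff)
    have "lk K w q r"
      using D le e2(2) e3(2) sub z by (intro lk_touch) auto
    then show ?thesis using lk_trans[OF e1(2)[OF le(1) K(2) sub(1)]] D le by blast
  qed
  then show ?case using e1 e2 e3 by (intro exI[of _ e] conjI exI[of _ K0]) (auto simp: e_def)
qed

lemma two_points:
  obtains y where "y \<in> cell w" "y \<noteq> x"
proof -
  obtain i where i: "i \<in> D" using D_ne by blast
  obtain j where j: "j \<in> D" "j \<noteq> i" using other_digit by blast
  have "\<exists>a\<in>F. \<exists>b\<in>F. a \<noteq> b"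
  proof (rule ccontr)
    assume "\<not> ?thesis"
    then obtain a where a: "F = {a}" using F_ne by blast
    have "i = j"
    proof (rule crd_eqI)
      fix c
      have "gsc_map N i a \<in> F" "gsc_map N j a \<in> F" using a i j F_eq by blast+
      then have "gsc_map N i a = gsc_map N j a" using a by simp
      then have "crd c (gsc_map N i a) = crd c (gsc_map N j a)" by simp
      then show "crd c i = crd c j" using N_pos by (simp add: crd_gsc_map)
    qed
    then show False using j by simp
  qed
  then obtain a b where "a \<in> F" "b \<in> F" "a \<noteq> b" by blast
  then have "word_map N w a \<in> cell w" "word_map N w b \<in> cell w" "word_map N w a \<noteq> word_map N w b"
    using inj_word_map[OF N_pos, of w] by (auto simp: cell_def dest: injD)
  then show thesis using that by metis
qed

lemma avoiding_extension:
  obtains u where "p @ u \<in> avoiding x" | "\<not> set p \<subseteq> D"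
proof (cases "set p \<subseteq> D")
  case True
  obtain y where "y \<in> cell p" "y \<noteq> x" using two_points .
  then obtain u where "set u \<subseteq> D" "x \<notin> cell (p @ u)" using cell_avoiding by metis
  then have "p @ u \<in> avoiding x" using True by (auto simp: avoiding_def)
  then show thesis by (rule that(1))
qed (rule that(2))

theorem cut_point_if_chi_large:
  assumes "\<And>n. n \<ge> 1 \<Longrightarrow> card D ^ n - 1 \<le> chi (W (Suc n)) E"
  shows "\<exists>x. cut_point F x"
proof -
  have "\<forall>n. \<exists>w a b. n \<ge> 1 \<longrightarrow> w \<in> W (Suc n) \<and> a \<in> D \<and> b \<in> D \<and>
      (\<forall>u v. a # u \<in> W (Suc n) - {w} \<longrightarrow> b # v \<in> W (Suc n) - {w} \<longrightarrow> \<not> conn E (W (Suc n) - {w}) (a # u) (b # v))"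
    using chi_geD assms by metis
  then obtain w a b where wab: "\<And>n. n \<ge> 1 \<Longrightarrow> w n \<in> W (Suc n)" "\<And>n. n \<ge> 1 \<Longrightarrow> a n \<in> D" "\<And>n. n \<ge> 1 \<Longrightarrow> b n \<in> D"
    "\<And>n u v. n \<ge> 1 \<Longrightarrow> a n # u \<in> W (Suc n) - {w n} \<Longrightarrow> b n # v \<in> W (Suc n) - {w n} \<Longrightarrow>
       \<not> conn E (W (Suc n) - {w n}) (a n # u) (b n # v)"
    by metis
  have "\<forall>n. \<exists>x. x \<in> cell (w (Suc n))" using cell_ne by blast
  then obtain xs where xs: "\<And>n. xs n \<in> cell (w (Suc n))" by metis
  have "xs n \<in> F" for n using xs[of n] wab(1)[of "Suc n"] cell_subset by (auto simp: words_iff)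
  then obtain x r where x: "x \<in> F" and r: "strict_mono r" and lim: "(xs \<circ> r) \<longlonglongrightarrow> x"
    using compact_F unfolding compact_def by (metis (no_types, lifting))
  \<comment> \<open>The separated pair of blocks may change with the level; one pair
    \<open>(A, B)\<close> recurs infinitely often along the subsequence.\<close>
  define f where "f n = (a (Suc (r n)), b (Suc (r n)))" for n
  have "finite (range f)"
    by (rule finite_subset[of _ "D \<times> D"]) (use wab finite_D in \<open>auto simp: f_def\<close>)
  then obtain n0 where inf: "infinite {n. f n = f n0}"
    using pigeonhole_infinite[of UNIV f] by auto
  define A B where "A = a (Suc (r n0))" and "B = b (Suc (r n0))"
  have AB: "A \<in> D" "B \<in> D" using wab by (auto simp: A_def B_def)
  have "\<not> connected (F - {x})"
  proof
    assume con: "connected (F - {x})"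
    \<comment> \<open>The blocks themselves may contain \<open>x\<close>; subcells that miss it
      represent them.\<close>
    obtain u where u: "A # u \<in> avoiding x" using avoiding_extension[of "[A]" x] AB by auto
    obtain v where v: "B # v \<in> avoiding x" using avoiding_extension[of "[B]" x] AB by auto
    obtain e K0 where e: "e > 0" and lk: "\<And>K w. K \<ge> K0 \<Longrightarrow> w \<in> W K \<Longrightarrow> cell w \<subseteq> ball x e \<Longrightarrow> lk K w (A # u) (B # v)"
      using touching_lk[OF touching_all[OF con u v] u] by blast
    obtain eu where eu: "eu > 0" "\<And>w. set w \<subseteq> D \<Longrightarrow> cell w \<subseteq> ball x eu \<Longrightarrow> off (A # u) w"
      using avoiding_off[OF u] by metis
    obtain ev where ev: "ev > 0" "\<And>w. set w \<subseteq> D \<Longrightarrow> cell w \<subseteq> ball x ev \<Longrightarrow> off (B # v) w"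
      using avoiding_off[OF v] by metis
    define d where "d = min e (min eu ev)"
    have d: "d > 0" using e eu ev by (simp add: d_def)
    obtain n1 where n1: "\<And>n. n \<ge> n1 \<Longrightarrow> dist (xs (r n)) x < d / 2"
      using lim d unfolding lim_sequentially comp_def by (metis half_gt_zero)
    obtain n2 where n2: "\<And>w k y z. k \<ge> n2 \<Longrightarrow> length w = k \<Longrightarrow> y \<in> cell w \<Longrightarrow> z \<in> cell w \<Longrightarrow> dist y z < d / 2"
      using cells_small[of "d / 2"] d by auto
    define L where "L = max (max n1 n2) (max K0 (max (length (A # u)) (length (B # v))))"
    obtain n where n: "n \<ge> L" "f n = f n0"
      using inf by (metis (mono_tags, lifting) infinite_nat_iff_unbounded_le mem_Collect_eq)
    define m where "m = Suc (r n)"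
    have "r n \<ge> n" using r by (rule seq_suble)
    then have m: "m \<ge> 1" "Suc m \<ge> n2" "Suc m \<ge> K0" "length (A # u) \<le> Suc m" "length (B # v) \<le> Suc m"
      using n by (auto simp: m_def L_def)
    have am: "a m = A" "b m = B" using n(2) by (auto simp: f_def A_def B_def m_def)
    have wm: "w m \<in> W (Suc m)" using wab m by simp
    have "cell (w m) \<subseteq> ball x d"
    proof
      fix y assume y: "y \<in> cell (w m)"
      have "dist (xs (r n)) y < d / 2"
        using n2[OF m(2) _ _ y, of "xs (r n)"] xs[of "r n"] wm by (auto simp: words_iff m_def)
      moreover have "dist (xs (r n)) x < d / 2" using n1 n by (simp add: L_def)
      ultimately show "y \<in> ball x d" using dist_triangle_half_r[of "xs (r n)" x d y]
        by (simp add: dist_commute)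
    qed
    then have sub: "cell (w m) \<subseteq> ball x e" "cell (w m) \<subseteq> ball x eu" "cell (w m) \<subseteq> ball x ev"
      by (auto simp: d_def)
    have wD: "set (w m) \<subseteq> D" using wm by (simp add: words_iff)
    have "set (A # u) \<subseteq> D" "set (B # v) \<subseteq> D" using u v by (auto simp: avoiding_def)
    then obtain s t where st: "(A # u) @ s \<in> W (Suc m)" "(B # v) @ t \<in> W (Suc m)"
      using extension_ex m by metis
    have "conn E (W (Suc m) - {w m}) ((A # u) @ s) ((B # v) @ t)"
      using lk[OF m(3) wm sub(1)] st unfolding lk_def by blast
    moreover have "(A # u) @ s \<noteq> w m" "(B # v) @ t \<noteq> w m"
      using eu(2)[OF wD sub(2)] ev(2)[OF wD sub(3)] unfolding off_def by metis+
    ultimately show False using wab(4)[OF m(1), of "u @ s" "v @ t"] st am by auto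
  qed
  then show ?thesis using x by (intro exI[of _ x]) (simp add: cut_point_def)
qed

end

subsection \<open>Intersections of two self-similar subsets of the unit interval\<close>

text \<open>The map \<open>N * s - l\<close> keeps \<open>S\<close> and multiplies differences by
  \<open>N\<close>, whereas differences in \<open>S\<close> are at most 2.\<close>

lemma expansion_unique:
  fixes S :: "real set"
  assumes "N \<ge> 2" "\<And>s. s \<in> S \<Longrightarrow> real N * s - l \<in> S" "\<And>s. s \<in> S \<Longrightarrow> \<bar>s\<bar> \<le> 1"
    and "s \<in> S" "t \<in> S"
  shows "s = t"
proof (rule ccontr)
  assume "s \<noteq> t"
  have "\<exists>s'\<in>S. \<exists>t'\<in>S. \<bar>s' - t'\<bar> = real N ^ n * \<bar>s - t\<bar>" for n
  proof (induction n)
    case (Suc n)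
    then obtain s' t' where st: "s' \<in> S" "t' \<in> S" "\<bar>s' - t'\<bar> = real N ^ n * \<bar>s - t\<bar>" by blast
    have "(real N * s' - l) - (real N * t' - l) = real N * (s' - t')" by (simp add: algebra_simps)
    then have "\<bar>(real N * s' - l) - (real N * t' - l)\<bar> = real N ^ Suc n * \<bar>s - t\<bar>"
      using st(3) by (simp add: abs_mult)
    then show ?case using st(1,2) assms(2) by blast
  qed (use assms in auto)
  moreover obtain n where "2 / \<bar>s - t\<bar> < real N ^ n"
    using real_arch_pow[of "real N" "2 / \<bar>s - t\<bar>"] assms(1) by auto
  then have "2 < real N ^ n * \<bar>s - t\<bar>" using \<open>s \<noteq> t\<close> by (simp add: field_simps)
  ultimately show False using assms(3) by (smt (verit))
qed

text \<open>Models two opposite sides of \<open>F\<close> as subsets of the unit interval, each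
  self-similar under the maps \<open>(t + d) / N\<close> for the digits \<open>d\<close> of its
  side.\<close>

locale self_similar_pair =
  fixes N :: nat and T B :: "real set" and P Q :: "nat set"
  assumes N2: "N \<ge> 2"
    and P_less: "\<And>d. d \<in> P \<Longrightarrow> d < N" and Q_less: "\<And>d. d \<in> Q \<Longrightarrow> d < N"
    and T01: "\<And>t. t \<in> T \<Longrightarrow> 0 \<le> t \<and> t \<le> 1" and B01: "\<And>t. t \<in> B \<Longrightarrow> 0 \<le> t \<and> t \<le> 1"
    and T_iff: "\<And>t. t \<in> T \<longleftrightarrow> (\<exists>d\<in>P. real N * t - real d \<in> T)"
    and B_iff: "\<And>t. t \<in> B \<longleftrightarrow> (\<exists>d\<in>Q. real N * t - real d \<in> B)"
begin

lemma T_I: "d \<in> P \<Longrightarrow> t \<in> T \<Longrightarrow> (real d + t) / real N \<in> T"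
  using T_iff[of "(real d + t) / real N"] N2 by (auto intro!: bexI[of _ d])

lemma B_I: "d \<in> Q \<Longrightarrow> t \<in> B \<Longrightarrow> (real d + t) / real N \<in> B"
  using B_iff[of "(real d + t) / real N"] N2 by (auto intro!: bexI[of _ d])

end

text \<open>\<open>S_l\<close> expresses that all contact points over a side lie in one subcell:
  each common point of the two sides has an expansion in \<open>T\<close> that starts with
  \<open>l\<close>.\<close>

locale pair_in_digit = self_similar_pair +
  fixes l :: nat
  assumes lP: "l \<in> P"
    and S_l: "\<And>s. s \<in> T \<Longrightarrow> s \<in> B \<Longrightarrow> real N * s - real l \<in> T"
    and S2: "\<exists>s t. s \<in> T \<inter> B \<and> t \<in> T \<inter> B \<and> s \<noteq> t"
begin

lemma S_range: "s \<in> T \<Longrightarrow> s \<in> B \<Longrightarrow> real l \<le> real N * s \<and> real N * s \<le> real l + 1"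
  using T01[OF S_l, of s] by simp

lemma not_both: "\<not> (0 \<in> T \<and> 0 \<in> B \<and> 1 \<in> T \<and> 1 \<in> B)"
  using S_range[of 0] S_range[of 1] N2 by auto

text \<open>The remainders \<open>N * s - l\<close> in \<open>T\<close> and \<open>N * s - d\<close>
  in \<open>B\<close> both lie in the unit interval. So \<open>d\<close> is \<open>l\<close> or a
  neighbour of \<open>l\<close>, and a neighbour forces \<open>s\<close> to be an endpoint of the
  subinterval of \<open>l\<close>.\<close>

lemma S_step:
  assumes "s \<in> T" "s \<in> B"
  shows "(l \<in> Q \<and> real N * s - real l \<in> T \<inter> B) \<or> (Suc l \<in> Q \<and> 1 \<in> T \<and> 0 \<in> B \<and> real N * s = real l + 1)
      \<or> ((\<exists>d\<in>Q. Suc d = l) \<and> 0 \<in> T \<and> 1 \<in> B \<and> real N * s = real l)"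
proof -
  have t: "real N * s - real l \<in> T" using assms by (rule S_l)
  obtain d where d: "d \<in> Q" "real N * s - real d \<in> B" using assms B_iff by blast
  have r: "0 \<le> real N * s - real l" "real N * s - real l \<le> 1" "0 \<le> real N * s - real d" "real N * s - real d \<le> 1"
    using T01[OF t] B01[OF d(2)] by auto
  then have "\<bar>real d - real l\<bar> \<le> 1" by linarith
  then consider "d = l" | "d = Suc l" | "Suc d = l" by linarith
  then show ?thesis
  proof cases
    case 2
    then have "real N * s = real l + 1" using r by simp
    then show ?thesis using 2 d t by auto
  next
    case 3
    then have "real N * s = real l" using r by auto
    then show ?thesis using 3 d t by auto
  qed (use d t in auto)
qed

text \<open>Otherwise every common point is an endpoint of the subinterval of \<open>l\<close>. Two
  of them would be both endpoints, against \<open>not_both\<close>.\<close>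

lemma l_Q: "l \<in> Q"
proof (rule ccontr)
  assume lQ: "l \<notin> Q"
  obtain s t where st: "s \<in> T" "s \<in> B" "t \<in> T" "t \<in> B" "s \<noteq> t" using S2 by blast
  have "real N * s \<noteq> real N * t" using st N2 by simp
  then show False using S_step[OF st(1,2)] S_step[OF st(3,4)] lQ not_both by metis
qed

text \<open>\<open>T \<inter> B\<close> lies in the subinterval of digit \<open>l\<close> and is not just the fixed point of its map, so it
  contains an endpoint of that subinterval, produced by the digit \<open>l + 1\<close> or \<open>l - 1\<close> of \<open>B\<close>.\<close>

lemma endpoint_cases: "(Suc l \<in> Q \<and> 1 \<in> T \<and> 0 \<in> B) \<or> ((\<exists>d\<in>Q. Suc d = l) \<and> 0 \<in> T \<and> 1 \<in> B)"
proof (rule ccontr)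
  assume no: "\<not> ?thesis"
  obtain s t where st: "s \<in> T \<inter> B" "t \<in> T \<inter> B" "s \<noteq> t" using S2 by blast
  have "s = t"
  proof (rule expansion_unique[OF N2 _ _ st(1,2)])
    show "real N * r - real l \<in> T \<inter> B" if "r \<in> T \<inter> B" for r using S_step[of r] no that by blast
    show "\<bar>r\<bar> \<le> 1" if "r \<in> T \<inter> B" for r using T01[of r] that by auto
  qed
  then show False using st by simp
qed

lemma two_points: obtains s where "s \<in> T" "s \<in> B" "s \<noteq> x"
  using S2 by blast

text \<open>Each part rules out one way in which contact sets could stay inside single subcells: the
  first two forbid digits of this side next to \<open>l\<close>, the third a single subcell on the
  opposite side, the fourth a single subcell two levels down.\<close>

theorem digit_isolated:
  shows "Suc l \<notin> P" and "\<And>d. Suc d = l \<Longrightarrow> d \<notin> P"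
    and "\<And>j. \<exists>s. s \<in> T \<and> s \<in> B \<and> real N * s - real j \<notin> B"
    and "\<And>j. \<exists>s. s \<in> T \<and> s \<in> B \<and> real N * (real N * s - real l) - real j \<notin> T"
proof -
  have Npos: "real N > 0" using N2 by simp
  have next_S: "(real l + s) / real N \<in> T" "(real l + s) / real N \<in> B" if "s \<in> T" "s \<in> B" for s
    using that T_I[OF lP] B_I[OF l_Q] by auto
  have "Suc l \<notin> P \<and> (\<forall>d. Suc d = l \<longrightarrow> d \<notin> P)
    \<and> (\<forall>j. \<exists>s. s \<in> T \<and> s \<in> B \<and> real N * s - real j \<notin> B)
    \<and> (\<forall>j. \<exists>s. s \<in> T \<and> s \<in> B \<and> real N * (real N * s - real l) - real j \<notin> T)"
    using endpoint_cases
  proof (elim disjE conjE)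
    assume up: "Suc l \<in> Q" "1 \<in> T" "0 \<in> B"
    have lN: "real l + 2 \<le> real N" using Q_less[OF up(1)] by simp
    have B1: "1 \<notin> B" using S_range[of 1] up lN by auto
    \<comment> \<open>The endpoint between the digits \<open>l\<close> and \<open>l + 1\<close>,
      reached in \<open>T\<close> from 1 and in \<open>B\<close> from 0. As \<open>l\<close> is a
      digit of both sets, its images \<open>s1\<close> and \<open>s2\<close> are common points
      too.\<close>
    define s0 where "s0 = (real l + 1) / real N"
    have s0: "s0 \<in> T" "s0 \<in> B"
      using T_I[OF lP up(2)] B_I[OF up(1,3)] by (auto simp: s0_def add.commute)
    have s0r: "0 < s0" "s0 < 1" "real N * s0 = real l + 1" using lN Npos by (auto simp: s0_def)
    define s1 where "s1 = (real l + s0) / real N"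
    have s1: "s1 \<in> T" "s1 \<in> B" "real N * s1 = real l + s0" using next_S[OF s0] Npos by (auto simp: s1_def)
    define s2 where "s2 = (real l + s1) / real N"
    have s2: "s2 \<in> T" "s2 \<in> B" "real N * s2 = real l + s1" using next_S[OF s1(1,2)] Npos by (auto simp: s2_def)
    have 1: "Suc l \<notin> P"
    proof
      assume "Suc l \<in> P"
      obtain s where s: "s \<in> T" "s \<in> B" "s \<noteq> 0" using two_points .
      then have "(real (Suc l) + s) / real N \<in> T" "(real (Suc l) + s) / real N \<in> B"
        using T_I \<open>Suc l \<in> P\<close> B_I up by blast+
      from S_range[OF this] show False using s T01[of s] Npos by auto
    qed
    have 2: "d \<notin> P" if d: "Suc d = l" for d
    proof
      assume "d \<in> P"
      have "real l / real N \<in> T" using T_I[OF \<open>d \<in> P\<close> up(2)] d by (auto simp: add.commute)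
      moreover have "real l / real N \<in> B" using B_I[OF l_Q up(3)] by simp
      ultimately have "0 \<in> T" using S_l[of "real l / real N"] Npos by simp
      then show False using S_range[of 0] up d by auto
    qed
    \<comment> \<open>The remainder of \<open>s1\<close> is \<open>l + s0 - j\<close> with
      \<open>0 < s0 < 1\<close>, which forces \<open>j = l\<close>. Then \<open>s0\<close> has
      remainder 1, which is not in \<open>B\<close>.\<close>
    have 3: "\<exists>s. s \<in> T \<and> s \<in> B \<and> real N * s - real j \<notin> B" for j
    proof (rule ccontr)
      assume "\<not> ?thesis"
      then have b: "real N * s1 - real j \<in> B" "real N * s0 - real j \<in> B" using s0 s1 by blast+
      have "j = l" using B01[OF b(1)] s0r s1(3) by linarith
      then show False using b(2) B1 s0r by simp
    qed
    \<comment> \<open>Remainders lie in the unit interval, so \<open>s0\<close> demands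
      \<open>j \<ge> N - 1\<close> and \<open>s2\<close> demands \<open>j \<le> l\<close>, while
      \<open>l + 2 \<le> N\<close>.\<close>
    have 4: "\<exists>s. s \<in> T \<and> s \<in> B \<and> real N * (real N * s - real l) - real j \<notin> T" for j
    proof (rule ccontr)
      assume "\<not> ?thesis"
      then have b: "real N * (real N * s0 - real l) - real j \<in> T" "real N * (real N * s2 - real l) - real j \<in> T"
        using s0 s2 by blast+
      have "real N * (real N * s0 - real l) = real N" unfolding s0r(3) by simp
      then have "real N - real j \<le> 1" using T01[OF b(1)] by linarith
      moreover have "real N * (real N * s2 - real l) = real l + s0" using s2(3) s1(3) by simp
      then have "real j \<le> real l + s0" using T01[OF b(2)] by simp
      ultimately show False using s0r lN by linarith
    qed
    show ?thesis using 1 2 3 4 by blast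
  next
    assume "\<exists>d\<in>Q. Suc d = l" and down: "0 \<in> T" "1 \<in> B"
    then obtain d where d: "d \<in> Q" "Suc d = l" by blast
    have lN: "real l < real N" "real l \<ge> 1" using P_less[OF lP] d by auto
    have B0: "0 \<notin> B" using S_range[of 0] down lN by auto
    \<comment> \<open>Mirror image of the first case under \<open>1 - t\<close>: the endpoint now
      lies between the digits \<open>l - 1\<close> and \<open>l\<close>.\<close>
    define s0 where "s0 = real l / real N"
    have s0: "s0 \<in> T" "s0 \<in> B"
      using T_I[OF lP down(1)] B_I[OF d(1) down(2)] d by (auto simp: s0_def add.commute)
    have s0r: "0 < s0" "s0 < 1" "real N * s0 = real l" using lN Npos by (auto simp: s0_def)
    define s1 where "s1 = (real l + s0) / real N"
    have s1: "s1 \<in> T" "s1 \<in> B" "real N * s1 = real l + s0" using next_S[OF s0] Npos by (auto simp: s1_def)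
    define s2 where "s2 = (real l + s1) / real N"
    have s2: "s2 \<in> T" "s2 \<in> B" "real N * s2 = real l + s1" using next_S[OF s1(1,2)] Npos by (auto simp: s2_def)
    have 1: "Suc l \<notin> P"
    proof
      assume sl: "Suc l \<in> P"
      have "(real l + 1) / real N \<in> T" using T_I[OF sl down(1)] by (simp add: add.commute)
      moreover have "(real l + 1) / real N \<in> B" using B_I[OF l_Q down(2)] by simp
      ultimately have "1 \<in> T" using S_l[of "(real l + 1) / real N"] Npos by simp
      then show False using S_range[of 1] down P_less[OF sl] by auto
    qed
    have 2: "d' \<notin> P" if d': "Suc d' = l" for d'
    proof
      assume "d' \<in> P"
      moreover have "d' = d" using d d' by simp
      ultimately have dP: "d \<in> P" by simp
      obtain s where s: "s \<in> T" "s \<in> B" "s \<noteq> 1" using two_points .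
      then have "(real d + s) / real N \<in> T" "(real d + s) / real N \<in> B"
        using T_I dP B_I d by blast+
      from S_range[OF this] show False using s T01[of s] Npos d by auto
    qed
    have 3: "\<exists>s. s \<in> T \<and> s \<in> B \<and> real N * s - real j \<notin> B" for j
    proof (rule ccontr)
      assume "\<not> ?thesis"
      then have b: "real N * s1 - real j \<in> B" "real N * s0 - real j \<in> B" using s0 s1 by blast+
      have "j = l" using B01[OF b(1)] s0r s1(3) by linarith
      then show False using b(2) B0 s0r by simp
    qed
    have 4: "\<exists>s. s \<in> T \<and> s \<in> B \<and> real N * (real N * s - real l) - real j \<notin> T" for j
    proof (rule ccontr)
      assume "\<not> ?thesis"
      then have b: "real N * (real N * s0 - real l) - real j \<in> T" "real N * (real N * s2 - real l) - real j \<in> T"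
        using s0 s2 by blast+
      have "real j \<le> 0" using T01[OF b(1)] s0r(3) by simp
      moreover have "real N * (real N * s2 - real l) = real l + s0" using s2(3) s1(3) by simp
      then have "real l + s0 - real j \<le> 1" using T01[OF b(2)] by simp
      ultimately show False using s0r lN by linarith
    qed
    show ?thesis using 1 2 3 4 by blast
  qed
  then show "Suc l \<notin> P" and "\<And>d. Suc d = l \<Longrightarrow> d \<notin> P"
    and "\<And>j. \<exists>s. s \<in> T \<and> s \<in> B \<and> real N * s - real j \<notin> B"
    and "\<And>j. \<exists>s. s \<in> T \<and> s \<in> B \<and> real N * (real N * s - real l) - real j \<notin> T" by auto
qed

end

subsection \<open>Contacts between adjacent cells\<close>

context carpet
begin

text \<open>Sides of the unit square are named by a direction \<open>c\<close> and a Boolean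
  \<open>b\<close>: \<open>True\<close> is the side at coordinate 1, \<open>False\<close> the one at
  0. \<open>dg b\<close> is the digit of the subcells along that side.\<close>

definition dg :: "bool \<Rightarrow> nat" where "dg b = (if b then N - 1 else 0)"

definition shf :: "bool \<Rightarrow> int" where "shf b = (if b then 1 else - 1)"

definition side :: "bool \<Rightarrow> bool \<Rightarrow> real set" where
  "side c b = {t. pt c (of_bool b) t \<in> F}"

definition side_digits :: "bool \<Rightarrow> bool \<Rightarrow> nat set" where
  "side_digits c b = {d. pt c (dg b) d \<in> D}"

definition contact :: "digit \<Rightarrow> (real \<times> real) set" where
  "contact i = cell [i] \<inter> (\<Union>j\<in>D - {i}. cell [j])"

definition nbr :: "digit \<Rightarrow> bool \<Rightarrow> bool \<Rightarrow> digit \<Rightarrow> bool" where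
  "nbr i c b j \<longleftrightarrow> j \<in> D \<and> int (crd c j) = int (crd c i) + shf b \<and> crd (\<not> c) j = crd (\<not> c) i"

lemma dg_inj: "dg b = dg b' \<longleftrightarrow> b = b'"
  using N2 by (auto simp: dg_def)

lemma F_01: "z \<in> F \<Longrightarrow> 0 \<le> crd c z \<and> crd c z \<le> 1"
  using F_ge F_le by blast

lemma idx_bounds: "set w \<subseteq> D \<Longrightarrow> 0 \<le> real_of_int (idx N c w) \<and> real_of_int (idx N c w) + 1 \<le> real N ^ length w"
proof -
  assume w: "set w \<subseteq> D"
  have "idx N c w + 1 \<le> int (N ^ length w)" using idx_less[OF w, of c] by simp
  then have "real_of_int (idx N c w + 1) \<le> real_of_int (int (N ^ length w))" by linarith
  then show ?thesis using idx_nonneg[of c w] by simp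
qed

text \<open>A coordinate equal to 0 or 1 leaves no room: the grid position must be extreme, and the
  preimage lies on the same side.\<close>

lemma boundary_word:
  assumes "y \<in> F" "set w \<subseteq> D" "real N ^ length w * of_bool b = crd c y + real_of_int (idx N c w)"
  shows "crd c y = of_bool b" "idx N c w = (if b then int N ^ length w - 1 else 0)"
proof -
  have "crd c y = of_bool b \<and> real_of_int (idx N c w) = (if b then real N ^ length w - 1 else 0)"
    using F_01[OF assms(1), of c] idx_bounds[OF assms(2), of c] assms(3) by (cases b) auto
  moreover have "real_of_int (int N ^ length w - 1) = real N ^ length w - 1" by simp
  ultimately show "crd c y = of_bool b" "idx N c w = (if b then int N ^ length w - 1 else 0)"
    by (metis of_int_eq_iff of_int_0)+
qed

lemma boundary_digit:
  assumes "y \<in> F" "l \<in> D" "real N * of_bool b = crd c y + real (crd c l)"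
  shows "crd c y = of_bool b" "crd c l = dg b"
proof -
  have eq: "real N ^ length [l] * of_bool b = crd c y + real_of_int (idx N c [l])" and l: "set [l] \<subseteq> D"
    using assms by auto
  show "crd c y = of_bool b" by (rule boundary_word(1)[OF assms(1) l eq])
  show "crd c l = dg b"
    using boundary_word(2)[OF assms(1) l eq] N_pos by (auto simp: dg_def split: if_splits)
qed

lemma mem_cell1: "z \<in> cell [i] \<longleftrightarrow> (\<exists>y\<in>F. \<forall>c. real N * crd c z = crd c y + real (crd c i))"
  by (simp add: mem_cell_iff)

lemma F_digit: "z \<in> F \<longleftrightarrow> (\<exists>i\<in>D. \<exists>y\<in>F. \<forall>c. real N * crd c z = crd c y + real (crd c i))"
proof -
  have "W 1 = (\<lambda>i. [i]) ` D" by (auto simp: words_iff length_Suc_conv)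
  then have "z \<in> F \<longleftrightarrow> (\<exists>i\<in>D. z \<in> cell [i])" using F_words[of 1] by auto
  then show ?thesis by (simp add: mem_cell1)
qed

lemma side_iff: "t \<in> side c b \<longleftrightarrow> (\<exists>d\<in>side_digits c b. real N * t - real d \<in> side c b)"
proof
  assume "t \<in> side c b"
  then obtain i y where iy: "i \<in> D" "y \<in> F"
    "\<And>c'. real N * crd c' (pt c (of_bool b) t) = crd c' y + real (crd c' i)"
    unfolding side_def using F_digit by blast
  have bd: "crd c y = of_bool b" "crd c i = dg b" using boundary_digit[OF iy(2,1)] iy(3)[of c] by auto
  have "real N * t = crd (\<not> c) y + real (crd (\<not> c) i)" using iy(3)[of "\<not> c"] by simp
  then have "pt c (of_bool b) (real N * t - real (crd (\<not> c) i)) = y" using bd pt_crd[of c y] by simp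
  moreover have "crd (\<not> c) i \<in> side_digits c b" using bd iy pt_crd[of c i] by (simp add: side_digits_def)
  ultimately show "\<exists>d\<in>side_digits c b. real N * t - real d \<in> side c b" using iy(2) by (auto simp: side_def)
next
  assume "\<exists>d\<in>side_digits c b. real N * t - real d \<in> side c b"
  then obtain d where d: "pt c (dg b) d \<in> D" "pt c (of_bool b) (real N * t - real d) \<in> F"
    by (auto simp: side_def side_digits_def)
  have "\<forall>c'. real N * crd c' (pt c (of_bool b) t) =
      crd c' (pt c (of_bool b) (real N * t - real d)) + real (crd c' (pt c (dg b) d))"
    unfolding all_crd_iff[of _ c] using N_pos by (auto simp: dg_def)
  then have "pt c (of_bool b) t \<in> F" by (rule F_digit[THEN iffD2, OF bexI[OF bexI[OF _ d(2)] d(1)]])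
  then show "t \<in> side c b" by (simp add: side_def)
qed

lemma side_01: "t \<in> side c b \<Longrightarrow> 0 \<le> t \<and> t \<le> 1"
  unfolding side_def using F_01[of "pt c (of_bool b) t" "\<not> c"] by simp

lemma side_digits_less: "d \<in> side_digits c b \<Longrightarrow> d < N"
  unfolding side_digits_def using digit_less[of "pt c (dg b) d" "\<not> c"] by simp

lemma self_similar_sides: "self_similar_pair N (side c b) (side c b') (side_digits c b) (side_digits c b')"
  by (intro self_similar_pair.intro N2 side_digits_less side_01 side_iff)

text \<open>The map of \<open>i\<close> fixes \<open>z\<close> and shrinks its distance to
  \<open>F\<close>, so this distance is 0.\<close>

lemma fixed_point_mem:
  assumes i: "i \<in> D" and z: "\<And>c. real N * crd c z = crd c z + real (crd c i)"
  shows "z \<in> F"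
proof -
  have zi: "gsc_map N i z = z"
    by (rule crd_eqI) (use z N_pos in \<open>simp add: crd_gsc_map field_simps\<close>)
  obtain g where g: "g \<in> F" "infdist z F = dist z g"
    using infdist_attains_inf[of F z] compact_F F_ne compact_imp_closed by metis
  have "gsc_map N i g \<in> F" using F_eq i g by blast
  then have "infdist z F \<le> dist (gsc_map N i z) (gsc_map N i g)"
    unfolding zi by (rule infdist_le)
  then have "dist z g \<le> dist z g / real N" by (simp add: dist_gsc_map g)
  moreover have "dist z g / real N \<le> dist z g / 2" using N2 by (intro divide_left_mono) auto
  ultimately have "dist z g \<le> dist z g / 2" by linarith
  then show ?thesis using g by simp
qed

lemma corner_mem: "pt c (dg b) (dg b') \<in> D \<Longrightarrow> pt c (of_bool b) (of_bool b') \<in> F"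
proof (erule fixed_point_mem)
  fix c'
  have "\<forall>c'. real N * crd c' (pt c (of_bool b) (of_bool b') :: real \<times> real) =
    crd c' (pt c (of_bool b) (of_bool b')) + real (crd c' (pt c (dg b) (dg b')))"
    unfolding all_crd_iff[of _ c] using N_pos by (auto simp: dg_def)
  then show "real N * crd c' (pt c (of_bool b) (of_bool b') :: real \<times> real) =
    crd c' (pt c (of_bool b) (of_bool b')) + real (crd c' (pt c (dg b) (dg b')))" by blast
qed

text \<open>The two preimages of \<open>z\<close> lie in the unit square and differ by an integer
  vector. Its entries are 0, 1 or -1, and a nonzero entry puts the preimages on opposite
  sides.\<close>

lemma touch_coords:
  assumes "length u = length v" "z \<in> cell u" "z \<in> cell v"
  obtains y y' where "y \<in> F" "y' \<in> F"
    "\<And>c. real N ^ length u * crd c z = crd c y + real_of_int (idx N c u)"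
    "\<And>c. real N ^ length u * crd c z = crd c y' + real_of_int (idx N c v)"
    "\<And>c. (idx N c v = idx N c u \<and> crd c y' = crd c y) \<or>
         (\<exists>b. idx N c v = idx N c u + shf b \<and> crd c y = of_bool b \<and> crd c y' = of_bool (\<not> b))"
proof -
  obtain y where y: "y \<in> F" "\<And>c. real N ^ length u * crd c z = crd c y + real_of_int (idx N c u)"
    using assms(2) unfolding mem_cell_iff by blast
  obtain y' where y': "y' \<in> F" "\<And>c. real N ^ length u * crd c z = crd c y' + real_of_int (idx N c v)"
    using assms(3) unfolding mem_cell_iff assms(1) by blast
  have "(idx N c v = idx N c u \<and> crd c y' = crd c y) \<or>
         (\<exists>b. idx N c v = idx N c u + shf b \<and> crd c y = of_bool b \<and> crd c y' = of_bool (\<not> b))" for c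
  proof -
    define k where "k = idx N c v - idx N c u"
    have eq: "crd c y = crd c y' + real_of_int k" using y(2)[of c] y'(2)[of c] by (simp add: k_def)
    have r: "0 \<le> crd c y" "crd c y \<le> 1" "0 \<le> crd c y'" "crd c y' \<le> 1" using F_01 y(1) y'(1) by auto
    then have "\<bar>real_of_int k\<bar> \<le> 1" using eq by linarith
    then consider "k = 0" | "k = 1" | "k = - 1" by linarith
    then show ?thesis
    proof cases
      case 2
      then show ?thesis using eq r by (intro disjI2 exI[of _ True]) (auto simp: k_def shf_def)
    next
      case 3
      then show ?thesis using eq r by (intro disjI2 exI[of _ False]) (auto simp: k_def shf_def)
    qed (use eq in \<open>auto simp: k_def\<close>)
  qed
  then show thesis using that[OF y(1) y'(1) y(2) y'(2)] by blast
qed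

lemma touchI:
  assumes "length u = length v" "p \<in> F" "q \<in> F"
    and "\<And>c. crd c p + real_of_int (idx N c u) = crd c q + real_of_int (idx N c v)"
  shows "word_map N u p = word_map N v q" "word_map N u p \<in> cell u \<inter> cell v"
proof -
  show eq: "word_map N u p = word_map N v q"
    by (rule crd_eqI) (simp add: crd_word_map[OF N_pos] assms)
  show "word_map N u p \<in> cell u \<inter> cell v" using assms(2,3) eq unfolding cell_def by (metis IntI imageI)
qed

lemma nbr_contact:
  assumes "i \<in> D" "nbr i c b j" "s \<in> side c b" "s \<in> side c (\<not> b)"
  shows "gsc_map N i (pt c (of_bool b) s) \<in> contact i"
proof -
  have j: "j \<in> D" "int (crd c j) = int (crd c i) + shf b" "crd (\<not> c) j = crd (\<not> c) i"
    using assms(2) by (auto simp: nbr_def)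
  then have "j \<noteq> i" by (auto simp: shf_def split: if_splits)
  have rj: "real (crd c j) = real (crd c i) + real_of_int (shf b)"
    using j(2) by (metis of_int_add of_int_of_nat_eq)
  have "\<forall>c'. crd c' (pt c (of_bool b) s) + real_of_int (idx N c' [i]) =
        crd c' (pt c (of_bool (\<not> b)) s) + real_of_int (idx N c' [j])"
    unfolding all_crd_iff[of _ c] using rj j(3) by (auto simp: shf_def)
  then have "word_map N [i] (pt c (of_bool b) s) \<in> cell [i] \<inter> cell [j]"
    using assms(3,4) by (intro touchI(2)[of "[i]" "[j]" _ "pt c (of_bool (\<not> b)) s"]) (auto simp: side_def)
  then show ?thesis using \<open>j \<noteq> i\<close> j(1) by (auto simp: contact_def)
qed

text \<open>Either the cells share a grid edge and \<open>z\<close> comes from a common point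
  \<open>s\<close> of opposite sides of \<open>F\<close>, or they share only a grid point and
  \<open>F\<close> contains the two opposite corners.\<close>

lemma neighbour_cases:
  assumes j: "j \<in> D" "j \<noteq> i" "z \<in> cell [i]" "z \<in> cell [j]"
  obtains (sided) c b s where "nbr i c b j" "s \<in> side c b" "s \<in> side c (\<not> b)"
      "z = gsc_map N i (pt c (of_bool b) s)" "z = gsc_map N j (pt c (of_bool (\<not> b)) s)"
  | (corner) f where "\<And>c. int (crd c j) = int (crd c i) + shf (f c)"
      "pt True (of_bool (f True)) (of_bool (f False)) \<in> F"
      "pt True (of_bool (\<not> f True)) (of_bool (\<not> f False)) \<in> F"
      "z = gsc_map N i (pt True (of_bool (f True)) (of_bool (f False)))"
      "z = gsc_map N j (pt True (of_bool (\<not> f True)) (of_bool (\<not> f False)))"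
proof -
  obtain y y' where y: "y \<in> F" "y' \<in> F"
    and yz: "\<And>c. real N ^ length [i] * crd c z = crd c y + real_of_int (idx N c [i])"
    and yz': "\<And>c. real N ^ length [i] * crd c z = crd c y' + real_of_int (idx N c [j])"
    and st: "\<And>c. (idx N c [j] = idx N c [i] \<and> crd c y' = crd c y) \<or>
         (\<exists>b. idx N c [j] = idx N c [i] + shf b \<and> crd c y = of_bool b \<and> crd c y' = of_bool (\<not> b))"
    using touch_coords[of "[i]" "[j]" z] j by (metis length_Cons list.size(3))
  have z: "z = gsc_map N i y"
    by (rule crd_eqI) (use yz N_pos in \<open>auto simp: crd_gsc_map field_simps\<close>)
  have z': "z = gsc_map N j y'"
    by (rule crd_eqI) (use yz' N_pos in \<open>auto simp: crd_gsc_map field_simps\<close>)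
  show thesis
  proof (cases "\<exists>c. crd c j = crd c i")
    case True
    then obtain c0 where c0: "crd c0 j = crd c0 i" by blast
    define c where "c = (\<not> c0)"
    have nc: "crd (\<not> c) j = crd (\<not> c) i" using c0 by (simp add: c_def)
    have ne: "crd c j \<noteq> crd c i" using nc j(2) crd_eqI2 by metis
    obtain b where b: "int (crd c j) = int (crd c i) + shf b" "crd c y = of_bool b" "crd c y' = of_bool (\<not> b)"
      using st[of c] ne by auto
    have eq: "crd (\<not> c) y' = crd (\<not> c) y" using st[of "\<not> c"] nc by (auto simp: shf_def split: if_splits)
    have py: "y = pt c (of_bool b) (crd (\<not> c) y)" "y' = pt c (of_bool (\<not> b)) (crd (\<not> c) y)"
      using b eq crd_eqI3 by metis+
    show thesis
      by (rule sided[of c b "crd (\<not> c) y"]) (use b nc j py y z z' in \<open>auto simp: nbr_def side_def\<close>)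
  next
    case False
    then have "\<forall>c. \<exists>b. int (crd c j) = int (crd c i) + shf b \<and> crd c y = of_bool b \<and> crd c y' = of_bool (\<not> b)"
      using st by force
    then obtain f where f: "\<And>c. int (crd c j) = int (crd c i) + shf (f c)" "\<And>c. crd c y = of_bool (f c)"
      "\<And>c. crd c y' = of_bool (\<not> f c)" by metis
    have "y = pt True (of_bool (f True)) (of_bool (f False))"
      "y' = pt True (of_bool (\<not> f True)) (of_bool (\<not> f False))"
      using f(2,3)[of True] f(2,3)[of False] by (auto simp: crd_def pt_def prod_eq_iff)
    then show thesis using corner[of f] f(1) y z z' by simp
  qed
qed

lemma contact_cases:
  assumes "i \<in> D" "z \<in> contact i"
  obtains (sided) c b s j where "nbr i c b j" "s \<in> side c b" "s \<in> side c (\<not> b)"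
      "z = gsc_map N i (pt c (of_bool b) s)"
  | (corner) f j where "j \<in> D" "\<And>c. int (crd c j) = int (crd c i) + shf (f c)"
      "pt True (of_bool (f True)) (of_bool (f False)) \<in> F"
      "pt True (of_bool (\<not> f True)) (of_bool (\<not> f False)) \<in> F"
      "z = gsc_map N i (pt True (of_bool (f True)) (of_bool (f False)))"
proof -
  obtain j where j: "j \<in> D" "j \<noteq> i" "z \<in> cell [i]" "z \<in> cell [j]"
    using assms by (auto simp: contact_def)
  then show thesis
  proof (cases rule: neighbour_cases)
    case (sided c b s)
    then show thesis using that(1) by metis
  next
    case (corner f)
    then show thesis using that(2)[OF j(1)] by metis
  qed
qed

lemma contact_in_subcell:
  assumes "set w \<subseteq> D" "gsc_map N i (pt c (of_bool b) s) \<in> cell (i # w)"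
  shows "idx N c w = (if b then int N ^ length w - 1 else 0)"
    "real N ^ length w * s - real_of_int (idx N (\<not> c) w) \<in> side c b"
proof -
  have "gsc_map N i (pt c (of_bool b) s) \<in> gsc_map N i ` cell w"
    using assms(2) cell_append[of "[i]" w] by simp
  then have "pt c (of_bool b) s \<in> cell w" using inj_image_mem_iff[OF inj_gsc_map[OF N_pos]] by blast
  then obtain y where y: "y \<in> F"
    "\<And>c'. real N ^ length w * crd c' (pt c (of_bool b) s) = crd c' y + real_of_int (idx N c' w)"
    unfolding mem_cell_iff by blast
  have b: "crd c y = of_bool b" "idx N c w = (if b then int N ^ length w - 1 else 0)"
    using boundary_word[OF y(1) assms(1), of b c] y(2)[of c] by auto
  show "idx N c w = (if b then int N ^ length w - 1 else 0)" by (rule b)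
  have "crd (\<not> c) y = real N ^ length w * s - real_of_int (idx N (\<not> c) w)"
    using y(2)[of "\<not> c"] by simp
  then have "y = pt c (of_bool b) (real N ^ length w * s - real_of_int (idx N (\<not> c) w))"
    using b crd_eqI3 by metis
  then show "real N ^ length w * s - real_of_int (idx N (\<not> c) w) \<in> side c b" using y by (simp add: side_def)
qed

lemma contact_in_digit:
  assumes "l \<in> D" "gsc_map N i (pt c (of_bool b) s) \<in> cell [i, l]"
  shows "crd c l = dg b" "real N * s - real (crd (\<not> c) l) \<in> side c b"
  using contact_in_subcell[of "[l]" i c b s] assms N_pos by (auto simp: dg_def split: if_splits)

text \<open>If the opposite side also uses the digit \<open>dg b'\<close> at \<open>s\<close>, the
  remainder \<open>N * s - dg b'\<close> is a new common point, because this map fixes only the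
  corner. If it uses another digit, its remainder is the corner \<open>of_bool b'\<close>, which
  lies on side \<open>b\<close> as well.\<close>

lemma second_side_point:
  assumes l: "l \<in> D" "crd c l = dg b" "crd (\<not> c) l = dg b'"
    and s: "s \<in> side c b" "s \<in> side c (\<not> b)" "real N * s - real (dg b') \<in> side c b" "s \<noteq> of_bool b'"
  shows "\<exists>t. t \<in> side c b \<and> t \<in> side c (\<not> b) \<and> t \<noteq> s"
proof -
  have "pt c (dg b) (dg b') \<in> D" using l pt_crd[of c l] by simp
  then have k: "of_bool b' \<in> side c b" using corner_mem by (simp add: side_def)
  define t where "t = real N * s - real (dg b')"
  have t: "t \<in> side c b" using s(3) by (simp add: t_def)
  obtain d where d: "d \<in> side_digits c (\<not> b)" "real N * s - real d \<in> side c (\<not> b)" using s(2) side_iff by blast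
  have dN: "d < N" using d side_digits_less by blast
  have r: "0 \<le> t" "t \<le> 1" "0 \<le> real N * s - real d" "real N * s - real d \<le> 1" using side_01[OF t] side_01[OF d(2)] by auto
  show ?thesis
  proof (cases "d = dg b'")
    case True
    have "t \<noteq> s"
    proof
      assume "t = s"
      then have "real N * s - s = real (dg b')" by (simp add: t_def)
      then have "(real N - 1) * s = (real N - 1) * of_bool b'"
        using N_pos by (auto simp: dg_def algebra_simps)
      moreover have "real N - 1 \<noteq> 0" using N2 by simp
      ultimately show False using s(4) by simp
    qed
    then show ?thesis using t d True by (auto simp: t_def)
  next
    case False
    have "real N * s - real d = of_bool b'"
    proof (cases b')
      case True
      then have dg: "dg b' = N - 1" by (simp add: dg_def)
      then have "real d + 1 \<le> real (dg b')" using False dN by linarith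
      then show ?thesis using r True by (simp add: t_def)
    next
      case b': False
      then have dg: "dg b' = 0" by (simp add: dg_def)
      then have "real d \<ge> 1" using False by linarith
      then show ?thesis using r b' dg by (simp add: t_def)
    qed
    then show ?thesis using k d s(4) by auto
  qed
qed

definition two_pts :: "'a set \<Rightarrow> bool" where
  "two_pts S \<longleftrightarrow> (\<exists>s t. s \<in> S \<and> t \<in> S \<and> s \<noteq> t)"

text \<open>If no side had two common points, two contact points inside \<open>[i, l]\<close> would
  come from different sides or from a corner, and \<open>l\<close> would be a corner digit. This
  case is impossible by \<open>second_side_point\<close>.\<close>

lemma contact_side_ex:
  assumes i: "i \<in> D" and l: "l \<in> D" and sub: "contact i \<subseteq> cell [i, l]" and two: "two_pts (contact i)"
  shows "\<exists>c b j. nbr i c b j \<and> two_pts (side c b \<inter> side c (\<not> b))"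
proof (rule ccontr)
  assume no: "\<not> ?thesis"
  have corner: "y = pt c (of_bool b) (of_bool b')"
    if gy: "gsc_map N i y \<in> contact i" and lc: "crd c l = dg b" "crd (\<not> c) l = dg b'" for y c b b'
    using i gy
  proof (cases rule: contact_cases)
    case (sided c1 b1 s j)
    have y: "y = pt c1 (of_bool b1) s" by (rule injD[OF inj_gsc_map[OF N_pos] sided(4)])
    have "gsc_map N i (pt c1 (of_bool b1) s) \<in> cell [i, l]" using gy sub y by auto
    note cd = contact_in_digit[OF l this]
    obtain b2 where b2: "crd (\<not> c1) l = dg b2" using lc by (cases "c1 = c") auto
    have "s = of_bool b2"
    proof (rule ccontr)
      assume ne: "s \<noteq> of_bool b2"
      have "\<exists>t. t \<in> side c1 b1 \<and> t \<in> side c1 (\<not> b1) \<and> t \<noteq> s"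
        using cd b2 by (intro second_side_point[OF l _ b2 sided(2,3) _ ne]) auto
      then show False using no sided unfolding two_pts_def by blast
    qed
    then show ?thesis
      using y cd(1) b2 lc dg_inj by (cases c; cases c1) (auto simp: pt_def)
  next
    case (corner f j)
    have y: "y = pt True (of_bool (f True)) (of_bool (f False))"
      by (rule injD[OF inj_gsc_map[OF N_pos] corner(5)])
    have y2: "y = pt False (of_bool (f False)) (of_bool (f True))" using y by (simp add: pt_def)
    have "gsc_map N i y \<in> cell [i, l]" using gy sub by auto
    then have "crd True l = dg (f True)" "crd False l = dg (f False)"
      using contact_in_digit(1)[OF l] y y2 by metis+
    then show ?thesis using y lc dg_inj by (cases c) (auto simp: pt_def)
  qed
  obtain z1 z2 where z: "z1 \<in> contact i" "z2 \<in> contact i" "z1 \<noteq> z2" using two by (auto simp: two_pts_def)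
  \<comment> \<open>For a corner digit \<open>l\<close> every contact point is the image of that
    corner, so there would be only one.\<close>
  have both: False if "crd True l = dg b" "crd False l = dg b'" for b b'
  proof -
    have "z1 \<in> gsc_map N i ` F" "z2 \<in> gsc_map N i ` F" using z by (auto simp: contact_def cell_def)
    then obtain y1 y2 where "z1 = gsc_map N i y1" "z2 = gsc_map N i y2" by blast
    then show False using corner[of y1 True b b'] corner[of y2 True b b'] z that by auto
  qed
  have sided_ex: "\<exists>c b s j. nbr i c b j \<and> s \<in> side c b \<and> s \<in> side c (\<not> b) \<and> z = gsc_map N i (pt c (of_bool b) s)"
    if "z \<in> contact i" for z
    using i that
  proof (cases rule: contact_cases)
    case (corner f j)
    have "z \<in> cell [i, l]" using sub that by blast
    then have T: "gsc_map N i (pt True (of_bool (f True)) (of_bool (f False))) \<in> cell [i, l]"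
      using corner(5) by metis
    then have "gsc_map N i (pt False (of_bool (f False)) (of_bool (f True))) \<in> cell [i, l]"
      by (simp add: pt_def)
    then have "crd True l = dg (f True)" "crd False l = dg (f False)"
      using contact_in_digit(1)[OF l] T by metis+
    then show ?thesis using both by blast
  next
    case (sided c b s j)
    then show ?thesis by metis
  qed
  obtain c1 b1 s1 j1 where 1: "nbr i c1 b1 j1" "s1 \<in> side c1 b1" "s1 \<in> side c1 (\<not> b1)" "z1 = gsc_map N i (pt c1 (of_bool b1) s1)"
    using sided_ex[OF z(1)] by blast
  obtain c2 b2 s2 j2 where 2: "nbr i c2 b2 j2" "s2 \<in> side c2 b2" "s2 \<in> side c2 (\<not> b2)" "z2 = gsc_map N i (pt c2 (of_bool b2) s2)"
    using sided_ex[OF z(2)] by blast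
  have l1: "crd c1 l = dg b1" using contact_in_digit(1)[OF l] 1 z sub by blast
  have l2: "crd c2 l = dg b2" using contact_in_digit(1)[OF l] 2 z sub by blast
  show False
  proof (cases "c1 = c2")
    case True
    then have "b1 = b2" using l1 l2 dg_inj by simp
    then have "s1 \<noteq> s2" using 1 2 z True by auto
    then show False using no 1 2 True \<open>b1 = b2\<close> unfolding two_pts_def by blast
  next
    case False
    then show False using both l1 l2 by (cases c1; cases c2) auto
  qed
qed

text \<open>Translates the planar situation into expansions along one pair of opposite sides, where
  \<open>digit_isolated\<close> applies.\<close>

lemma contact_pair_in_digit:
  assumes i: "i \<in> D" and l: "l \<in> D" and sub: "contact i \<subseteq> cell [i, l]" and two: "two_pts (contact i)"
  obtains c b j where "nbr i c b j" "crd c l = dg b"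
    "\<And>s. s \<in> side c b \<Longrightarrow> s \<in> side c (\<not> b) \<Longrightarrow> gsc_map N i (pt c (of_bool b) s) \<in> contact i"
    "pair_in_digit N (side c b) (side c (\<not> b)) (side_digits c b) (side_digits c (\<not> b)) (crd (\<not> c) l)"
proof -
  obtain c b j where n: "nbr i c b j" and two': "two_pts (side c b \<inter> side c (\<not> b))"
    using contact_side_ex[OF assms] by blast
  have con: "gsc_map N i (pt c (of_bool b) s) \<in> contact i" if "s \<in> side c b" "s \<in> side c (\<not> b)" for s
    using nbr_contact[OF i n that] .
  obtain s0 where "s0 \<in> side c b" "s0 \<in> side c (\<not> b)" using two' by (auto simp: two_pts_def)
  then have lc: "crd c l = dg b" using contact_in_digit(1)[OF l] con sub by blast
  interpret self_similar_pair N "side c b" "side c (\<not> b)" "side_digits c b" "side_digits c (\<not> b)"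
    by (rule self_similar_sides)
  have "pair_in_digit N (side c b) (side c (\<not> b)) (side_digits c b) (side_digits c (\<not> b)) (crd (\<not> c) l)"
  proof unfold_locales
    show "crd (\<not> c) l \<in> side_digits c b" using l lc pt_crd[of c l] by (simp add: side_digits_def)
    show "real N * s - real (crd (\<not> c) l) \<in> side c b" if "s \<in> side c b" "s \<in> side c (\<not> b)" for s
      using contact_in_digit(2)[OF l] con[OF that] sub by blast
    show "\<exists>s t. s \<in> side c b \<inter> side c (\<not> b) \<and> t \<in> side c b \<inter> side c (\<not> b) \<and> s \<noteq> t"
      using two' by (simp add: two_pts_def)
  qed
  then show thesis using that n lc con by blast
qed

theorem contact_not_in_third_level:
  assumes "i \<in> D" "l \<in> D" "j \<in> D" "two_pts (contact i)" "contact i \<subseteq> cell [i, l]"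
  shows "\<not> contact i \<subseteq> cell [i, l, j]"
proof
  assume sub: "contact i \<subseteq> cell [i, l, j]"
  obtain c b j' where c: "nbr i c b j'" "crd c l = dg b"
    "\<And>s. s \<in> side c b \<Longrightarrow> s \<in> side c (\<not> b) \<Longrightarrow> gsc_map N i (pt c (of_bool b) s) \<in> contact i"
    and pd: "pair_in_digit N (side c b) (side c (\<not> b)) (side_digits c b) (side_digits c (\<not> b)) (crd (\<not> c) l)"
    using contact_pair_in_digit[OF assms(1,2,5,4)] by metis
  obtain s where s: "s \<in> side c b" "s \<in> side c (\<not> b)"
    "real N * (real N * s - real (crd (\<not> c) l)) - real (crd (\<not> c) j) \<notin> side c b"
    using pair_in_digit.digit_isolated(4)[OF pd] by metis
  have "gsc_map N i (pt c (of_bool b) s) \<in> cell (i # [l, j])" using c(3)[OF s(1,2)] sub by auto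
  from contact_in_subcell(2)[OF _ this] assms(2,3)
  have "real N ^ 2 * s - (real (crd (\<not> c) l) * real N + real (crd (\<not> c) j)) \<in> side c b"
    by (simp add: power2_eq_square)
  moreover have "real N ^ 2 * s - (real (crd (\<not> c) l) * real N + real (crd (\<not> c) j))
    = real N * (real N * s - real (crd (\<not> c) l)) - real (crd (\<not> c) j)"
    by (simp add: algebra_simps power2_eq_square)
  ultimately show False using s(3) by simp
qed

text \<open>The contact side of \<open>l\<close> can lie in three ways relative to that of
  \<open>i\<close>. On the same side, the neighbour of \<open>l\<close> would leave the grid. On the
  opposite side, the third part of \<open>digit_isolated\<close> applies. In the perpendicular
  direction, the neighbour gives a digit next to \<open>l\<close> on the contact side of
  \<open>i\<close>, against the first two parts.\<close>

theorem contact_not_twice_in_subcell: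
  assumes "i \<in> D" "l \<in> D" "j \<in> D" "two_pts (contact i)" "contact i \<subseteq> cell [i, l]"
    and "two_pts (contact l)"
  shows "\<not> contact l \<subseteq> cell [l, j]"
proof
  assume sub: "contact l \<subseteq> cell [l, j]"
  obtain c b i' where c: "nbr i c b i'" "crd c l = dg b"
    "\<And>s. s \<in> side c b \<Longrightarrow> s \<in> side c (\<not> b) \<Longrightarrow> gsc_map N i (pt c (of_bool b) s) \<in> contact i"
    and pd: "pair_in_digit N (side c b) (side c (\<not> b)) (side_digits c b) (side_digits c (\<not> b)) (crd (\<not> c) l)"
    using contact_pair_in_digit[OF assms(1,2,5,4)] by metis
  obtain c2 b2 l' where c2: "nbr l c2 b2 l'" "crd c2 j = dg b2"
    "\<And>s. s \<in> side c2 b2 \<Longrightarrow> s \<in> side c2 (\<not> b2) \<Longrightarrow> gsc_map N l (pt c2 (of_bool b2) s) \<in> contact l"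
    using contact_pair_in_digit[OF assms(2,3) sub assms(6)] by metis
  have l': "l' \<in> D" "int (crd c2 l') = int (crd c2 l) + shf b2" "crd (\<not> c2) l' = crd (\<not> c2) l"
    using c2(1) by (auto simp: nbr_def)
  show False
  proof (cases "c2 = c")
    case True
    show False
    proof (cases "b2 = b")
      case b: True
      have "crd c l' < N" using digit_less[OF l'(1)] .
      then show False using l'(2) c(2) b True N_pos by (auto simp: dg_def shf_def split: if_splits)
    next
      case False
      then have b2: "b2 = (\<not> b)" by auto
      obtain s where s: "s \<in> side c b" "s \<in> side c (\<not> b)" "real N * s - real (crd (\<not> c) j) \<notin> side c (\<not> b)"
        using pair_in_digit.digit_isolated(3)[OF pd] by metis
      have "gsc_map N l (pt c (of_bool (\<not> b)) s) \<in> cell [l, j]" using c2(3)[of s] s sub True b2 by auto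
      from contact_in_digit(2)[OF assms(3) this] s(3) show False by simp
    qed
  next
    case False
    then have cc: "c2 = (\<not> c)" by auto
    then have "crd c l' = dg b" using l'(3) c(2) by simp
    then have mem: "crd (\<not> c) l' \<in> side_digits c b"
      using l'(1) pt_crd[of c l'] by (simp add: side_digits_def)
    have "int (crd (\<not> c) l') = int (crd (\<not> c) l) + shf b2" using l'(2) cc by simp
    then have "crd (\<not> c) l' = Suc (crd (\<not> c) l) \<or> Suc (crd (\<not> c) l') = crd (\<not> c) l"
      by (auto simp: shf_def split: if_splits)
    then show False using pair_in_digit.digit_isolated(1,2)[OF pd] mem by metis
  qed
qed

end

subsection \<open>Separation of first-level blocks\<close>

context carpet
begin

text \<open>Both compared blocks differ from the block of the deleted word, so they are intact. As
  \<open>hd\<close> is taken of \<open>w\<close>, statements about it ask for a positive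
  level.\<close>

definition separates :: "nat \<Rightarrow> bool" where
  "separates K \<longleftrightarrow> (\<exists>w\<in>W K. \<exists>a\<in>D - {hd w}. \<exists>b\<in>D - {hd w}. \<not> lk K w [a] [b])"

text \<open>If the prefix \<open>take K w\<close> does not separate two blocks, neither does
  \<open>w\<close>, which deletes less (\<open>lk_refine\<close>).\<close>

lemma separates_mono:
  assumes "separates (K + n)" "K \<ge> 1"
  shows "separates K"
proof (rule ccontr)
  assume no: "\<not> separates K"
  obtain w a b where w: "w \<in> W (K + n)" "a \<in> D" "a \<noteq> hd w" "b \<in> D" "b \<noteq> hd w" "\<not> lk (K + n) w [a] [b]"
    using assms(1) unfolding separates_def by blast
  define w1 where "w1 = take K w"
  have w1: "w1 \<in> W K" "w = w1 @ drop K w" "hd w1 = hd w" "w \<noteq> []"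
    using w(1) assms(2) set_take_subset[of K w] by (auto simp: words_iff w1_def)
  have "lk K w1 [a] [b]" using no w w1 unfolding separates_def by auto
  moreover have "off [a] w1" using w w1 assms(2) by (cases w1) (auto simp: off_def)
  ultimately have "lk (K + n) (w1 @ drop K w) [a] [b]"
    using assms(2) w by (intro lk_refine w1(1)) auto
  then show False using w w1(2) by simp
qed

lemma separates_chi:
  assumes "separates (Suc n)" "n \<ge> 1"
  shows "card D ^ n - 1 \<le> chi (W (Suc n)) E"
proof -
  obtain w a b where w: "w \<in> W (Suc n)" "a \<in> D" "a \<noteq> hd w" "b \<in> D" "b \<noteq> hd w" "\<not> lk (Suc n) w [a] [b]"
    using assms(1) unfolding separates_def by blast
  have aa: "lk (Suc n) w [a] [a]" and bb: "lk (Suc n) w [b] [b]"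
    using lk_refl[of "[a]" w] lk_refl[of "[b]" w] w(2-5) off_single[OF w(1)] by simp_all
  obtain u0 v0 where uv0: "[a] @ u0 \<in> W (Suc n)" "[b] @ v0 \<in> W (Suc n)"
    "\<not> conn E (W (Suc n) - {w}) ([a] @ u0) ([b] @ v0)"
    using w(6) unfolding lk_def by blast
  show ?thesis
  proof (rule chi_geI[OF assms(2) w(1,2,4)])
    show "conn E (W (Suc n) - {w}) (a # u) (a # u')"
      if "a # u \<in> W (Suc n) - {w}" "a # u' \<in> W (Suc n) - {w}" for u u'
      using aa that unfolding lk_def by auto
    show "conn E (W (Suc n) - {w}) (b # u) (b # u')"
      if "b # u \<in> W (Suc n) - {w}" "b # u' \<in> W (Suc n) - {w}" for u u'
      using bb that unfolding lk_def by auto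
    show "\<not> conn E (W (Suc n) - {w}) (a # u) (b # v)"
      if uv: "a # u \<in> W (Suc n) - {w}" "b # v \<in> W (Suc n) - {w}" for u v
    proof
      assume "conn E (W (Suc n) - {w}) (a # u) (b # v)"
      moreover have "conn E (W (Suc n) - {w}) (a # u0) (a # u)" "conn E (W (Suc n) - {w}) (b # v) (b # v0)"
        using aa bb uv uv0 unfolding lk_def by auto
      ultimately have "conn E (W (Suc n) - {w}) (a # u0) (b # v0)" using conn_trans by metis
      then show False using uv0 by simp
    qed
  qed
qed

lemma not_separatesD:
  assumes "\<not> separates k" "k \<ge> 1" "k \<le> K" "w \<in> W K" "a \<in> D" "a \<noteq> hd w" "b \<in> D" "b \<noteq> hd w"
  shows "lk K w [a] [b]"
proof -
  have "\<not> separates K" using separates_mono[of k "K - k"] assms by auto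
  then show ?thesis using assms by (auto simp: separates_def)
qed

text \<open>Each of the first three layers is linked in itself. If the first two do not touch, the
  third serves as a detour: a point of \<open>contact i0\<close> outside \<open>[i0, i1, i2]\<close>
  links it to the first layer, and a point of \<open>contact i1\<close> outside
  \<open>[i1, i2]\<close>, moved into block \<open>i0\<close>, links it to the second. The third
  layer lives in a copy of level \<open>K - 2\<close>, hence the bound \<open>k + 2\<close>.\<close>

lemma consecutive_layers_linked:
  assumes k: "\<not> separates k" "k \<ge> 1" and two: "\<And>i. i \<in> D \<Longrightarrow> two_pts (contact i)"
    and K: "K \<ge> k + 2" and w: "w \<in> W K" "w = i0 # i1 # i2 # w'"
    and a: "a \<in> D" "a \<noteq> i0" and b: "b \<in> D" "b \<noteq> i1"
  shows "lk K w [a] [i0, b]"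
proof (rule ccontr)
  assume nl: "\<not> lk K w [a] [i0, b]"
  have iD: "i0 \<in> D" "i1 \<in> D" "i2 \<in> D" using w by (auto simp: words_iff)
  have L0: "lk K w [x] [y]" if "x \<in> D" "x \<noteq> i0" "y \<in> D" "y \<noteq> i0" for x y
    using not_separatesD[OF k, of K w x y] that K w by auto
  have L1: "lk K w [i0, x] [i0, y]" if "x \<in> D" "x \<noteq> i1" "y \<in> D" "y \<noteq> i1" for x y
  proof -
    have "i1 # i2 # w' \<in> W (K - 1)" using w by (auto simp: words_iff)
    then have "lk (K - 1) (i1 # i2 # w') [x] [y]" using not_separatesD[OF k, of "K - 1"] that K by auto
    from lk_prefix[OF this, of "[i0]"] iD w K show ?thesis by simp
  qed
  have L2: "lk K w [i0, i1, x] [i0, i1, y]" if "x \<in> D" "x \<noteq> i2" "y \<in> D" "y \<noteq> i2" for x y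
  proof -
    have "i2 # w' \<in> W (K - 2)" using w by (auto simp: words_iff)
    then have "lk (K - 2) (i2 # w') [x] [y]" using not_separatesD[OF k, of "K - 2"] that K by auto
    moreover have "Suc (Suc (K - 2)) = K" using K by simp
    ultimately show ?thesis using lk_prefix[of "K - 2" _ _ _ "[i0, i1]"] iD w(2) by fastforce
  qed
  have K3: "K \<ge> 3" using K k by simp
  have offs: "off [x] w \<longleftrightarrow> x \<noteq> i0" "off [i0, x] w \<longleftrightarrow> x \<noteq> i1" "off [i0, i1, x] w \<longleftrightarrow> x \<noteq> i2" for x
    unfolding w(2) off_def by auto
  have disj: False if z: "z \<in> cell [x]" "z \<in> cell [i0, y]" and x: "x \<in> D" "x \<noteq> i0" and y: "y \<in> D" "y \<noteq> i1" for x y z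
  proof -
    have "lk K w [x] [i0, y]"
      using x y iD K3 offs by (intro lk_touch[OF _ _ _ _ _ _ z]) auto
    then have "lk K w [a] [i0, y]" using lk_trans[OF L0[OF a x]] x K3 by auto
    then have "lk K w [a] [i0, b]" using lk_trans[OF _ L1[OF y b]] y iD K3 by auto
    then show False using nl by simp
  qed
  have sub: "contact i0 \<subseteq> cell [i0, i1]"
  proof
    fix z assume "z \<in> contact i0"
    then obtain x where z: "z \<in> cell [i0]" "x \<in> D" "x \<noteq> i0" "z \<in> cell [x]" by (auto simp: contact_def)
    obtain v where v: "v \<in> W 1" "z \<in> cell ([i0] @ v)" using cell_refine[OF z(1)] by blast
    then obtain y where "v = [y]" "y \<in> D" by (auto simp: words_iff length_Suc_conv)
    then show "z \<in> cell [i0, i1]" using disj[OF z(4) _ z(2,3), of y] v by (cases "y = i1") auto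
  qed
  obtain z where z: "z \<in> contact i0" "z \<notin> cell [i0, i1, i2]"
    using contact_not_in_third_level[OF iD two[OF iD(1)] sub] by blast
  have "z \<in> cell [i0, i1]" using z sub by blast
  then obtain v where v: "v \<in> W 1" "z \<in> cell ([i0, i1] @ v)" using cell_refine by blast
  then obtain c where c: "v = [c]" "c \<in> D" by (auto simp: words_iff length_Suc_conv)
  have ci2: "c \<noteq> i2" using z v c by auto
  obtain x where x: "x \<in> D" "x \<noteq> i0" "z \<in> cell [x]" using z by (auto simp: contact_def)
  have "lk K w [x] [i0, i1, c]"
    using v c ci2 x iD K3 offs by (intro lk_touch[of _ K w _ z]) auto
  then have 1: "lk K w [a] [i0, i1, c]" using lk_trans[OF L0[OF a x(1,2)]] x K3 by auto
  obtain z' where z': "z' \<in> contact i1" "z' \<notin> cell [i1, i2]"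
    using contact_not_twice_in_subcell[OF iD two[OF iD(1)] sub two[OF iD(2)]] by blast
  then obtain y where y: "y \<in> D" "y \<noteq> i1" "z' \<in> cell [i1]" "z' \<in> cell [y]" by (auto simp: contact_def)
  obtain v' where v': "v' \<in> W 1" "z' \<in> cell ([i1] @ v')" using cell_refine[OF y(3)] by blast
  then obtain d where d: "v' = [d]" "d \<in> D" by (auto simp: words_iff length_Suc_conv)
  have di2: "d \<noteq> i2" using z' v' d by auto
  have "gsc_map N i0 z' \<in> cell [i0, i1, d]" "gsc_map N i0 z' \<in> cell [i0, y]"
    using cell_append[of "[i0]" "[i1, d]"] cell_append[of "[i0]" "[y]"] v' d y by auto
  then have "lk K w [i0, i1, d] [i0, y]"
    using d di2 y iD K3 offs by (intro lk_touch[of _ K w _ "gsc_map N i0 z'"]) auto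
  then have "lk K w [i0, i1, d] [i0, b]" using lk_trans[OF _ L1[OF y(1,2) b]] y iD K3 by auto
  then have "lk K w [i0, i1, c] [i0, b]" using lk_trans[OF L2[OF c(2) ci2 d(2) di2]] d iD K3 by auto
  then have "lk K w [a] [i0, b]" using lk_trans[OF 1] c iD K3 by auto
  then show False using nl by simp
qed

text \<open>The step from one layer to the next takes place inside the block
  \<open>take s w\<close>, where \<open>drop s w\<close> must still have length at least
  \<open>k + 2\<close>.\<close>

lemma layers_linked:
  assumes k: "\<not> separates k" "k \<ge> 1" and two: "\<And>i. i \<in> D \<Longrightarrow> two_pts (contact i)"
    and K: "K \<ge> k + 2 + s" and w: "w \<in> W K"
    and a: "a \<in> D" "a \<noteq> hd w" and b: "b \<in> D" "b \<noteq> w ! s"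
  shows "lk K w [a] (take s w @ [b])"
  using K b
proof (induction s arbitrary: b)
  case 0
  then have "b \<noteq> hd w" using w by (cases w) (auto simp: words_iff)
  then show ?case using not_separatesD[OF k _ w a] 0 by auto
next
  case (Suc s)
  obtain d where d: "d \<in> D" "d \<noteq> w ! s" using other_digit by blast
  have IH: "lk K w [a] (take s w @ [d])" using Suc d by auto
  have len: "length w = K" "set w \<subseteq> D" using w by (auto simp: words_iff)
  define r where "r = drop (s + 3) w"
  have s3: "s + 3 \<le> length w" using Suc.prems(1) k(2) len by simp
  have dr: "drop s w = w ! s # w ! Suc s # w ! (s + 2) # r"
    using s3 by (simp add: r_def Cons_nth_drop_Suc numeral_3_eq_3 numeral_2_eq_2)
  have wD: "drop s w \<in> W (K - s)" using len set_drop_subset[of s w] by (auto simp: words_iff)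
  have "lk (K - s) (drop s w) [d] [w ! s, b]"
    using consecutive_layers_linked[OF k two _ wD dr d Suc.prems(2,3)] Suc.prems(1) by auto
  then have "lk (length (take s w) + (K - s)) (take s w @ drop s w) (take s w @ [d]) (take s w @ [w ! s, b])"
    by (rule lk_prefix) (use len set_take_subset[of s w] in auto)
  moreover have "take s w @ [w ! s, b] = take (Suc s) w @ [b]"
    using s3 by (simp add: take_Suc_conv_app_nth)
  moreover have "length (take s w) + (K - s) = K" using s3 len by simp
  ultimately have "lk K w (take s w @ [d]) (take (Suc s) w @ [b])" by simp
  then show ?case using lk_trans[OF IH] d s3 len set_take_subset[of s w] by auto
qed

lemma off_first_difference:
  assumes "off u w" "length u \<le> length w"
  obtains s d r where "s < length u" "u = take s w @ d # r" "d \<noteq> w ! s"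
  using assms
proof (induction u arbitrary: w thesis)
  case Nil
  then show ?case by (simp add: off_def)
next
  case (Cons x u)
  have "w \<noteq> []" using Cons.prems(3) by auto
  then obtain y w' where w: "w = y # w'" by (meson neq_Nil_conv)
  show ?case
  proof (cases "x = y")
    case True
    have "off u w'" using Cons.prems(2) w True by (auto simp: off_def)
    moreover have "length u \<le> length w'" using Cons.prems(3) w by simp
    ultimately obtain s d r where "s < length u" "u = take s w' @ d # r" "d \<noteq> w' ! s"
      using Cons.IH[of w'] by metis
    then show ?thesis using Cons.prems(1)[of "Suc s" d r] w True by auto
  next
    case False
    then show ?thesis using Cons.prems(1)[of 0 x u] w by auto
  qed
qed

text \<open>At its first difference from \<open>w\<close>, a word branches off into one of the
  layers, and every layer is linked to the block \<open>a\<close>.\<close>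

theorem all_linked:
  assumes k: "\<not> separates k" "k \<ge> 1" and two: "\<And>i. i \<in> D \<Longrightarrow> two_pts (contact i)"
    and K: "K \<ge> k + 2 + n" and w: "w \<in> W K"
    and uv: "u \<in> W n" "v \<in> W n" "off u w" "off v w"
  shows "lk K w u v"
proof -
  obtain a where a: "a \<in> D" "a \<noteq> hd w" using other_digit by blast
  have "lk K w [a] u" if u: "u \<in> W n" "off u w" for u
  proof -
    have "length u \<le> length w" using u w K by (simp add: words_iff)
    then obtain s d r where s: "s < length u" "u = take s w @ d # r" "d \<noteq> w ! s"
      using off_first_difference[OF u(2)] by metis
    have "d \<in> D" using s(2) u(1) by (auto simp: words_iff)
    then have "lk K w [a] (take s w @ [d])"
      using layers_linked[OF k two _ w a _ s(3)] K s(1) u(1) by (auto simp: words_iff)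
    from lk_sym[OF lk_descend_left[OF lk_sym[OF this], of r]] s(2) show ?thesis by simp
  qed
  then have "lk K w [a] u" "lk K w [a] v" using uv by auto
  then show ?thesis using lk_trans[OF lk_sym[of K w "[a]" u]] a K k by auto
qed

end

subsection \<open>From cut points to separating words\<close>

context carpet
begin

text \<open>Preimages in two different cells differ by a nonzero integer vector, which fits into the
  unit square only between boundary points.\<close>

lemma crossing_boundary:
  assumes "a \<in> W K" "b \<in> W K" "a \<noteq> b" "y \<in> F" "word_map N a y \<in> cell b"
  obtains c e where "idx N c b \<noteq> idx N c a" "crd c y = of_bool e"
proof -
  have len: "length a = length b" using assms by (simp add: words_iff)
  have mem: "word_map N a y \<in> cell a" using assms(4) by (simp add: cell_def)
  obtain y1 y2 where y: "\<And>c. real N ^ length a * crd c (word_map N a y) = crd c y1 + real_of_int (idx N c a)"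
    "\<And>c. (idx N c b = idx N c a \<and> crd c y2 = crd c y1) \<or>
         (\<exists>e. idx N c b = idx N c a + shf e \<and> crd c y1 = of_bool e \<and> crd c y2 = of_bool (\<not> e))"
    using touch_coords[OF len mem assms(5)] by metis
  have "crd c y1 = crd c y" for c using y(1)[of c] N_pos by (simp add: crd_word_map)
  moreover obtain c where c: "idx N c b \<noteq> idx N c a"
    using idx_inj[of b a] assms len by (metis words_iff)
  ultimately show thesis using y(2)[of c] that by metis
qed

text \<open>A corner of the unit square forces both grid positions to be extreme, and positions
  determine the word.\<close>

lemma corner_not_crossed:
  assumes "a \<in> W K" "b \<in> W K" "z \<in> cell a" "z \<in> cell b" "\<And>c. \<exists>e. crd c z = of_bool e"
  shows "a = b"
proof (rule idx_inj)
  fix c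
  obtain e where e: "crd c z = of_bool e" using assms(5) by blast
  have "idx N c w = (if e then int N ^ K - 1 else 0)" if w: "w \<in> W K" "z \<in> cell w" for w
  proof -
    obtain y where y: "y \<in> F" "real N ^ length w * crd c z = crd c y + real_of_int (idx N c w)"
      using w(2) unfolding mem_cell_iff by blast
    then show ?thesis using boundary_word(2)[of y w e c] w e by (simp add: words_iff)
  qed
  then show "idx N c a = idx N c b" using assms by simp
qed (use assms in \<open>auto simp: words_iff\<close>)

end

section \<open>The cells around a cut point\<close>

locale cut_carpet = carpet +
  fixes x :: "real \<times> real" and U V :: "(real \<times> real) set"
  assumes x_F: "x \<in> F" and opn: "open U" "open V" and cover: "F - {x} \<subseteq> U \<union> V"
    and disj: "U \<inter> V \<inter> (F - {x}) = {}"
    and U_ne: "U \<inter> (F - {x}) \<noteq> {}" and V_ne: "V \<inter> (F - {x}) \<noteq> {}"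
begin

lemma cell_disj: "set w \<subseteq> D \<Longrightarrow> z \<in> cell w \<Longrightarrow> z \<noteq> x \<Longrightarrow> z \<in> U \<Longrightarrow> z \<in> V \<Longrightarrow> False"
  using disj cell_subset by blast

lemma connected_one_side:
  assumes "connected C" "C \<subseteq> F - {x}"
  shows "C \<subseteq> U \<or> C \<subseteq> V"
proof (rule ccontr)
  assume "\<not> ?thesis"
  then have "U \<inter> C \<noteq> {}" "V \<inter> C \<noteq> {}" using assms cover by blast+
  moreover have "U \<inter> V \<inter> C = {}" "C \<subseteq> U \<union> V" using assms cover disj by blast+
  ultimately show False using connectedD[OF assms(1) opn] by blast
qed

lemma punctured_ne: "\<exists>z. z \<in> cell w - {x}"
  using two_points by blast

text \<open>A path starting below \<open>u\<close> stays in \<open>U\<close>: two cells on different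
  sides could meet only at \<open>x\<close>, and \<open>nob\<close> says that after the deletion of
  \<open>w\<close> none do.\<close>

lemma not_linked:
  assumes K: "w \<in> W K" "x \<in> cell w" "n \<le> K"
    and uv: "u \<in> W n" "v \<in> W n" "x \<notin> cell u" "x \<notin> cell v" "cell u \<subseteq> U" "cell v \<subseteq> V"
    and one: "\<And>a. a \<in> W K \<Longrightarrow> a \<noteq> w \<Longrightarrow> cell a - {x} \<subseteq> U \<or> cell a - {x} \<subseteq> V"
    and nob: "\<And>a b. a \<in> W K \<Longrightarrow> b \<in> W K \<Longrightarrow> a \<noteq> w \<Longrightarrow> b \<noteq> w \<Longrightarrow> x \<in> cell a \<Longrightarrow> x \<in> cell b \<Longrightarrow>
       cell a - {x} \<subseteq> U \<Longrightarrow> cell b - {x} \<subseteq> V \<Longrightarrow> False"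
  shows "off u w" "off v w" "\<not> lk K w u v"
proof -
  have offp: "off p w" if "p \<in> W n" "x \<notin> cell p" for p
    unfolding off_def
  proof (intro allI notI)
    fix s assume "w = p @ s"
    then have "cell w \<subseteq> cell p" using K(1) cell_append_subset by (auto simp: words_iff)
    then show False using K that by blast
  qed
  show "off u w" "off v w" using offp uv by auto
  show "\<not> lk K w u v"
  proof
    assume lk: "lk K w u v"
    obtain s where s: "u @ s \<in> W K" using extension_ex[of u K] uv K by (auto simp: words_iff)
    obtain t where t: "v @ t \<in> W K" using extension_ex[of v K] uv K by (auto simp: words_iff)
    have "conn E (W K - {w}) (u @ s) (v @ t)" using lk s t by (auto simp: lk_def)
    then have "cell (v @ t) - {x} \<subseteq> U"
    proof (induction rule: conn_induct)
      case refl
      have "cell (u @ s) \<subseteq> cell u" using s cell_append_subset by (auto simp: words_iff)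
      then show ?case using uv by blast
    next
      case (step y z)
      have yz: "y \<in> W K" "y \<noteq> w" "z \<in> W K" "z \<noteq> w" using step by auto
      show ?case
      proof (rule ccontr)
        assume "\<not> cell z - {x} \<subseteq> U"
        then have zV: "cell z - {x} \<subseteq> V" using one yz by blast
        obtain p where p: "p \<in> cell y" "p \<in> cell z" using step(4) by (auto simp: E_iff)
        show False
        proof (cases "p = x")
          case True
          then show False using nob[OF yz(1,3,2,4)] p step.IH zV by blast
        next
          case False
          then show False using cell_disj[of y p] p step.IH zV yz by (auto simp: words_iff)
        qed
      qed
    qed
    moreover have "cell (v @ t) \<subseteq> cell v" using t cell_append_subset by (auto simp: words_iff)
    moreover obtain z where "z \<in> cell (v @ t) - {x}" using punctured_ne by blast
    ultimately show False using uv cell_disj[of "v @ t" z] t by (auto simp: words_iff)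
  qed
qed

lemma base_words:
  obtains n u v where "u \<in> W n" "v \<in> W n" "x \<notin> cell u" "x \<notin> cell v" "cell u \<subseteq> U" "cell v \<subseteq> V"
proof -
  obtain p where p: "p \<in> U" "p \<in> F" "p \<noteq> x" using U_ne by blast
  obtain q where q: "q \<in> V" "q \<in> F" "q \<noteq> x" using V_ne by blast
  obtain u where u: "set u \<subseteq> D" "p \<in> cell u" "x \<notin> cell u" using cell_avoiding[of p "[]" x] p by auto
  obtain v where v: "set v \<subseteq> D" "q \<in> cell v" "x \<notin> cell v" using cell_avoiding[of q "[]" x] q by auto
  define n where "n = max (length u) (length v)"
  obtain u' where u': "u' \<in> W (n - length u)" "p \<in> cell (u @ u')" using cell_refine[OF u(2)] by blast
  obtain v' where v': "v' \<in> W (n - length v)" "q \<in> cell (v @ v')" using cell_refine[OF v(2)] by blast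
  have x: "x \<notin> cell (u @ u')" "x \<notin> cell (v @ v')"
    using u(3) v(3) u' v' cell_append_subset by (auto simp: words_iff)
  have W: "u @ u' \<in> W n" "v @ v' \<in> W n" using u v u' v' by (auto simp: words_iff n_def)
  have "cell (u @ u') \<subseteq> F - {x}" "cell (v @ v') \<subseteq> F - {x}" using W x cell_subset[of "u @ u'"] cell_subset[of "v @ v'"] by (auto simp: words_iff)
  then have "cell (u @ u') \<subseteq> U \<or> cell (u @ u') \<subseteq> V" "cell (v @ v') \<subseteq> U \<or> cell (v @ v') \<subseteq> V"
    using connected_one_side connected_cell by blast+
  moreover have "p \<notin> V" "q \<notin> U" using p q disj by blast+
  ultimately have "cell (u @ u') \<subseteq> U" "cell (v @ v') \<subseteq> V" using u' v' by blast+
  then show thesis using that W x by blast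
qed

lemma one_side_avoiding:
  assumes "a \<in> W K" "x \<notin> cell a"
  shows "cell a - {x} \<subseteq> U \<or> cell a - {x} \<subseteq> V"
proof -
  have "cell a \<subseteq> F - {x}" using assms cell_subset by (auto simp: words_iff)
  then show ?thesis using connected_one_side[OF connected_cell] by blast
qed

text \<open>The cell without \<open>x\<close> is a copy of the connected set
  \<open>F - {y}\<close>.\<close>

lemma one_side_not_cut:
  assumes "a \<in> W K" "y \<in> F" "x = word_map N a y" "\<not> cut_point F y"
  shows "cell a - {x} \<subseteq> U \<or> cell a - {x} \<subseteq> V"
proof -
  have "connected (F - {y})" using assms by (auto simp: cut_point_def)
  then have "connected (word_map N a ` (F - {y}))"
    by (intro connected_continuous_image continuous_on_word_map)
  moreover have "word_map N a ` (F - {y}) = cell a - {x}"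
    unfolding cell_def assms(3) by (simp add: image_set_diff[OF inj_word_map[OF N_pos]])
  moreover have "cell a - {x} \<subseteq> F - {x}" using assms cell_subset by (auto simp: words_iff)
  ultimately show ?thesis using connected_one_side by simp
qed

text \<open>If two cells on each side met at \<open>x\<close>, the four cells would surround \<open>x\<close> and \<open>F\<close> would contain all corners
  of the unit square, so that adjacent cells would share a second corner.\<close>

lemma no_two_two_split:
  assumes a: "a1 \<in> W K" "a2 \<in> W K" "a1 \<noteq> a2" "x \<in> cell a1" "x \<in> cell a2" "cell a1 - {x} \<subseteq> U" "cell a2 - {x} \<subseteq> U"
    and b: "b1 \<in> W K" "b2 \<in> W K" "b1 \<noteq> b2" "x \<in> cell b1" "x \<in> cell b2" "cell b1 - {x} \<subseteq> V" "cell b2 - {x} \<subseteq> V"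
  shows False
proof -
  define A where "A = {a1, a2, b1, b2}"
  have AW: "w \<in> W K" "x \<in> cell w" if "w \<in> A" for w using that a b by (auto simp: A_def)
  have UV: False if w: "w \<in> W K" "cell w - {x} \<subseteq> U" "cell w - {x} \<subseteq> V" for w
  proof -
    obtain z where "z \<in> cell w - {x}" using punctured_ne by blast
    then show False using w cell_disj[of w z] by (auto simp: words_iff)
  qed
  have ab: "a1 \<noteq> b1" "a1 \<noteq> b2" "a2 \<noteq> b1" "a2 \<noteq> b2" using UV a b by metis+
  have cardA: "card A = 4" using a b ab by (simp add: A_def)
  \<comment> \<open>\<open>r c w\<close> is the \<open>c\<close>-coordinate of the preimage of
    \<open>x\<close> in the cell \<open>w\<close>.\<close>
  define r where "r c w = real N ^ K * crd c x - real_of_int (idx N c w)" for c w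
  have step: "idx N c v = idx N c u \<or> (\<exists>e. idx N c v = idx N c u + shf e \<and> r c u = of_bool e \<and> r c v = of_bool (\<not> e))"
    if uv: "u \<in> A" "v \<in> A" for c u v
  proof -
    have len: "length u = length v" "length u = K" using AW uv by (auto simp: words_iff)
    show ?thesis using touch_coords[OF len(1) AW(2)[OF uv(1)] AW(2)[OF uv(2)]] unfolding r_def len(2)[symmetric]
      by (smt (verit, ccfv_SIG))
  qed
  have coord: "\<exists>e. r c w = of_bool e" if w: "w \<in> A" for c w
  proof -
    \<comment> \<open>Otherwise the four cells form one row with positions pairwise at distance 1,
      which already three integers cannot satisfy.\<close>
    have "\<exists>u\<in>A. \<exists>v\<in>A. idx N c v \<noteq> idx N c u"
    proof (rule ccontr)
      assume "\<not> ?thesis"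
      then have eq: "idx N c v = idx N c u" if "u \<in> A" "v \<in> A" for u v using that by blast
      have ne: "idx N (\<not> c) v \<noteq> idx N (\<not> c) u" if "u \<in> A" "v \<in> A" "u \<noteq> v" for u v
        using idx_inj2[of u K v c] AW that eq by metis
      have "\<bar>idx N (\<not> c) v - idx N (\<not> c) u\<bar> = 1" if "u \<in> A" "v \<in> A" "u \<noteq> v" for u v
        using step[OF that(1,2), of "\<not> c"] ne[OF that] by (auto simp: shf_def split: if_splits)
      from this[of a1 a2] this[of a1 b1] this[of a2 b1] show False
        using a(3) ab by (auto simp: A_def)
    qed
    then obtain u v where uv: "u \<in> A" "v \<in> A" "idx N c v \<noteq> idx N c u" by blast
    then consider "idx N c w \<noteq> idx N c u" | "idx N c w \<noteq> idx N c v" by fastforce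
    then show ?thesis
      by cases (use step[OF uv(1) w, of c] step[OF uv(2) w, of c] in metis)+
  qed
  then have "\<forall>w. \<exists>f. w \<in> A \<longrightarrow> (\<forall>c. r c w = of_bool (f c))" by metis
  then obtain f where f: "\<And>w c. w \<in> A \<Longrightarrow> r c w = of_bool (f w c)" by metis
  have idx_f: "real_of_int (idx N c w) = real N ^ K * crd c x - of_bool (f w c)" if "w \<in> A" for c w
    using f[OF that, of c] by (simp add: r_def)
  \<comment> \<open>\<open>g w\<close> names the corner of the cell \<open>w\<close> at which
    \<open>x\<close> sits. Four cells use four different corners, so \<open>F\<close> contains all
    corners of the square.\<close>
  define g where "g w = (f w True, f w False)" for w
  have inj: "inj_on g A"
  proof (rule inj_onI)
    fix u v assume uv: "u \<in> A" "v \<in> A" "g u = g v"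
    then have "\<forall>c. f u c = f v c" by (simp add: g_def all_bool_eq)
    then have "real_of_int (idx N c u) = real_of_int (idx N c v)" for c
      using idx_f[OF uv(1), of c] idx_f[OF uv(2), of c] by simp
    then show "u = v" using idx_inj2[of u K v True] AW uv by simp
  qed
  have "card (g ` A) = card (UNIV :: (bool \<times> bool) set)" using card_image[OF inj] cardA by simp
  then have surj: "g ` A = UNIV" by (intro card_subset_eq) auto
  have res: "pt c (of_bool (f w c)) (of_bool (f w (\<not> c))) \<in> F" if w: "w \<in> A" for w c
  proof -
    obtain y where y: "y \<in> F" "\<And>c. real N ^ K * crd c x = crd c y + real_of_int (idx N c w)"
      using AW[OF w] unfolding mem_cell_iff by (auto simp: words_iff)
    have "crd c y = of_bool (f w c)" for c using f[OF w, of c] y(2)[of c] by (simp add: r_def)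
    then have "y = pt c (of_bool (f w c)) (of_bool (f w (\<not> c)))" using crd_eqI3 by metis
    then show ?thesis using y by simp
  qed
  have corners: "pt c (of_bool e) (of_bool e') \<in> F" for c e e'
  proof -
    have "(if c then (e, e') else (e', e)) \<in> g ` A" using surj by simp
    then obtain w where w: "w \<in> A" "(if c then (e, e') else (e', e)) = g w" by blast
    then have "f w c = e" "f w (\<not> c) = e'" by (auto simp: g_def split: if_splits)
    then show ?thesis using res[OF w(1), of c] by simp
  qed
  have adj: False if uv: "u \<in> A" "v \<in> A" "cell u - {x} \<subseteq> U" "cell v - {x} \<subseteq> V" "f u c = f v c" for u v c
  proof -
    have len: "length u = length v" "length u = K" using AW uv by (auto simp: words_iff)
    have "u \<noteq> v" using UV AW uv by metis
    then have ne: "f u (\<not> c) \<noteq> f v (\<not> c)"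
      using inj uv(1,2,5) by (cases c) (auto simp: inj_on_def g_def)
    \<comment> \<open>\<open>p\<close> and \<open>q\<close> describe, from either cell, the other
      end of the edge shared by \<open>u\<close> and \<open>v\<close>.\<close>
    define p where "p = (pt c (of_bool (\<not> f u c)) (of_bool (f u (\<not> c))) :: real \<times> real)"
    define q where "q = (pt c (of_bool (\<not> f u c)) (of_bool (f v (\<not> c))) :: real \<times> real)"
    have "\<forall>c'. crd c' p + real_of_int (idx N c' u) = crd c' q + real_of_int (idx N c' v)"
      unfolding all_crd_iff[of _ c] p_def q_def using idx_f uv(1,2,5) by simp
    then have mem: "word_map N u p \<in> cell u \<inter> cell v"
      using corners by (intro touchI(2)[OF len(1), of p q]) (auto simp: p_def q_def)
    have "word_map N u p \<noteq> x"
    proof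
      assume "word_map N u p = x"
      then have "crd c x = (crd c p + real_of_int (idx N c u)) / real N ^ K"
        using crd_word_map[OF N_pos, of c u p] len by simp
      then have "real N ^ K * crd c x = crd c p + real_of_int (idx N c u)" using N_pos by simp
      then show False using idx_f[OF uv(1), of c] by (cases "f u c") (auto simp: p_def)
    qed
    then show False using mem uv(3,4) cell_disj[of u "word_map N u p"] AW(1)[OF uv(1)] by (auto simp: words_iff)
  qed
  \<comment> \<open>Cells on different sides share no edge, so \<open>b1\<close> and
    \<open>b2\<close> are both diagonally opposite to \<open>a1\<close>.\<close>
  have "f a1 c \<noteq> f b1 c" "f a1 c \<noteq> f b2 c" for c
    using adj[of a1 b1 c] adj[of a1 b2 c] a b by (auto simp: A_def)
  then have "g b1 = g b2" by (auto simp: g_def)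
  then show False using inj b(3) by (auto simp: inj_on_def A_def)
qed

text \<open>At this level no cell is cut by \<open>x\<close>, so each has a side. By
  \<open>no_two_two_split\<close> some side has at most one cell at \<open>x\<close>; deleting that
  cell, or any cell at \<open>x\<close> if the side has none, leaves one side at
  \<open>x\<close>.\<close>

lemma separating_word:
  assumes K: "n \<le> K" and uv: "u \<in> W n" "v \<in> W n" "x \<notin> cell u" "x \<notin> cell v" "cell u \<subseteq> U" "cell v \<subseteq> V"
    and nc: "\<And>a y. a \<in> W K \<Longrightarrow> y \<in> F \<Longrightarrow> x = word_map N a y \<Longrightarrow> \<not> cut_point F y"
  shows "\<exists>w\<in>W K. off u w \<and> off v w \<and> \<not> lk K w u v"
proof -
  have one: "cell a - {x} \<subseteq> U \<or> cell a - {x} \<subseteq> V" if a: "a \<in> W K" for a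
  proof (cases "x \<in> cell a")
    case True
    then obtain y where "y \<in> F" "x = word_map N a y" by (auto simp: cell_def)
    then show ?thesis using one_side_not_cut[OF a] nc[OF a] by blast
  qed (use one_side_avoiding a in blast)
  obtain w0 where w0: "w0 \<in> W K" "x \<in> cell w0" using cell_refine[of x "[]" K] x_F by auto
  have "\<exists>w\<in>W K. x \<in> cell w \<and> (\<forall>a b. a \<in> W K \<longrightarrow> b \<in> W K \<longrightarrow> a \<noteq> w \<longrightarrow> b \<noteq> w \<longrightarrow> x \<in> cell a \<longrightarrow> x \<in> cell b \<longrightarrow>
       cell a - {x} \<subseteq> U \<longrightarrow> cell b - {x} \<subseteq> V \<longrightarrow> False)"
  proof (rule ccontr)
    assume no: "\<not> ?thesis"
    then obtain a b where ab: "a \<in> W K" "b \<in> W K" "x \<in> cell a" "x \<in> cell b" "cell a - {x} \<subseteq> U" "cell b - {x} \<subseteq> V"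
      using w0 by blast
    obtain a' where "a' \<in> W K" "a' \<noteq> a" "x \<in> cell a'" "cell a' - {x} \<subseteq> U"
      using no ab(1,3) by blast
    moreover obtain b' where "b' \<in> W K" "b' \<noteq> b" "x \<in> cell b'" "cell b' - {x} \<subseteq> V"
      using no ab(2,4) by blast
    ultimately show False using no_two_two_split[of a K a' b b'] ab by metis
  qed
  then obtain w where w: "w \<in> W K" "x \<in> cell w" "\<And>a b. a \<in> W K \<Longrightarrow> b \<in> W K \<Longrightarrow> a \<noteq> w \<Longrightarrow> b \<noteq> w \<Longrightarrow>
      x \<in> cell a \<Longrightarrow> x \<in> cell b \<Longrightarrow> cell a - {x} \<subseteq> U \<Longrightarrow> cell b - {x} \<subseteq> V \<Longrightarrow> False" by metis
  have "off u w" "off v w" "\<not> lk K w u v"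
    by (rule not_linked[OF w(1,2) K uv]; use one w(3) in blast)+
  then show ?thesis using w(1) by blast
qed

end

context carpet
begin

lemma cut_point_carpet:
  assumes "cut_point F x" obtains U V where "cut_carpet N D x U V"
proof -
  obtain U V where "open U" "open V" "F - {x} \<subseteq> U \<union> V" "U \<inter> V \<inter> (F - {x}) = {}"
    "U \<inter> (F - {x}) \<noteq> {}" "V \<inter> (F - {x}) \<noteq> {}" "x \<in> F"
    using assms unfolding cut_point_def connected_def by blast
  then have "cut_carpet N D x U V" by unfold_locales
  then show thesis by (rule that)
qed

text \<open>A cut point lying in several cells of every level has all its preimages at some deep level at corners of
  the unit square; a corner lies in one cell only, so it is not such a cut point.\<close>

lemma not_cut_at_deep_level:
  assumes multi: "\<And>x. cut_point F x \<Longrightarrow> \<exists>K0. \<forall>K\<ge>K0. \<exists>a\<in>W K. \<exists>b\<in>W K. a \<noteq> b \<and> x \<in> cell a \<and> x \<in> cell b"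
    and x: "cut_point F x"
  shows "\<exists>K\<ge>K1. \<forall>a\<in>W K. \<forall>y\<in>F. x = word_map N a y \<longrightarrow> \<not> cut_point F y"
proof -
  obtain K0 where K0: "\<And>K. K \<ge> K0 \<Longrightarrow> \<exists>a\<in>W K. \<exists>b\<in>W K. a \<noteq> b \<and> x \<in> cell a \<and> x \<in> cell b"
    using multi[OF x] by blast
  define K where "K = max K0 K1"
  show ?thesis
  proof (cases "\<forall>a\<in>W K. \<forall>y\<in>F. x = word_map N a y \<longrightarrow> \<not> cut_point F y")
    case True
    then show ?thesis by (intro exI[of _ K]) (auto simp: K_def)
  next
    case False
    then obtain a y where a: "a \<in> W K" "y \<in> F" "x = word_map N a y" "cut_point F y" by blast
    obtain a1 b1 where "a1 \<in> W K" "b1 \<in> W K" "a1 \<noteq> b1" "x \<in> cell a1" "x \<in> cell b1"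
      using K0[of K] by (auto simp: K_def)
    then have "\<exists>b\<in>W K. a \<noteq> b \<and> x \<in> cell b" by (cases "a1 = a") auto
    then obtain b where b: "b \<in> W K" "a \<noteq> b" "word_map N a y \<in> cell b" using a by auto
    obtain c e where c: "crd c y = of_bool e" using crossing_boundary[OF a(1) b(1,2) a(2) b(3)] by metis
    obtain K' where K': "\<exists>a\<in>W K'. \<exists>b\<in>W K'. a \<noteq> b \<and> y \<in> cell a \<and> y \<in> cell b"
      using multi[OF a(4)] by blast
    then obtain a' b' where ab': "a' \<in> W K'" "b' \<in> W K'" "a' \<noteq> b'" "y \<in> cell a'" "y \<in> cell b'" by blast
    obtain y' where y': "y' \<in> F" "y = word_map N a' y'" using ab'(4) by (auto simp: cell_def)
    obtain c' e' where c': "idx N c' b' \<noteq> idx N c' a'" "crd c' y' = of_bool e'"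
      using crossing_boundary[OF ab'(1-3) y'(1)] ab'(5) y'(2) by metis
    have ic: "idx N c w = (if e then int N ^ K' - 1 else 0)" if w: "w \<in> W K'" "y \<in> cell w" for w
    proof -
      obtain z where z: "z \<in> F" "real N ^ length w * crd c y = crd c z + real_of_int (idx N c w)"
        using w(2) unfolding mem_cell_iff by blast
      then show ?thesis using boundary_word(2)[of z w e c] w c by (simp add: words_iff)
    qed
    have "idx N c a' = idx N c b'" using ic[of a'] ic[of b'] ab' by simp
    \<comment> \<open>Coordinate \<open>c\<close> of \<open>y\<close> is 0 or 1, so all cells
      containing \<open>y\<close> share that position; \<open>a'\<close> and \<open>b'\<close> must
      differ in the other direction.\<close>
    then have "c' \<noteq> c" using c'(1) by (cases c; cases c') auto
    then have cc: "c' = (\<not> c)" by auto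
    have len: "length a' = K'" "length a = K" using ab'(1) a(1) by (auto simp: words_iff)
    have "real N ^ K' * crd c y \<in> \<int>" using c by simp
    moreover have "real N ^ K' * crd (\<not> c) y \<in> \<int>"
      using c'(2) cc len N_pos unfolding y'(2) by (simp add: crd_word_map)
    ultimately have "\<forall>d. real N ^ K' * crd d y \<in> \<int>" unfolding all_crd_iff[of _ c] by simp
    moreover have "real N ^ (K + K') * crd d x = real N ^ K' * crd d y + real_of_int (int N ^ K' * idx N d a)" for d
      unfolding a(3) using len N_pos by (simp add: crd_word_map power_add field_simps)
    \<comment> \<open>Thus \<open>x\<close> is a grid point of level \<open>K + K'\<close>, and its
      preimages there are corners of the unit square.\<close>
    ultimately have int: "real N ^ (K + K') * crd d x \<in> \<int>" for d
      by (metis Ints_add Ints_of_int)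
    have "\<not> cut_point F z" if z: "w \<in> W (K + K')" "z \<in> F" "x = word_map N w z" for w z
    proof
      assume cz: "cut_point F z"
      have "\<exists>e. crd d z = of_bool e" for d
      proof -
        have "real N ^ (K + K') * crd d x = crd d z + real_of_int (idx N d w)"
          unfolding z(3) using z(1) N_pos by (simp add: crd_word_map words_iff)
        then have "crd d z = real N ^ (K + K') * crd d x - real_of_int (idx N d w)" by simp
        then have "crd d z \<in> \<int>" using int[of d] by (metis Ints_diff Ints_of_int)
        then obtain k where k: "crd d z = real_of_int k" by (auto elim: Ints_cases)
        then have "k = 0 \<or> k = 1" using F_01[OF z(2), of d] by auto
        then show ?thesis using k by (metis of_bool_eq of_int_0 of_int_1)
      qed
      moreover obtain L where "\<exists>a\<in>W L. \<exists>b\<in>W L. a \<noteq> b \<and> z \<in> cell a \<and> z \<in> cell b"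
        using multi[OF cz] by blast
      ultimately show False using corner_not_crossed by metis
    qed
    then show ?thesis by (intro exI[of _ "K + K'"]) (auto simp: K_def)
  qed
qed

text \<open>If some cut point lies in only one cell at arbitrarily deep levels, that cell is
  deleted. Otherwise every cut point lies in several cells of each deep level, which is the
  assumption of \<open>not_cut_at_deep_level\<close>.\<close>

theorem cut_point_separating_words:
  assumes "cut_point F x"
  shows "\<exists>n u v. u \<in> W n \<and> v \<in> W n \<and> (\<forall>K0. \<exists>K\<ge>K0. \<exists>w\<in>W K. off u w \<and> off v w \<and> \<not> lk K w u v)"
proof (cases "\<exists>x. cut_point F x \<and> (\<forall>K0. \<exists>K\<ge>K0. \<forall>a\<in>W K. \<forall>b\<in>W K. x \<in> cell a \<longrightarrow> x \<in> cell b \<longrightarrow> a = b)")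
  case True
  then obtain x where x: "cut_point F x"
    "\<And>K0. \<exists>K\<ge>K0. \<forall>a\<in>W K. \<forall>b\<in>W K. x \<in> cell a \<longrightarrow> x \<in> cell b \<longrightarrow> a = b" by blast
  obtain U V where "cut_carpet N D x U V" using cut_point_carpet[OF x(1)] .
  then interpret cut_carpet N D x U V .
  obtain n u v where uv: "u \<in> W n" "v \<in> W n" "x \<notin> cell u" "x \<notin> cell v" "cell u \<subseteq> U" "cell v \<subseteq> V"
    using base_words .
  have "\<exists>K\<ge>K0. \<exists>w\<in>W K. off u w \<and> off v w \<and> \<not> lk K w u v" for K0
  proof -
    obtain K where K: "K \<ge> max K0 n" "\<forall>a\<in>W K. \<forall>b\<in>W K. x \<in> cell a \<longrightarrow> x \<in> cell b \<longrightarrow> a = b"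
      using x(2) by blast
    obtain w where w: "w \<in> W K" "x \<in> cell w" using cell_refine[of x "[]" K] x_F by auto
    have "off u w" "off v w" "\<not> lk K w u v"
      by (rule not_linked[OF w _ uv]; use K w one_side_avoiding in auto)+
    then show ?thesis using K(1) w by auto
  qed
  then show ?thesis using uv by blast
next
  case False
  have multi: "\<exists>K0. \<forall>K\<ge>K0. \<exists>a\<in>W K. \<exists>b\<in>W K. a \<noteq> b \<and> x \<in> cell a \<and> x \<in> cell b"
    if cx: "cut_point F x" for x
  proof (rule ccontr)
    assume no: "\<not> ?thesis"
    have "\<exists>K\<ge>K0. \<forall>a\<in>W K. \<forall>b\<in>W K. x \<in> cell a \<longrightarrow> x \<in> cell b \<longrightarrow> a = b" for K0
    proof (rule ccontr)
      assume "\<not> ?thesis"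
      then have "\<forall>K\<ge>K0. \<exists>a\<in>W K. \<exists>b\<in>W K. a \<noteq> b \<and> x \<in> cell a \<and> x \<in> cell b" by blast
      with no show False by blast
    qed
    with False cx show False by blast
  qed
  obtain U V where "cut_carpet N D x U V" using cut_point_carpet[OF assms] .
  then interpret cut_carpet N D x U V .
  obtain n u v where uv: "u \<in> W n" "v \<in> W n" "x \<notin> cell u" "x \<notin> cell v" "cell u \<subseteq> U" "cell v \<subseteq> V"
    using base_words .
  have "\<exists>K\<ge>K0. \<exists>w\<in>W K. off u w \<and> off v w \<and> \<not> lk K w u v" for K0
  proof -
    obtain K where K: "K \<ge> max K0 n" "\<forall>a\<in>W K. \<forall>y\<in>F. x = word_map N a y \<longrightarrow> \<not> cut_point F y"
      using not_cut_at_deep_level[OF multi assms] by blast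
    have "\<exists>w\<in>W K. off u w \<and> off v w \<and> \<not> lk K w u v"
      by (rule separating_word[OF _ uv]) (use K in auto)
    then show ?thesis using K(1) by auto
  qed
  then show ?thesis using uv by blast
qed

end

subsection \<open>Deleting a cell next to a leaf block\<close>

context carpet
begin

lemma conn_block_closed:
  assumes c: "conn E S (i # u) z" and S: "S \<subseteq> W (Suc n)"
    and cross: "\<And>s j t. i # s \<in> S \<Longrightarrow> j # t \<in> S \<Longrightarrow> j \<noteq> i \<Longrightarrow> E (i # s) (j # t) \<Longrightarrow> False"
  shows "hd z = i"
  using c
proof (induction rule: conn_induct)
  case (step y z)
  obtain s where s: "y = i # s" using step.IH step(2) S by (cases y) (auto simp: words_iff)
  obtain j t where t: "z = j # t" using step(3) S by (cases z) (auto simp: words_iff)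
  show ?case using cross[of s j t] step s t by auto
qed simp

text \<open>\<open>k\<close> is the only exit of block \<open>i\<close>, so deleting
  \<open>i # k\<close> cuts off the other words of the block, and \<open>nbrs\<close> keeps them
  connected. This component has exactly the threshold size.\<close>

lemma chi_ge_block_end:
  assumes n: "n \<ge> 1" and i: "i \<in> D" and k: "k \<in> W n"
    and cross: "\<And>s j t. s \<in> W n \<Longrightarrow> j # t \<in> W (Suc n) \<Longrightarrow> j \<noteq> i \<Longrightarrow> E (i # s) (j # t) \<Longrightarrow> s = k"
    and nbrs: "\<And>u v. u \<in> W n \<Longrightarrow> v \<in> W n \<Longrightarrow> E k u \<Longrightarrow> E k v \<Longrightarrow> u \<noteq> v \<Longrightarrow> E u v"
  shows "card D ^ n - 1 \<le> chi (W (Suc n)) E"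
proof -
  obtain b where b: "b \<in> D" "b \<noteq> i" using other_digit by blast
  have w: "i # k \<in> W (Suc n)" using i k by (auto simp: words_iff)
  show ?thesis
  proof (rule chi_geI[OF n w i b(1)])
    show "conn E (W (Suc n) - {i # k}) (i # u) (i # u')"
      if "i # u \<in> W (Suc n) - {i # k}" "i # u' \<in> W (Suc n) - {i # k}" for u u'
    proof -
      have u: "u \<in> W n" "u' \<in> W n" "u \<noteq> k" "u' \<noteq> k" using that by (auto simp: words_iff)
      have "conn E (W n - {k}) u u'"
        using conn_delete_vertex[OF symp_hata_edge irreflp_hata_edge nbrs conn_words[OF u(1,2)] u(1,3,4)]
        by blast
      then have "conn E (W (Suc n) - {i # k}) ([i] @ u) ([i] @ u')"
        by (rule conn_prefix) (use i in \<open>auto simp: words_iff\<close>)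
      then show ?thesis by simp
    qed
    have "lk (Suc n) (i # k) [b] [b]" using b by (intro lk_refl) (auto simp: off_def)
    then show "conn E (W (Suc n) - {i # k}) (b # u) (b # u')"
      if "b # u \<in> W (Suc n) - {i # k}" "b # u' \<in> W (Suc n) - {i # k}" for u u'
      using that unfolding lk_def by auto
    show "\<not> conn E (W (Suc n) - {i # k}) (i # u) (b # v)"
      if "i # u \<in> W (Suc n) - {i # k}" "b # v \<in> W (Suc n) - {i # k}" for u v
    proof
      assume "conn E (W (Suc n) - {i # k}) (i # u) (b # v)"
      then have "hd (b # v) = i"
        by (rule conn_block_closed[of _ _ _ _ n]) (use cross in \<open>auto simp: words_iff\<close>)
      then show False using b by simp
    qed
  qed
qed

lemma edge_idx:
  assumes "u \<in> W n" "v \<in> W n" "E u v"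
  shows "\<bar>idx N c v - idx N c u\<bar> \<le> 1"
proof -
  obtain z where z: "z \<in> cell u" "z \<in> cell v" using assms(3) by (auto simp: E_iff)
  have len: "length u = length v" using assms by (simp add: words_iff)
  show ?thesis
    by (rule touch_coords[OF len z]) (smt (verit) shf_def)
qed

text \<open>With two digits \<open>i\<close>, \<open>j\<close> the cells are lined up in the order of \<open>idx\<close>, so \<open>i j \<dots> j\<close> is the only cell of block
  \<open>i\<close> that can meet block \<open>j\<close>.\<close>

lemma chi_ge_two_digits:
  assumes D2: "card D = 2" and n: "n \<ge> 1"
  shows "card D ^ n - 1 \<le> chi (W (Suc n)) E"
proof -
  obtain p q where pq: "D = {p, q}" "p \<noteq> q" using D2 by (auto simp: card_2_iff)
  obtain c where c: "crd c p \<noteq> crd c q" using pq crd_eqI by metis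
  obtain i j where ij: "D = {i, j}" "crd c i < crd c j" "i \<noteq> j"
  proof (cases "crd c p < crd c q")
    case True
    then show thesis using that[of p q] pq by simp
  next
    case False
    then show thesis using that[of q p] pq c by (simp add: insert_commute)
  qed
  define k where "k = replicate n j"
  have iD: "i \<in> D" and jD: "j \<in> D" and D_cases: "\<And>d. d \<in> D \<Longrightarrow> d = i \<or> d = j" using ij(1) by blast+
  have k: "k \<in> W n" using jD by (auto simp: k_def words_iff)
  have inj: "u = v" if "u \<in> W m" "v \<in> W m" "idx N c u = idx N c v" for u v m
  proof -
    have "map (crd c) u = map (crd c) v" using that by (intro idx_eq_imp_map_eq) (auto simp: words_iff)
    moreover have "inj_on (crd c) (set u \<union> set v)"
    proof (rule inj_onI)
      fix d d' assume "d \<in> set u \<union> set v" "d' \<in> set u \<union> set v" "crd c d = crd c d'"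
      moreover from this have "d \<in> D" "d' \<in> D" using that by (auto simp: words_iff)
      ultimately show "d = d'" using D_cases[of d] D_cases[of d'] ij(2) by auto
    qed
    ultimately show ?thesis using inj_on_map_eq_map by blast
  qed
  have le: "idx N c u \<le> idx N c (replicate (length u) j)" if "set u \<subseteq> D" for u
    using that
  proof (induction u)
    case (Cons d u)
    have "crd c d \<le> crd c j" using D_cases[of d] Cons.prems ij(2) by auto
    then have "int (crd c d) * int N ^ length u \<le> int (crd c j) * int N ^ length u"
      by (intro mult_right_mono) auto
    then show ?case using Cons by simp
  qed simp
  have lek: "idx N c u < idx N c k" if "u \<in> W n" "u \<noteq> k" for u
    using le[of u] inj[OF that(1) k] that by (force simp: words_iff k_def)
  show ?thesis
  proof (rule chi_ge_block_end[OF n iD k])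
    fix s j' t
    assume s: "s \<in> W n" and t: "j' # t \<in> W (Suc n)" "j' \<noteq> i" and e: "E (i # s) (j' # t)"
    have j': "j' = j" "t \<in> W n" using t D_cases[of j'] by (auto simp: words_iff)
    have "i # s \<in> W (Suc n)" using s iD by (auto simp: words_iff)
    from edge_idx[OF this t(1) e, of c] have
      "int (crd c j) * int N ^ n + idx N c t \<le> int (crd c i) * int N ^ n + idx N c s + 1"
      using s j' by (auto simp: words_iff)
    moreover have "(int (crd c i) + 1) * int N ^ n \<le> int (crd c j) * int N ^ n"
      using ij(2) by (intro mult_right_mono) auto
    moreover have "0 \<le> idx N c t" by (rule idx_nonneg)
    ultimately have "int N ^ n \<le> idx N c s + 1" by (simp add: algebra_simps)
    moreover have "idx N c k < int N ^ n" using idx_less[of k c] k by (simp add: words_iff)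
    ultimately show "s = k" using lek[OF s] by force
  next
    fix u v assume uv: "u \<in> W n" "v \<in> W n" "E k u" "E k v" "u \<noteq> v"
    \<comment> \<open>\<open>k\<close> has the largest position, so a neighbour has the position
      just below it; two different neighbours cannot exist.\<close>
    have "u \<noteq> k" "v \<noteq> k" using uv by (auto simp: E_iff)
    then have "idx N c u = idx N c v"
      using edge_idx[OF k uv(1,3), of c] edge_idx[OF k uv(2,4), of c] lek[OF uv(1)] lek[OF uv(2)] by linarith
    then show "E u v" using inj[OF uv(1,2)] uv by blast
  qed
qed

section \<open>Neighbours of a corner cell\<close>

lemma shf_add: "real_of_int (shf (\<not> b)) + of_bool b = of_bool (\<not> b)"
  by (simp add: shf_def)

lemma corner_word:
  assumes "pt c (of_bool b) (of_bool b') \<in> F"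
  obtains k where "k \<in> W n" "pt c (of_bool b) (of_bool b') \<in> cell k"
    "idx N c k = (if b then int N ^ n - 1 else 0)" "idx N (\<not> c) k = (if b' then int N ^ n - 1 else 0)"
proof -
  define z where "z = (pt c (of_bool b) (of_bool b') :: real \<times> real)"
  obtain k where k: "k \<in> W n" "z \<in> cell k"
    using cell_refine[of z "[]" n] assms by (auto simp: z_def)
  then obtain y where y: "y \<in> F" "\<And>d. real N ^ length k * crd d z = crd d y + real_of_int (idx N d k)"
    unfolding mem_cell_iff by blast
  have kD: "set k \<subseteq> D" "length k = n" using k by (auto simp: words_iff)
  have "idx N c k = (if b then int N ^ n - 1 else 0)" "idx N (\<not> c) k = (if b' then int N ^ n - 1 else 0)"
    using boundary_word(2)[OF y(1) kD(1), of b c] boundary_word(2)[OF y(1) kD(1), of b' "\<not> c"] y(2)[of c] y(2)[of "\<not> c"] kD(2)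
    by (simp_all add: z_def)
  then show thesis using that k by (simp add: z_def)
qed

text \<open>At a corner of the grid there is room only inward, in direction
  \<open>\<not> e d\<close>. Such a shift puts the preimage \<open>y\<close> of a common point on
  that side.\<close>

lemma corner_neighbour:
  assumes k: "k \<in> W n" "u \<in> W n" "E k u" and e: "\<And>d. idx N d k = (if e d then int N ^ n - 1 else 0)"
  obtains y where "y \<in> F"
    "\<And>d. idx N d u = idx N d k \<or> (idx N d u = idx N d k + shf (\<not> e d) \<and> crd d y = of_bool (\<not> e d))"
proof -
  obtain z where z: "z \<in> cell k" "z \<in> cell u" using k(3) by (auto simp: E_iff)
  have len: "length k = length u" using k by (simp add: words_iff)
  obtain y y' where y: "y \<in> F" "y' \<in> F" "\<And>c. (idx N c u = idx N c k \<and> crd c y' = crd c y) \<or>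
         (\<exists>b. idx N c u = idx N c k + shf b \<and> crd c y = of_bool b \<and> crd c y' = of_bool (\<not> b))"
    using touch_coords[OF len z] by metis
  show thesis
  proof (rule that[OF y(1)])
    fix d
    have r: "0 \<le> idx N d u" "idx N d u < int N ^ n"
      using idx_nonneg[of d u] idx_less[of u d] k by (auto simp: words_iff)
    have "b = (\<not> e d)" if "idx N d u = idx N d k + shf b" for b
      using that r e[of d] by (auto simp: shf_def split: if_splits)
    then show "idx N d u = idx N d k \<or> (idx N d u = idx N d k + shf (\<not> e d) \<and> crd d y = of_bool (\<not> e d))"
      using y(3)[of d] by fastforce
  qed
qed

text \<open>A corner cell has at most three neighbours. If the corner of the square opposite to it
  lies in \<open>F\<close>, then \<open>uniq\<close> excludes the neighbour in direction
  \<open>\<not> c\<close> alone, and the other two meet in a corner. If not, there is no diagonal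
  neighbour, and the remaining two meet at the inner corner of the square of
  \<open>k\<close>.\<close>

lemma corner_neighbours_adjacent:
  assumes corner: "pt c (of_bool b) (of_bool b') \<in> F" and next_corner: "pt c (of_bool (\<not> b)) (of_bool b') \<in> F"
    and uniq: "\<And>s. s \<in> side c b \<Longrightarrow> s \<in> side c (\<not> b) \<Longrightarrow> s = of_bool b'"
    and third: "pt c (of_bool b) (of_bool (\<not> b')) \<in> F \<or> pt c (of_bool (\<not> b)) (of_bool (\<not> b')) \<in> F"
    and k: "k \<in> W n" "idx N c k = (if b then int N ^ n - 1 else 0)" "idx N (\<not> c) k = (if b' then int N ^ n - 1 else 0)"
    and uv: "u \<in> W n" "v \<in> W n" "E k u" "E k v" "u \<noteq> v"
  shows "E u v"
proof -
  define e where "e d = (if d = c then b else b')" for d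
  have e: "e c = b" "e (\<not> c) = b'" by (auto simp: e_def)
  have ke: "idx N d k = (if e d then int N ^ n - 1 else 0)" for d
  proof -
    have "\<forall>d. idx N d k = (if e d then int N ^ n - 1 else 0)"
      unfolding all_crd_iff[of _ c] using k e by simp
    then show ?thesis by blast
  qed
  have len: "length u = n" "length v = n" "length k = n" using uv k by (auto simp: words_iff)
  have nbr: "idx N d w = idx N d k \<or> idx N d w = idx N d k + shf (\<not> e d)" if "w \<in> W n" "E k w" for w d
    using corner_neighbour[OF k(1) that ke] by metis
  have meet: "E p q" if pq: "p \<in> W n" "q \<in> W n" "p \<noteq> q"
    and F: "pt c a1 a2 \<in> F" "pt c b1 b2 \<in> F"
    and eq: "a1 + real_of_int (idx N c p) = b1 + real_of_int (idx N c q)"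
      "a2 + real_of_int (idx N (\<not> c) p) = b2 + real_of_int (idx N (\<not> c) q)" for p q a1 a2 b1 b2
  proof -
    have "\<forall>d. crd d (pt c a1 a2) + real_of_int (idx N d p) = crd d (pt c b1 b2) + real_of_int (idx N d q)"
      unfolding all_crd_iff[of _ c] using eq by simp
    then have "word_map N p (pt c a1 a2) \<in> cell p \<inter> cell q"
      using pq F by (intro touchI(2)) (auto simp: words_iff)
    then show ?thesis using pq(3) by (auto simp: E_iff)
  qed
  have Esym: "E q p \<Longrightarrow> E p q" for p q by (auto simp: E_iff)
  show ?thesis
  proof (cases "pt c (of_bool (\<not> b)) (of_bool (\<not> b')) \<in> F")
    case True
    have c_shift: "idx N c w = idx N c k + shf (\<not> b)" if w: "w \<in> W n" "E k w" for w
    proof (rule ccontr)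
      assume "idx N c w \<noteq> idx N c k + shf (\<not> b)"
      then have wc: "idx N c w = idx N c k" using nbr[OF w, of c] e by simp
      have "w \<noteq> k" using w by (auto simp: E_iff)
      then have wn: "idx N (\<not> c) w = idx N (\<not> c) k + shf (\<not> b')"
        using nbr[OF w, of "\<not> c"] wc idx_inj2[OF w(1) k(1) wc] e by auto
      \<comment> \<open>The position of the edge between \<open>k\<close> and \<open>w\<close>. On
        side \<open>b\<close> it is hit by a corner of \<open>w\<close>, on side
        \<open>\<not> b\<close> by a corner of the cell \<open>k'\<close> at the next corner of the
        square: a common point other than \<open>of_bool b'\<close>.\<close>
      define s where "s = (real_of_int (idx N (\<not> c) k) + of_bool (\<not> b')) / real N ^ n"
      have lw: "length w = n" using w by (simp add: words_iff)
      have pow: "real N ^ n \<noteq> 0" using N_pos by simp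
      have "crd c (word_map N w (pt c (of_bool b) (of_bool b'))) = of_bool b"
        unfolding crd_word_map[OF N_pos] lw using wc k(2) pow by (auto simp: field_simps)
      moreover have "crd (\<not> c) (word_map N w (pt c (of_bool b) (of_bool b'))) = s"
        unfolding crd_word_map[OF N_pos] lw s_def using wn shf_add[of b'] by (simp add: algebra_simps)
      moreover have "word_map N w (pt c (of_bool b) (of_bool b')) \<in> F"
        using corner w cell_subset[of w] by (auto simp: cell_def words_iff)
      ultimately have s1: "s \<in> side c b" unfolding side_def using crd_eqI3 by (metis mem_Collect_eq)
      obtain k' where k': "k' \<in> W n" "idx N c k' = (if \<not> b then int N ^ n - 1 else 0)"
        "idx N (\<not> c) k' = (if b' then int N ^ n - 1 else 0)"
        using corner_word[OF next_corner] by metis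
      have lk': "length k' = n" using k' by (simp add: words_iff)
      have "crd c (word_map N k' (pt c (of_bool (\<not> b)) (of_bool (\<not> b')))) = of_bool (\<not> b)"
        unfolding crd_word_map[OF N_pos] lk' using k'(2) pow by (auto simp: field_simps)
      moreover have "crd (\<not> c) (word_map N k' (pt c (of_bool (\<not> b)) (of_bool (\<not> b')))) = s"
        unfolding crd_word_map[OF N_pos] lk' s_def using k'(3) k(3) by (simp add: algebra_simps)
      moreover have "word_map N k' (pt c (of_bool (\<not> b)) (of_bool (\<not> b'))) \<in> F"
        using True k' cell_subset[of k'] by (auto simp: cell_def words_iff)
      ultimately have s2: "s \<in> side c (\<not> b)" unfolding side_def using crd_eqI3 by (metis mem_Collect_eq)
      have "s = of_bool b'" by (rule uniq[OF s1 s2])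
      then have "real_of_int (idx N (\<not> c) k) + of_bool (\<not> b') = of_bool b' * real N ^ n"
        using pow by (simp add: s_def field_simps)
      then show False using k(3) by (cases b') auto
    qed
    have main: "E p q" if p: "p \<in> W n" "E k p" "idx N (\<not> c) p = idx N (\<not> c) k"
      and q: "q \<in> W n" "E k q" "idx N (\<not> c) q = idx N (\<not> c) k + shf (\<not> b')" "p \<noteq> q" for p q
      by (rule meet[OF p(1) q(1,4) True next_corner])
        (use p q c_shift shf_add[of b'] in \<open>auto simp: algebra_simps\<close>)
    have "idx N (\<not> c) u \<noteq> idx N (\<not> c) v"
      using idx_inj2[OF uv(1,2)] c_shift uv by metis
    moreover have "idx N (\<not> c) w = idx N (\<not> c) k \<or> idx N (\<not> c) w = idx N (\<not> c) k + shf (\<not> b')"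
      if "w \<in> W n" "E k w" for w
      using nbr[OF that, of "\<not> c"] unfolding e .
    from this[OF uv(1,3)] this[OF uv(2,4)] calculation show ?thesis
      using main[OF uv(1,3) _ uv(2,4) _ uv(5)] main[OF uv(2,4) _ uv(1,3) _ uv(5)[symmetric]] Esym[of v u] by linarith
  next
    case False
    then have third': "pt c (of_bool b) (of_bool (\<not> b')) \<in> F" using third by blast
    have not_both: "idx N c w = idx N c k \<or> idx N (\<not> c) w = idx N (\<not> c) k" if w: "w \<in> W n" "E k w" for w
    proof (rule ccontr)
      assume no: "\<not> ?thesis"
      obtain y where y: "y \<in> F"
        "\<And>d. idx N d w = idx N d k \<or> (idx N d w = idx N d k + shf (\<not> e d) \<and> crd d y = of_bool (\<not> e d))"
        using corner_neighbour[OF k(1) w ke] by metis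
      have "crd c y = of_bool (\<not> b)" "crd (\<not> c) y = of_bool (\<not> b')"
        using y(2)[of c] y(2)[of "\<not> c"] no e by auto
      then have "y = pt c (of_bool (\<not> b)) (of_bool (\<not> b'))" by (rule crd_eqI3)
      then show False using False y(1) by simp
    qed
    have main: "E p q" if p: "p \<in> W n" "E k p" "idx N c p \<noteq> idx N c k"
      and q: "q \<in> W n" "E k q" "idx N c q = idx N c k" "p \<noteq> q" for p q
    proof -
      have "idx N c p = idx N c k + shf (\<not> b)" "idx N (\<not> c) p = idx N (\<not> c) k"
        using nbr[OF p(1,2), of c] not_both[OF p(1,2)] p(3) e by auto
      moreover have "q \<noteq> k" using q by (auto simp: E_iff)
      then have "idx N (\<not> c) q = idx N (\<not> c) k + shf (\<not> b')"
        using nbr[OF q(1,2), of "\<not> c"] idx_inj2[OF q(1) k(1) q(3)] e by auto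
      ultimately show ?thesis
        by (intro meet[OF p(1) q(1,4) third' next_corner])
          (use q shf_add[of b] shf_add[of b'] in \<open>auto simp: algebra_simps\<close>)
    qed
    have ne: "w \<noteq> k" if "E k w" for w using that by (auto simp: E_iff)
    have "(idx N c u = idx N c k) \<noteq> (idx N c v = idx N c k)"
    proof
      assume same: "(idx N c u = idx N c k) = (idx N c v = idx N c k)"
      have "idx N c u = idx N c v" using same nbr[OF uv(1,3), of c] nbr[OF uv(2,4), of c] by auto
      moreover have "idx N (\<not> c) u = idx N (\<not> c) v"
      proof (cases "idx N c u = idx N c k")
        case True
        then have "idx N (\<not> c) u \<noteq> idx N (\<not> c) k" "idx N (\<not> c) v \<noteq> idx N (\<not> c) k"
          using same ne uv idx_inj2[OF _ k(1)] by metis+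
        then show ?thesis using nbr[OF uv(1,3), of "\<not> c"] nbr[OF uv(2,4), of "\<not> c"] by auto
      next
        case False
        then show ?thesis using same not_both uv by metis
      qed
      ultimately show False using idx_inj2[OF uv(1,2)] uv(5) by blast
    qed
    then show ?thesis using main[of u v] main[of v u] Esym uv by metis
  qed
qed

lemma gsc_map_mem_cell: "gsc_map N j y \<in> cell (j # t) \<longleftrightarrow> y \<in> cell t"
  using cell_append[of "[j]" t] inj_image_mem_iff[OF inj_gsc_map[OF N_pos]] by simp

lemma cell_Cons_subset: "set t \<subseteq> D \<Longrightarrow> cell (j # t) \<subseteq> cell [j]"
  using cell_append_subset[of t "[j]"] by simp

lemma contact_ne:
  assumes "i \<in> D" shows "contact i \<noteq> {}"
proof
  assume e: "contact i = {}"
  obtain j where j: "j \<in> D" "j \<noteq> i" using other_digit by blast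
  define B where "B = (\<Union>j\<in>D - {i}. cell [j])"
  have W1: "W 1 = (\<lambda>i. [i]) ` D" by (auto simp: words_iff length_Suc_conv)
  have "F = (\<Union>j\<in>D. cell [j])" using F_words[of 1] unfolding W1 by simp
  then have "F = cell [i] \<union> B" using assms by (auto simp: B_def)
  moreover have "closed B" unfolding B_def using finite_D closed_cell by (intro closed_UN) auto
  moreover have "cell [i] \<inter> B = {}" using e by (auto simp: contact_def B_def)
  moreover have "B \<noteq> {}" using j cell_ne unfolding B_def by blast
  ultimately show False
    using conn_F closed_cell[of "[i]"] cell_ne[of "[i]"] unfolding connected_closed_set[OF compact_imp_closed[OF compact_F]]
    by metis
qed

end

section \<open>A block that meets the other blocks in one point\<close>

locale leaf_carpet = carpet +
  fixes i :: digit and x y :: "real \<times> real"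
  assumes iD: "i \<in> D" and contact_x: "contact i = {x}" and yF: "y \<in> F" and x_y: "x = gsc_map N i y"
begin

lemma edge_at_x:
  assumes "s \<in> W n" "j # t \<in> W (Suc n)" "j \<noteq> i" "E (i # s) (j # t)"
  shows "x \<in> cell (i # s)" "x \<in> cell (j # t)"
proof -
  obtain z where z: "z \<in> cell (i # s)" "z \<in> cell (j # t)" using assms(4) by (auto simp: E_iff)
  have "z \<in> cell [i]" "z \<in> cell [j]" "j \<in> D"
    using z assms cell_Cons_subset[of s i] cell_Cons_subset[of t j] by (auto simp: words_iff)
  then have "z \<in> contact i" using assms(3) by (auto simp: contact_def)
  then show "x \<in> cell (i # s)" "x \<in> cell (j # t)" using z contact_x by auto
qed

lemma side_point_unique:
  assumes "nbr i c b j" "s \<in> side c b" "s \<in> side c (\<not> b)"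
  shows "pt c (of_bool b) s = y"
proof -
  have "gsc_map N i (pt c (of_bool b) s) = gsc_map N i y"
    using nbr_contact[OF iD assms] contact_x x_y by simp
  then show ?thesis by (rule injD[OF inj_gsc_map[OF N_pos]])
qed

text \<open>Suppose two cells of block \<open>j\<close> met at \<open>x\<close> over a shared side.
  Then \<open>x\<close> is a grid point there, and both ends 0 and 1 lie on side
  \<open>\<not> b\<close> of \<open>F\<close>. The preimage on side \<open>b\<close> at the same
  level is an end too, hence a common point. As the contact point is unique, \<open>s\<close> is
  this end, so \<open>x\<close> sits at a corner of block \<open>j\<close>, and a corner lies in one
  cell only.\<close>

lemma block_cell_unique:
  assumes j: "j \<in> D" "j \<noteq> i" and t: "t \<in> W n" "t' \<in> W n" "x \<in> cell (j # t)" "x \<in> cell (j # t')"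
  shows "t = t'"
proof -
  have xi: "x \<in> cell [i]" using yF x_y by (auto simp: cell_def)
  have xj: "x \<in> cell [j]" using t cell_Cons_subset[of t j] by (auto simp: words_iff)
  show ?thesis using j xi xj
  proof (cases rule: neighbour_cases)
    case (sided c b s)
    define y' where "y' = (pt c (of_bool (\<not> b)) s :: real \<times> real)"
    have y': "y' \<in> cell t" "y' \<in> cell t'" using t(3,4) sided(5) gsc_map_mem_cell by (auto simp: y'_def)
    show ?thesis
    proof (rule ccontr)
      assume ne: "t \<noteq> t'"
      have len: "length t = length t'" "length t = n" "set t \<subseteq> D" "set t' \<subseteq> D" using t by (auto simp: words_iff)
      obtain z z' where z: "z \<in> F" "z' \<in> F"
        and zt: "\<And>d. real N ^ length t * crd d y' = crd d z + real_of_int (idx N d t)"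
        and zt': "\<And>d. real N ^ length t * crd d y' = crd d z' + real_of_int (idx N d t')"
        and st: "\<And>d. (idx N d t' = idx N d t \<and> crd d z' = crd d z) \<or>
         (\<exists>e. idx N d t' = idx N d t + shf e \<and> crd d z = of_bool e \<and> crd d z' = of_bool (\<not> e))"
        using touch_coords[OF len(1) y'] by metis
      have zc: "crd c z = of_bool (\<not> b)" "crd c z' = of_bool (\<not> b)" "idx N c t = idx N c t'"
        using boundary_word[OF z(1) len(3), of "\<not> b" c] boundary_word[OF z(2) len(4), of "\<not> b" c]
          zt[of c] zt'[of c] len(1) by (simp_all add: y'_def)
      then have "idx N (\<not> c) t' \<noteq> idx N (\<not> c) t" using idx_inj2[OF t(1,2)] ne by metis
      then obtain e where e: "crd (\<not> c) z = of_bool e" "crd (\<not> c) z' = of_bool (\<not> e)"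
        using st[of "\<not> c"] by blast
      have "of_bool e \<in> side c (\<not> b)" "of_bool (\<not> e) \<in> side c (\<not> b)"
        using z zc e crd_eqI3 unfolding side_def by (metis mem_Collect_eq)+
      then have both: "of_bool e' \<in> side c (\<not> b)" for e' by (cases "e' = e") auto
      have "pt c (of_bool b) s \<in> F" using sided(2) by (simp add: side_def)
      then obtain k where k: "k \<in> W n" "pt c (of_bool b) s \<in> cell k"
        using cell_refine[of "pt c (of_bool b) s" "[]" n] by auto
      then obtain q where q: "q \<in> F"
        "\<And>d. real N ^ length k * crd d (pt c (of_bool b) s) = crd d q + real_of_int (idx N d k)"
        unfolding mem_cell_iff by blast
      have kl: "length k = n" "set k \<subseteq> D" using k by (auto simp: words_iff)
      have qc: "crd c q = of_bool b"
        using boundary_word(1)[OF q(1) kl(2), of b c] q(2)[of c] by simp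
      have "crd (\<not> c) q = of_bool e + real_of_int (idx N (\<not> c) t) - real_of_int (idx N (\<not> c) k)"
        using q(2)[of "\<not> c"] zt[of "\<not> c"] e(1) kl len(2) by (simp add: y'_def)
      also have "\<dots> = real_of_int (of_bool e + idx N (\<not> c) t - idx N (\<not> c) k)" by simp
      finally obtain m where m: "crd (\<not> c) q = real_of_int m" by blast
      then have "m = 0 \<or> m = 1" using F_01[OF q(1), of "\<not> c"] by auto
      then obtain e2 where e2: "crd (\<not> c) q = of_bool e2" using m by (metis of_bool_eq of_int_0 of_int_1)
      have "of_bool e2 \<in> side c b" using q(1) qc e2 crd_eqI3 unfolding side_def by (metis mem_Collect_eq)
      then have "pt c (of_bool b) (of_bool e2) = pt c (of_bool b) s"
        using side_point_unique[OF sided(1)] both[of e2] sided(2,3) by metis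
      then have s: "s = of_bool e2" unfolding pt_inject by simp
      have "\<forall>d. \<exists>e. crd d y' = of_bool e"
        unfolding all_crd_iff[of _ c] y'_def s crd_pt by blast
      then show False using corner_not_crossed[OF t(1,2) y'] ne by blast
    qed
  next
    case (corner f)
    define y' where "y' = (pt True (of_bool (\<not> f True)) (of_bool (\<not> f False)) :: real \<times> real)"
    have y': "y' \<in> cell t" "y' \<in> cell t'" using t(3,4) corner(5) gsc_map_mem_cell by (auto simp: y'_def)
    have "crd d y' = of_bool (\<not> f d)" for d by (cases d) (auto simp: y'_def crd_def pt_def)
    then show ?thesis using corner_not_crossed[OF t(1,2) y'] by blast
  qed
qed

text \<open>Supplies the hypotheses of \<open>corner_neighbours_adjacent\<close>. Two neighbours
  over the same side, or both over a corner, would coincide. So two sides, or a side and a corner,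
  meet in \<open>y\<close>, and the second neighbour provides the third corner of the
  square.\<close>

lemma two_neighbours_corner:
  assumes j: "j0 \<in> D" "j0 \<noteq> i" "x \<in> cell [j0]" "j1 \<in> D" "j1 \<noteq> i" "x \<in> cell [j1]" "j0 \<noteq> j1"
  shows "\<exists>c b b'. y = pt c (of_bool b) (of_bool b') \<and> pt c (of_bool (\<not> b)) (of_bool b') \<in> F
    \<and> (\<forall>s. s \<in> side c b \<longrightarrow> s \<in> side c (\<not> b) \<longrightarrow> s = of_bool b')
    \<and> (pt c (of_bool b) (of_bool (\<not> b')) \<in> F \<or> pt c (of_bool (\<not> b)) (of_bool (\<not> b')) \<in> F)"
proof -
  have xi: "x \<in> cell [i]" using yF x_y by (auto simp: cell_def)
  have kind: "(\<exists>c b s. nbr i c b j \<and> s \<in> side c b \<and> s \<in> side c (\<not> b) \<and> y = pt c (of_bool b) s) \<or>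
      (\<exists>f. (\<forall>c. int (crd c j) = int (crd c i) + shf (f c)) \<and> (\<forall>c. y = pt c (of_bool (f c)) (of_bool (f (\<not> c)))
        \<and> pt c (of_bool (\<not> f c)) (of_bool (\<not> f (\<not> c))) \<in> F))"
    if j: "j \<in> D" "j \<noteq> i" "x \<in> cell [j]" for j
    using j(1,2) xi j(3)
  proof (cases rule: neighbour_cases)
    case (sided c b s)
    then show ?thesis using side_point_unique by metis
  next
    case (corner f)
    have "y = pt True (of_bool (f True)) (of_bool (f False))"
      by (rule injD[OF inj_gsc_map[OF N_pos]]) (use corner(4) x_y in simp)
    then have "y = pt c (of_bool (f c)) (of_bool (f (\<not> c)))" for c
      using pt_fun[of "\<lambda>d. of_bool (f d)" c] by simp
    moreover have "pt c (of_bool (\<not> f c)) (of_bool (\<not> f (\<not> c))) \<in> F" for c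
      using pt_fun[of "\<lambda>d. of_bool (\<not> f d) :: real" c] corner(3) by simp
    ultimately show ?thesis using corner(1) by blast
  qed
  have finish: ?thesis
    if n: "nbr i c b j" "s \<in> side c b" "s \<in> side c (\<not> b)" "y = pt c (of_bool b) s" "s = of_bool b'"
      and third: "pt c (of_bool b) (of_bool (\<not> b')) \<in> F \<or> pt c (of_bool (\<not> b)) (of_bool (\<not> b')) \<in> F" for c b j s b'
  proof -
    have "y = pt c (of_bool b) (of_bool b')" using n by simp
    moreover have "pt c (of_bool (\<not> b)) (of_bool b') \<in> F" using n by (simp add: side_def)
    moreover have "r = of_bool b'" if "r \<in> side c b" "r \<in> side c (\<not> b)" for r
    proof -
      have "pt c (of_bool b) r = pt c (of_bool b) s" using side_point_unique[OF n(1) that] n(4) by simp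
      then show ?thesis using n(5) unfolding pt_inject by simp
    qed
    ultimately show ?thesis using third by blast
  qed
  have mixed: ?thesis
    if n: "nbr i c b j" "s \<in> side c b" "s \<in> side c (\<not> b)" "y = pt c (of_bool b) s"
      and f: "\<And>c. y = pt c (of_bool (f c)) (of_bool (f (\<not> c)))" "\<And>c. pt c (of_bool (\<not> f c)) (of_bool (\<not> f (\<not> c))) \<in> F"
    for c b j s f
  proof -
    have "pt c (of_bool b) s = pt c (of_bool (f c)) (of_bool (f (\<not> c)))" using n(4) f(1) by metis
    then have "(of_bool b :: real) = of_bool (f c)" "s = of_bool (f (\<not> c))" unfolding pt_inject by simp_all
    then show ?thesis using f(2)[of c] by (intro finish[OF n, of "f (\<not> c)"]) auto
  qed
  from kind[OF j(1-3)] kind[OF j(4-6)] show ?thesis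
  proof (elim disjE exE conjE)
    fix c0 b0 s0 c1 b1 s1
    assume n0: "nbr i c0 b0 j0" "s0 \<in> side c0 b0" "s0 \<in> side c0 (\<not> b0)" "y = pt c0 (of_bool b0) s0"
      and n1: "nbr i c1 b1 j1" "s1 \<in> side c1 b1" "s1 \<in> side c1 (\<not> b1)" "y = pt c1 (of_bool b1) s1"
    show ?thesis
    proof (cases "c0 = c1")
      case True
      have "pt c0 (of_bool b0) s0 = pt c0 (of_bool b1) s1" using n0(4) n1(4) True by simp
      then have "b0 = b1" unfolding pt_inject by (cases b0; cases b1) auto
      then have "crd c0 j0 = crd c0 j1" "crd (\<not> c0) j0 = crd (\<not> c0) j1"
        using n0(1) n1(1) True by (auto simp: nbr_def)
      then have "j0 = j1" by (rule crd_eqI2)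
      then show ?thesis using j(7) by simp
    next
      case False
      then have c1: "c1 = (\<not> c0)" by auto
      have "pt c0 (of_bool b0) s0 = pt c0 s1 (of_bool b1)" using n0(4) n1(4) unfolding c1 pt_not by simp
      then have s: "s0 = of_bool b1" "s1 = of_bool b0" unfolding pt_inject by simp_all
      have "pt c0 (of_bool b0) (of_bool (\<not> b1)) \<in> F"
        using n1(3) unfolding c1 s(2) side_def mem_Collect_eq pt_not .
      then show ?thesis by (intro finish[OF n0 s(1)]) auto
    qed
  next
    fix c b s f assume "nbr i c b j0" "s \<in> side c b" "s \<in> side c (\<not> b)" "y = pt c (of_bool b) s"
      "\<forall>c. y = pt c (of_bool (f c)) (of_bool (f (\<not> c))) \<and> pt c (of_bool (\<not> f c)) (of_bool (\<not> f (\<not> c))) \<in> F"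
    then show ?thesis by (intro mixed[of c b j0 s f]) blast+
  next
    fix c b s f assume "nbr i c b j1" "s \<in> side c b" "s \<in> side c (\<not> b)" "y = pt c (of_bool b) s"
      "\<forall>c. y = pt c (of_bool (f c)) (of_bool (f (\<not> c))) \<and> pt c (of_bool (\<not> f c)) (of_bool (\<not> f (\<not> c))) \<in> F"
    then show ?thesis by (intro mixed[of c b j1 s f]) blast+
  next
    fix f g assume f: "\<forall>c. int (crd c j0) = int (crd c i) + shf (f c)" "\<forall>c. int (crd c j1) = int (crd c i) + shf (g c)"
      "\<forall>c. y = pt c (of_bool (f c)) (of_bool (f (\<not> c))) \<and> pt c (of_bool (\<not> f c)) (of_bool (\<not> f (\<not> c))) \<in> F"
      "\<forall>c. y = pt c (of_bool (g c)) (of_bool (g (\<not> c))) \<and> pt c (of_bool (\<not> g c)) (of_bool (\<not> g (\<not> c))) \<in> F"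
    have "(of_bool (f c) :: real) = of_bool (g c)" for c using f(3,4) by (metis crd_pt(1))
    then have fg: "f c = g c" for c by (metis of_bool_eq_iff)
    have "j0 = j1"
    proof (rule crd_eqI)
      fix c show "crd c j0 = crd c j1" using f(1)[rule_format, of c] f(2)[rule_format, of c] fg[of c] by simp
    qed
    then show ?thesis using j(7) by simp
  qed
qed

text \<open>If a single cell outside block \<open>i\<close> contains \<open>x\<close>, deleting it
  separates \<open>i\<close> from a third block. Otherwise two such cells lie in different blocks by
  \<open>block_cell_unique\<close>; then \<open>y\<close> is a corner, and the cell of block
  \<open>i\<close> at that corner is deleted.\<close>

theorem chi_ge_leaf:
  assumes D3: "card D \<ge> 3" and n: "n \<ge> 1"
  shows "card D ^ n - 1 \<le> chi (W (Suc n)) E"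
proof -
  define Out where "Out = {v \<in> W (Suc n). hd v \<noteq> i \<and> x \<in> cell v}"
  obtain j where j: "j \<in> D" "j \<noteq> i" "x \<in> cell [j]" using contact_x unfolding contact_def by blast
  obtain t where t: "t \<in> W n" "x \<in> cell ([j] @ t)" using cell_refine[OF j(3)] by blast
  have v0: "j # t \<in> Out" using j t by (auto simp: Out_def words_iff)
  show ?thesis
  proof (cases "\<forall>v\<in>Out. v = j # t")
    case True
    have "\<not> D \<subseteq> {i, j}"
    proof
      assume "D \<subseteq> {i, j}"
      then have "card D \<le> card {i, j}" by (intro card_mono) auto
      also have "\<dots> \<le> 2" by (simp add: card_insert_if)
      finally show False using D3 by simp
    qed
    then obtain l where l: "l \<in> D" "l \<noteq> i" "l \<noteq> j" by blast
    have w: "j # t \<in> W (Suc n)" using j t by (auto simp: words_iff)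
    have "\<not> lk (Suc n) (j # t) [i] [l]"
    proof
      assume lk: "lk (Suc n) (j # t) [i] [l]"
      obtain u where u: "u \<in> W n" using words_ne by blast
      have "[i] @ u \<in> W (Suc n)" "[l] @ u \<in> W (Suc n)" using u iD l by (auto simp: words_iff)
      then have "conn E (W (Suc n) - {j # t}) ([i] @ u) ([l] @ u)" using lk unfolding lk_def by blast
      then have con: "conn E (W (Suc n) - {j # t}) (i # u) (l # u)" by simp
      have "hd (l # u) = i"
      proof (rule conn_block_closed[OF con, of n])
        fix s j' t' assume a: "i # s \<in> W (Suc n) - {j # t}" "j' # t' \<in> W (Suc n) - {j # t}" "j' \<noteq> i" "E (i # s) (j' # t')"
        then have "s \<in> W n" by (auto simp: words_iff)
        then have "x \<in> cell (j' # t')" using edge_at_x(2) a by blast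
        then have "j' # t' \<in> Out" using a by (auto simp: Out_def)
        then show False using True a by blast
      qed blast
      then show False using l by simp
    qed
    then have "separates (Suc n)" unfolding separates_def using w iD l j by force
    then show ?thesis using separates_chi n by blast
  next
    case False
    then obtain v1 where v1: "v1 \<in> Out" "v1 \<noteq> j # t" by blast
    then obtain j1 t1 where v1_eq: "v1 = j1 # t1" by (cases v1) (auto simp: Out_def words_iff)
    have j1: "j1 \<in> D" "j1 \<noteq> i" "x \<in> cell (j1 # t1)" "t1 \<in> W n"
      using v1 v1_eq by (auto simp: Out_def words_iff)
    have "j \<noteq> j1"
    proof
      assume "j = j1"
      then have "t = t1" using block_cell_unique[OF j(1,2) t(1) j1(4)] t(2) j1(3) by simp
      then show False using v1(2) v1_eq \<open>j = j1\<close> by simp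
    qed
    moreover have "x \<in> cell [j1]" using j1 cell_Cons_subset[of t1 j1] by (auto simp: words_iff)
    ultimately obtain c b b' where y: "y = pt c (of_bool b) (of_bool b')" and nc: "pt c (of_bool (\<not> b)) (of_bool b') \<in> F"
      and uniq: "\<And>s. s \<in> side c b \<Longrightarrow> s \<in> side c (\<not> b) \<Longrightarrow> s = of_bool b'"
      and third: "pt c (of_bool b) (of_bool (\<not> b')) \<in> F \<or> pt c (of_bool (\<not> b)) (of_bool (\<not> b')) \<in> F"
      using two_neighbours_corner[OF j j1(1,2)] by metis
    have cF: "pt c (of_bool b) (of_bool b') \<in> F" using y yF by simp
    obtain k where k: "k \<in> W n" "pt c (of_bool b) (of_bool b') \<in> cell k"
      "idx N c k = (if b then int N ^ n - 1 else 0)" "idx N (\<not> c) k = (if b' then int N ^ n - 1 else 0)"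
      using corner_word[OF cF] by metis
    have bd: "\<exists>e. crd d y = of_bool e" for d
    proof -
      have "\<forall>d. \<exists>e. crd d y = of_bool e" unfolding all_crd_iff[of _ c] y crd_pt by blast
      then show ?thesis by blast
    qed
    show ?thesis
    proof (rule chi_ge_block_end[OF n iD k(1)])
      fix s j' t' assume a: "s \<in> W n" "j' # t' \<in> W (Suc n)" "j' \<noteq> i" "E (i # s) (j' # t')"
      have "y \<in> cell s" using edge_at_x(1)[OF a] x_y gsc_map_mem_cell by simp
      moreover have "y \<in> cell k" using k(2) y by simp
      ultimately show "s = k" using corner_not_crossed[OF a(1) k(1)] bd by blast
    next
      fix u v assume uv: "u \<in> W n" "v \<in> W n" "E k u" "E k v" "u \<noteq> v"
      show "E u v" by (rule corner_neighbours_adjacent[OF cF nc _ third k(1,3,4) uv]) (rule uniq)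
    qed
  qed
qed

end

context carpet
begin

theorem chi_large_if_cut_point:
  assumes x: "cut_point F x" and n: "n \<ge> 1"
  shows "card D ^ n - 1 \<le> chi (W (Suc n)) E"
proof (cases "card D = 2")
  case True
  then show ?thesis using chi_ge_two_digits n by blast
next
  case False
  then have D3: "card D \<ge> 3" using card_D by simp
  show ?thesis
  proof (cases "\<forall>i\<in>D. two_pts (contact i)")
    case True
    obtain m u v where uv: "u \<in> W m" "v \<in> W m" "\<forall>K0. \<exists>K\<ge>K0. \<exists>w\<in>W K. off u w \<and> off v w \<and> \<not> lk K w u v"
      using cut_point_separating_words[OF x] by blast
    obtain K w where K: "K \<ge> Suc n + 2 + m" "w \<in> W K" "off u w" "off v w" "\<not> lk K w u v"
      using uv(3) by blast
    have "separates (Suc n)"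
    proof (rule ccontr)
      assume "\<not> separates (Suc n)"
      from all_linked[OF this _ _ K(1,2) uv(1,2) K(3,4)] True K(5) show False by simp
    qed
    then show ?thesis using separates_chi n by blast
  next
    case False
    then obtain i where i: "i \<in> D" "\<not> two_pts (contact i)" by blast
    obtain z where z: "z \<in> contact i" using contact_ne[OF i(1)] by blast
    then have "contact i = {z}" using i(2) unfolding two_pts_def by blast
    moreover obtain y where "y \<in> F" "z = gsc_map N i y" using z by (auto simp: contact_def cell_def)
    ultimately have "leaf_carpet N D i z y" using i(1) by unfold_locales auto
    then show ?thesis using leaf_carpet.chi_ge_leaf D3 n by blast
  qed
qed

end

theorem mainTheorem1:
  fixes N :: nat and D :: "digit set"
  assumes "N \<ge> 2"
    and "D \<subseteq> {0..<N} \<times> {0..<N}"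
    and "1 < card D" and "card D < N ^ 2"
    and "connected (gsc N D)"
  shows "(\<exists>x. cut_point (gsc N D) x) \<longleftrightarrow>
         (\<forall>k::nat. k \<ge> 2 \<longrightarrow>
            chi (words D k) (hata_edge N D) \<ge> card D ^ (k - 1) - 1)"
proof -
  interpret carpet N D
    using assms by unfold_locales
  show ?thesis
  proof
    assume "\<exists>x. cut_point (gsc N D) x"
    then obtain x where x: "cut_point (gsc N D) x" ..
    show "\<forall>k\<ge>2. card D ^ (k - 1) - 1 \<le> chi (words D k) (hata_edge N D)"
    proof (intro allI impI)
      fix k :: nat
      assume k: "k \<ge> 2"
      then have "k - 1 \<ge> 1" "Suc (k - 1) = k" by auto
      then show "card D ^ (k - 1) - 1 \<le> chi (words D k) (hata_edge N D)"
        using chi_large_if_cut_point[OF x, of "k - 1"] by simp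
    qed
  next
    assume chi: "\<forall>k\<ge>2. card D ^ (k - 1) - 1 \<le> chi (words D k) (hata_edge N D)"
    have "card D ^ n - 1 \<le> chi (words D (Suc n)) (hata_edge N D)" if "n \<ge> 1" for n
      using chi[rule_format, of "Suc n"] that by simp
    then show "\<exists>x. cut_point (gsc N D) x" by (rule cut_point_if_chi_large)
  qed
qed

end
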